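(* Let $\mathsf{X}$ be an irreducible, strictly sofic shift of almost finite type (AFT). Then the Matsumoto algebra $\mathcal{O}_{\mathsf{X}}$ associated to $\mathsf{X}$ is not simple.
   Context: A shift space $\mathsf{X}$ over a finite alphabet $\mathcal{A}$ is a closed shift-invariant subset of $\mathcal{A}^{\mathbf{Z}}$; $\mathcal{B}(\mathsf{X})$ is its language (set of finite words, including the empty word, occurring in its elements). $\mathsf{X}$ is irreducible if for all $u,w\in\mathcal{B}(\mathsf{X})$ there is $v\in\mathcal{B}(\mathsf{X})$ with $uvw\in\mathcal{B}(\mathsf{X})$. $\mathsf{X}$ is of finite type (an SFT) if it can be described by a finite set of forbidden words; a factor map is a continuous shift-commuting surjection between shift spaces; $\mathsf{X}$ is sofic if it is the image of an SFT under a factor map, and strictly sofic if it is sofic and not an SFT. $\mathsf{X}$ is of almost finite type (AFT) if there is an irreducible SFT $\mathsf{Y}$ and a factor map $\pi:\mathsf{Y}\to\mathsf{X}$ that is one-to-one on a nonempty open set. (It is known that a strictly sofic shift is AFT if and only if its left Fischer cover, i.e. the minimal left-resolving labelled graph presenting it, is right-closing. Left-resolving: edges ending at a common vertex carry distinct labels. Right-closing: for some $D\ge0$, any two paths of length $D+1$ with the same initial vertex and the same label have the same first edge.) Let $\mathsf{X}^+$ be the set of right-rays $x_0x_1x_2\dots$ of elements of $\mathsf{X}$. For finite words $u,v\in\mathcal{A}^*$ put $C(u,v)=\{vx : x\in\mathsf{X}^+,\ vx\in\mathsf{X}^+,\ ux\in\mathsf{X}^+\}$. The Matsumoto algebra $\mathcal{O}_{\mathsf{X}}$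 is the universal $C^*$-algebra generated by partial isometries $\{S_u\}_{u\in\mathcal{A}^*}$ such that $S_uS_v=S_{uv}$ for all $u,v\in\mathcal{A}^*$ and such that the assignment $1_{C(u,v)}\mapsto S_vS_u^*S_uS_v^*$ ($u,v\in\mathcal{A}^*$) extends to a $*$-homomorphism from the $C^*$-algebra of bounded functions on $\mathsf{X}^+$ generated by $\{1_{C(u,v)} : u,v\in\mathcal{A}^*\}$ to the algebra generated by $\{S_u\}_{u\in\mathcal{A}^*}$. A $C^*$-algebra is simple if it has no closed two-sided ideals other than $0$ and itself. *)

theory Defs
  imports "HOL-Analysis.Analysis" "HOL-Library.Omega_Words_Fun"
begin

section \<open>Shift spaces\<close>

definition full_shift :: "'a set \<Rightarrow> (int \<Rightarrow> 'a) set" where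
  "full_shift A = {x. range x \<subseteq> A}"

definition shift_topology :: "'a set \<Rightarrow> (int \<Rightarrow> 'a) topology" where
  "shift_topology A = product_topology (\<lambda>_. discrete_topology A) UNIV"

lemma topspace_shift_topology: "topspace (shift_topology A) = full_shift A"
  by (auto simp: shift_topology_def full_shift_def PiE_def)

definition shift_map :: "(int \<Rightarrow> 'a) \<Rightarrow> (int \<Rightarrow> 'a)" where
  "shift_map x = (\<lambda>i. x (i + 1))"

definition shift_space :: "'a set \<Rightarrow> (int \<Rightarrow> 'a) set \<Rightarrow> bool" where
  "shift_space A X \<longleftrightarrow>
     finite A \<and> closedin (shift_topology A) X \<and> shift_map ` X = X"

definition occurs_in :: "'a list \<Rightarrow> (int \<Rightarrow> 'a) \<Rightarrow> bool" where
  "occurs_in w x \<longleftrightarrow> (\<exists>i. \<forall>k<length w. x (i + int k) = w ! k)"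

definition language :: "(int \<Rightarrow> 'a) set \<Rightarrow> 'a list set" where
  "language X = {w. \<exists>x\<in>X. occurs_in w x}"

definition irreducible_shift :: "(int \<Rightarrow> 'a) set \<Rightarrow> bool" where
  "irreducible_shift X \<longleftrightarrow>
     (\<forall>u\<in>language X. \<forall>w\<in>language X. \<exists>v\<in>language X. u @ v @ w \<in> language X)"

definition SFT :: "'a set \<Rightarrow> (int \<Rightarrow> 'a) set \<Rightarrow> bool" where
  "SFT A X \<longleftrightarrow> shift_space A X \<and>
     (\<exists>F. finite F \<and> F \<subseteq> lists A \<and> X = {x \<in> full_shift A. \<forall>w\<in>F. \<not> occurs_in w x})"

definition factor_map ::
  "'b set \<Rightarrow> (int \<Rightarrow> 'b) set \<Rightarrow> 'a set \<Rightarrow> (int \<Rightarrow> 'a) set \<Rightarrow> ((int \<Rightarrow> 'b) \<Rightarrow> (int \<Rightarrow> 'a)) \<Rightarrow> bool" where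
  "factor_map B Y A X \<pi> \<longleftrightarrow>
     continuous_map (subtopology (shift_topology B) Y) (subtopology (shift_topology A) X) \<pi> \<and>
     (\<forall>y\<in>Y. \<pi> (shift_map y) = shift_map (\<pi> y)) \<and> \<pi> ` Y = X"

text \<open>
  The alphabet of the covering shift is an arbitrary finite set; up to renaming
  its letters it is a finite set of natural numbers.
\<close>

definition sofic :: "'a set \<Rightarrow> (int \<Rightarrow> 'a) set \<Rightarrow> bool" where
  "sofic A X \<longleftrightarrow> shift_space A X \<and>
     (\<exists>(B :: nat set) Y \<pi>. SFT B Y \<and> factor_map B Y A X \<pi>)"

definition strictly_sofic :: "'a set \<Rightarrow> (int \<Rightarrow> 'a) set \<Rightarrow> bool" where
  "strictly_sofic A X \<longleftrightarrow> sofic A X \<and> \<not> SFT A X"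

text \<open>
  "One-to-one on a nonempty open set" is injectivity of the restriction of \<open>\<pi>\<close> to
  a nonempty relatively open \<open>U \<subseteq> Y\<close>; points outside \<open>U\<close> may have the same image
  as points of \<open>U\<close>.
\<close>

definition AFT :: "'a set \<Rightarrow> (int \<Rightarrow> 'a) set \<Rightarrow> bool" where
  "AFT A X \<longleftrightarrow> shift_space A X \<and>
     (\<exists>(B :: nat set) Y \<pi>. SFT B Y \<and> irreducible_shift Y \<and> factor_map B Y A X \<pi> \<and>
        (\<exists>U. openin (subtopology (shift_topology B) Y) U \<and> U \<noteq> {} \<and> inj_on \<pi> U))"


section \<open>C*-algebras\<close>

text \<open>C*-algebras are complex and need not be unital; the zero algebra is allowed.\<close>

record 'c star_algebra =
  carr :: "'c set"
  zer :: 'c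
  add :: "'c \<Rightarrow> 'c \<Rightarrow> 'c"
  scl :: "complex \<Rightarrow> 'c \<Rightarrow> 'c"
  mul :: "'c \<Rightarrow> 'c \<Rightarrow> 'c"
  adj :: "'c \<Rightarrow> 'c"
  nrm :: "'c \<Rightarrow> real"

definition dst :: "('c, 'm) star_algebra_scheme \<Rightarrow> 'c \<Rightarrow> 'c \<Rightarrow> real" where
  "dst M x y = nrm M (add M x (scl M (- 1) y))"

locale cstar_algebra =
  fixes M :: "('c, 'm) star_algebra_scheme"
  assumes zer_closed: "zer M \<in> carr M"
    and add_closed: "\<lbrakk>x \<in> carr M; y \<in> carr M\<rbrakk> \<Longrightarrow> add M x y \<in> carr M"
    and scl_closed: "x \<in> carr M \<Longrightarrow> scl M a x \<in> carr M"
    and mul_closed: "\<lbrakk>x \<in> carr M; y \<in> carr M\<rbrakk> \<Longrightarrow> mul M x y \<in> carr M"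
    and adj_closed: "x \<in> carr M \<Longrightarrow> adj M x \<in> carr M"
    and add_assoc: "\<lbrakk>x \<in> carr M; y \<in> carr M; z \<in> carr M\<rbrakk> \<Longrightarrow>
           add M (add M x y) z = add M x (add M y z)"
    and add_commute: "\<lbrakk>x \<in> carr M; y \<in> carr M\<rbrakk> \<Longrightarrow> add M x y = add M y x"
    and add_zer: "x \<in> carr M \<Longrightarrow> add M x (zer M) = x"
    and add_neg: "x \<in> carr M \<Longrightarrow> add M x (scl M (- 1) x) = zer M"
    and scl_add: "\<lbrakk>x \<in> carr M; y \<in> carr M\<rbrakk> \<Longrightarrow>
           scl M a (add M x y) = add M (scl M a x) (scl M a y)"
    and add_scl: "x \<in> carr M \<Longrightarrow> scl M (a + b) x = add M (scl M a x) (scl M b x)"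
    and scl_scl: "x \<in> carr M \<Longrightarrow> scl M a (scl M b x) = scl M (a * b) x"
    and scl_one: "x \<in> carr M \<Longrightarrow> scl M 1 x = x"
    and mul_assoc: "\<lbrakk>x \<in> carr M; y \<in> carr M; z \<in> carr M\<rbrakk> \<Longrightarrow>
           mul M (mul M x y) z = mul M x (mul M y z)"
    and mul_add: "\<lbrakk>x \<in> carr M; y \<in> carr M; z \<in> carr M\<rbrakk> \<Longrightarrow>
           mul M x (add M y z) = add M (mul M x y) (mul M x z)"
    and add_mul: "\<lbrakk>x \<in> carr M; y \<in> carr M; z \<in> carr M\<rbrakk> \<Longrightarrow>
           mul M (add M x y) z = add M (mul M x z) (mul M y z)"
    and scl_mul: "\<lbrakk>x \<in> carr M; y \<in> carr M\<rbrakk> \<Longrightarrow> mul M (scl M a x) y = scl M a (mul M x y)"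
    and mul_scl: "\<lbrakk>x \<in> carr M; y \<in> carr M\<rbrakk> \<Longrightarrow> mul M x (scl M a y) = scl M a (mul M x y)"
    and adj_adj: "x \<in> carr M \<Longrightarrow> adj M (adj M x) = x"
    and adj_add: "\<lbrakk>x \<in> carr M; y \<in> carr M\<rbrakk> \<Longrightarrow> adj M (add M x y) = add M (adj M x) (adj M y)"
    and adj_scl: "x \<in> carr M \<Longrightarrow> adj M (scl M a x) = scl M (cnj a) (adj M x)"
    and adj_mul: "\<lbrakk>x \<in> carr M; y \<in> carr M\<rbrakk> \<Longrightarrow> adj M (mul M x y) = mul M (adj M y) (adj M x)"
    and nrm_nonneg: "x \<in> carr M \<Longrightarrow> 0 \<le> nrm M x"
    and nrm_eq_0: "x \<in> carr M \<Longrightarrow> nrm M x = 0 \<longleftrightarrow> x = zer M"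
    and nrm_add: "\<lbrakk>x \<in> carr M; y \<in> carr M\<rbrakk> \<Longrightarrow> nrm M (add M x y) \<le> nrm M x + nrm M y"
    and nrm_scl: "x \<in> carr M \<Longrightarrow> nrm M (scl M a x) = cmod a * nrm M x"
    and nrm_mul: "\<lbrakk>x \<in> carr M; y \<in> carr M\<rbrakk> \<Longrightarrow> nrm M (mul M x y) \<le> nrm M x * nrm M y"
    and cstar_identity: "x \<in> carr M \<Longrightarrow> nrm M (mul M (adj M x) x) = (nrm M x)\<^sup>2"
    and complete: "\<lbrakk>range \<sigma> \<subseteq> carr M;
           \<And>e. e > 0 \<Longrightarrow> \<exists>N. \<forall>m\<ge>N. \<forall>n\<ge>N. dst M (\<sigma> m) (\<sigma> n) < e\<rbrakk> \<Longrightarrow>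
           \<exists>l\<in>carr M. (\<lambda>n. dst M (\<sigma> n) l) \<longlonglongrightarrow> 0"

definition norm_closed :: "('c, 'm) star_algebra_scheme \<Rightarrow> 'c set \<Rightarrow> bool" where
  "norm_closed M H \<longleftrightarrow>
     (\<forall>\<sigma> l. range \<sigma> \<subseteq> H \<longrightarrow> l \<in> carr M \<longrightarrow> (\<lambda>n. dst M (\<sigma> n) l) \<longlonglongrightarrow> 0 \<longrightarrow> l \<in> H)"

definition cstar_subalgebra :: "('c, 'm) star_algebra_scheme \<Rightarrow> 'c set \<Rightarrow> bool" where
  "cstar_subalgebra M H \<longleftrightarrow> H \<subseteq> carr M \<and> zer M \<in> H \<and>
     (\<forall>x\<in>H. \<forall>y\<in>H. add M x y \<in> H \<and> mul M x y \<in> H) \<and>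
     (\<forall>x\<in>H. adj M x \<in> H \<and> (\<forall>a. scl M a x \<in> H)) \<and> norm_closed M H"

definition cstar_generated ::
  "('c, 'm) star_algebra_scheme \<Rightarrow> 'c set \<Rightarrow> ('c, 'm) star_algebra_scheme" where
  "cstar_generated M G = M\<lparr>carr := \<Inter>{H. cstar_subalgebra M H \<and> G \<subseteq> H}\<rparr>"

definition star_hom ::
  "('c, 'm) star_algebra_scheme \<Rightarrow> ('d, 'n) star_algebra_scheme \<Rightarrow> ('c \<Rightarrow> 'd) \<Rightarrow> bool" where
  "star_hom M N \<phi> \<longleftrightarrow> \<phi> ` carr M \<subseteq> carr N \<and>
     (\<forall>x\<in>carr M. \<forall>y\<in>carr M. \<phi> (add M x y) = add N (\<phi> x) (\<phi> y) \<and>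
                             \<phi> (mul M x y) = mul N (\<phi> x) (\<phi> y)) \<and>
     (\<forall>x\<in>carr M. \<phi> (adj M x) = adj N (\<phi> x) \<and> (\<forall>a. \<phi> (scl M a x) = scl N a (\<phi> x)))"

definition partial_isometry :: "('c, 'm) star_algebra_scheme \<Rightarrow> 'c \<Rightarrow> bool" where
  "partial_isometry M s \<longleftrightarrow> s \<in> carr M \<and> mul M (mul M s (adj M s)) s = s"

definition closed_ideal :: "('c, 'm) star_algebra_scheme \<Rightarrow> 'c set \<Rightarrow> bool" where
  "closed_ideal M I \<longleftrightarrow> I \<subseteq> carr M \<and> zer M \<in> I \<and>
     (\<forall>x\<in>I. \<forall>y\<in>I. add M x y \<in> I) \<and> (\<forall>x\<in>I. \<forall>a. scl M a x \<in> I) \<and>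
     (\<forall>x\<in>I. \<forall>y\<in>carr M. mul M x y \<in> I \<and> mul M y x \<in> I) \<and> norm_closed M I"

definition simple_cstar :: "('c, 'm) star_algebra_scheme \<Rightarrow> bool" where
  "simple_cstar M \<longleftrightarrow> (\<forall>I. closed_ideal M I \<longrightarrow> I = {zer M} \<or> I = carr M)"

text \<open>
  Functions on a set \<open>Z\<close> are represented by functions on the whole type vanishing
  outside \<open>Z\<close>. The 0 inserted in the supremum only matters for empty \<open>Z\<close>.
\<close>

definition bounded_functions :: "'z set \<Rightarrow> ('z \<Rightarrow> complex) star_algebra" where
  "bounded_functions Z =
     \<lparr>carr = {f. bounded (f ` Z) \<and> (\<forall>z. z \<notin> Z \<longrightarrow> f z = 0)},
      zer = (\<lambda>_. 0),
      add = (\<lambda>f g z. f z + g z),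
      scl = (\<lambda>a f z. a * f z),
      mul = (\<lambda>f g z. f z * g z),
      adj = (\<lambda>f z. cnj (f z)),
      nrm = (\<lambda>f. Sup (insert 0 ((\<lambda>z. cmod (f z)) ` Z)))\<rparr>"


section \<open>The Matsumoto algebra\<close>

definition right_rays :: "(int \<Rightarrow> 'a) set \<Rightarrow> (nat \<Rightarrow> 'a) set" where
  "right_rays X = {\<lambda>n. x (int n) | x. x \<in> X}"

definition cyl :: "(int \<Rightarrow> 'a) set \<Rightarrow> 'a list \<Rightarrow> 'a list \<Rightarrow> (nat \<Rightarrow> 'a) set" where
  "cyl X u v = {v \<frown> x | x. x \<in> right_rays X \<and> v \<frown> x \<in> right_rays X \<and> u \<frown> x \<in> right_rays X}"

definition cyl_algebra :: "'a set \<Rightarrow> (int \<Rightarrow> 'a) set \<Rightarrow> ((nat \<Rightarrow> 'a) \<Rightarrow> complex) star_algebra" where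
  "cyl_algebra A X =
     cstar_generated (bounded_functions (right_rays X))
       {indicator (cyl X u v) | u v. u \<in> lists A \<and> v \<in> lists A}"

definition matsumoto_family ::
  "'a set \<Rightarrow> (int \<Rightarrow> 'a) set \<Rightarrow> 'c star_algebra \<Rightarrow> ('a list \<Rightarrow> 'c) \<Rightarrow> bool" where
  "matsumoto_family A X M S \<longleftrightarrow>
     (\<forall>u\<in>lists A. partial_isometry M (S u)) \<and>
     (\<forall>u\<in>lists A. \<forall>v\<in>lists A. mul M (S u) (S v) = S (u @ v)) \<and>
     (\<exists>\<phi>. star_hom (cyl_algebra A X) (cstar_generated M (S ` lists A)) \<phi> \<and>
        (\<forall>u\<in>lists A. \<forall>v\<in>lists A.
           \<phi> (indicator (cyl X u v)) =
             mul M (mul M (mul M (S v) (adj M (S u))) (S u)) (adj M (S v))))"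

text \<open>
  HOL cannot quantify over all C*-algebras of all types, so the universal property
  is tested on the algebras carried by one fixed type. This is no restriction: only
  the C*-subalgebra generated by the countable family \<open>T ` lists A\<close> matters; it is
  separable, hence has at most continuum many elements and is isomorphic to an
  algebra carried by this type (which also contains all operators on the Hilbert
  space of square summable sequences).
\<close>

type_synonym test_carrier = "(nat \<Rightarrow> complex) \<Rightarrow> (nat \<Rightarrow> complex)"

text \<open>
  \<open>M\<close>, together with the generators \<open>S\<close>, is the universal C*-algebra of the
  relations \<^const>\<open>matsumoto_family\<close>. The homomorphism \<open>\<psi>\<close> is unique, as \<open>M\<close> is
  generated by \<open>S ` lists A\<close> and homomorphisms of C*-algebras are continuous.
\<close>

definition matsumoto_algebra ::
  "'a set \<Rightarrow> (int \<Rightarrow> 'a) set \<Rightarrow> 'c star_algebra \<Rightarrow> ('a list \<Rightarrow> 'c) \<Rightarrow> bool" where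
  "matsumoto_algebra A X M S \<longleftrightarrow>
     cstar_algebra M \<and> matsumoto_family A X M S \<and>
     carr (cstar_generated M (S ` lists A)) = carr M \<and>
     (\<forall>(N :: test_carrier star_algebra) T. cstar_algebra N \<and> matsumoto_family A X N T \<longrightarrow>
        (\<exists>\<psi>. star_hom M N \<psi> \<and> (\<forall>u\<in>lists A. \<psi> (S u) = T u)))"

end

theory Submission
  imports Defs
begin

text \<open>
  Every countable set \<open>R\<close> of right rays that is closed under tails and under admissible prefixes
  carries a representation of the Matsumoto relations on \<open>\<ell>\<^sup>2(R)\<close> in which \<open>S\<^sub>u\<close> maps the basis vector
  of \<open>x\<close> to that of \<open>ux\<close>; there \<open>S\<^sub>u\<^sup>* S\<^sub>u S\<^sub>v\<^sup>* S\<^sub>v\<close> is the projection onto the rays \<open>x\<close> for which both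
  \<open>ux\<close> and \<open>vx\<close> are admissible. It therefore suffices to find a ray \<open>z\<close> and words \<open>u\<close>, \<open>v\<close> with
  \<open>uz\<close>, \<open>vz\<close> admissible, and a second ray \<open>r\<close> such that no ray tail-equivalent to \<open>r\<close> may be preceded
  by both \<open>u\<close> and \<open>v\<close>: the projection then survives in the representation on the tail class of \<open>z\<close>
  and dies on that of \<open>r\<close>. The closure of the kernel of the second representation is a proper ideal,
  since a dense ideal would contain an invertible element.

  For \<open>r\<close> take a ray containing infinitely often a magic word \<open>W\<close> of an irreducible SFT cover that is
  injective on an open set. Such a cover is right- and left-closing. Suppose that whenever \<open>uz\<close> and
  \<open>vz\<close> are admissible, some \<open>upW\<close> and \<open>vpW\<close> are admissible too. If \<open>X\<close> is not an SFT, there are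
  admissible \<open>u t\<close>, \<open>t v\<close> with \<open>t\<close> arbitrarily long and \<open>u t v\<close> forbidden. Lifts of \<open>W s t v\<close> and
  \<open>W s t p W\<close> through a common block over the first \<open>W\<close> coincide on most of \<open>t\<close>, and so do
  lifts of \<open>W s t p W\<close> and \<open>u t p W\<close> through a common block over the last \<open>W\<close>; crossing from the last
  of these lifts to the first one inside \<open>t\<close> produces \<open>u t v\<close>, a contradiction.
\<close>

section \<open>Bi-closing covers\<close>

text \<open>Failure of finite type concerns finite words, whereas the common continuation
  \<open>p W\<close> is available only for words that precede a common infinite ray. The long
  overlaps \<open>t\<close> therefore have to converge to a ray while the words on their left stay
  fixed; finiteness of the number of follower sets makes this possible.

  The magic word does double duty. Its recurrence defines \<open>r\<close>, and it is where lifts of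
  different points can be made to start in, or to end in, the same block. Closing then forces such
  lifts to coincide except within a bounded distance of the place where their images part. This
  distance on both sides, plus room for one gluing window, is how long the overlap must be.

  On the algebraic side, closing up the kernel and solving one affine equation by a Neumann series
  takes the place of automatic continuity of homomorphisms. Only countable sets of rays occur, so
  that all representations act on sequences and fit into the type on which the universal property is
  tested.\<close>

definition agree :: "nat \<Rightarrow> (int \<Rightarrow> 'b) \<Rightarrow> (int \<Rightarrow> 'b) \<Rightarrow> bool" where
  "agree m x y \<longleftrightarrow> (\<forall>i. \<bar>i\<bar> \<le> int m \<longrightarrow> x i = y i)"

definition translate :: "int \<Rightarrow> (int \<Rightarrow> 'b) \<Rightarrow> int \<Rightarrow> 'b" where
  "translate k x = (\<lambda>i. x (i + k))"

text \<open>Reversing time lets left-sided statements be read off from right-sided ones.\<close>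

definition flip :: "(int \<Rightarrow> 'b) \<Rightarrow> int \<Rightarrow> 'b" where
  "flip x = (\<lambda>i. x (- i))"

lemma translate_apply [simp]: "translate k x i = x (i + k)"
  by (simp add: translate_def)

lemma translate_translate [simp]: "translate k (translate l x) = translate (k + l) x"
  by (simp add: translate_def add.assoc)

lemma translate_0 [simp]: "translate 0 x = x"
  by (simp add: translate_def)

lemma flip_apply [simp]: "flip x i = x (- i)"
  by (simp add: flip_def)

lemma flip_flip [simp]: "flip (flip x) = x"
  by (simp add: flip_def)

lemma agree_mono: "agree m x y \<Longrightarrow> k \<le> m \<Longrightarrow> agree k x y"
  by (auto simp: agree_def)

lemma agree_sym: "agree m x y \<Longrightarrow> agree m y x"
  by (auto simp: agree_def)

lemma agree_trans: "agree m x y \<Longrightarrow> agree m y z \<Longrightarrow> agree m x z"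
  by (auto simp: agree_def)

lemma agree_flip [simp]: "agree m (flip x) (flip y) \<longleftrightarrow> agree m x y"
  unfolding agree_def by (metis abs_minus flip_apply minus_minus)

lemma agree_translateD: "agree m (translate k x) y \<Longrightarrow> \<bar>i - k\<bar> \<le> int m \<Longrightarrow> x i = y (i - k)"
  unfolding agree_def by (metis diff_add_cancel translate_apply)

section \<open>Compactness of sequence spaces over a finite alphabet\<close>

lemma konig_nat:
  fixes f :: "nat \<Rightarrow> nat \<Rightarrow> 'b"
  assumes "finite B" "\<And>n i. f n i \<in> B" "infinite I"
  shows "\<exists>g. \<forall>k. infinite {n \<in> I. \<forall>i<k. f n i = g i}"
proof -
  \<comment> \<open>By the pigeonhole principle infinitely many indices survive each time one more
    coordinate is fixed. Keeping infinite index sets instead of one subsequence allows later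
    arguments to choose indices as large as they want.\<close>
  have "\<exists>J. (J 0 = I \<and> (\<forall>k. infinite (J k))) \<and> (\<forall>k. J (Suc k) \<subseteq> J k \<and> (\<exists>b. \<forall>n\<in>J (Suc k). f n k = b))"
  proof -
    have "\<exists>J. \<forall>k. (infinite (J k) \<and> (k = 0 \<longrightarrow> J k = I)) \<and> (J (Suc k) \<subseteq> J k \<and> (\<exists>b. \<forall>n\<in>J (Suc k). f n k = b))"
    proof (rule dependent_nat_choice)
      show "\<exists>x. infinite x \<and> (0 = (0::nat) \<longrightarrow> x = I)" using assms by auto
      fix x :: "nat set" and k :: nat assume "infinite x \<and> (k = 0 \<longrightarrow> x = I)"
      then have inf: "infinite x" by simp
      have "finite ((\<lambda>n. f n k) ` x)" using assms(1,2) by (auto intro: finite_subset)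
      then obtain a where "a \<in> x" "infinite {n \<in> x. f n k = f a k}"
        using pigeonhole_infinite[OF inf] by blast
      then show "\<exists>y. (infinite y \<and> (Suc k = 0 \<longrightarrow> y = I)) \<and> y \<subseteq> x \<and> (\<exists>b. \<forall>n\<in>y. f n k = b)"
        by (intro exI[of _ "{n \<in> x. f n k = f a k}"]) auto
    qed
    then obtain J where "\<forall>k. (infinite (J k) \<and> (k = 0 \<longrightarrow> J k = I)) \<and> (J (Suc k) \<subseteq> J k \<and> (\<exists>b. \<forall>n\<in>J (Suc k). f n k = b))" ..
    then show ?thesis by (intro exI[of _ J]) simp
  qed
  then obtain J where J: "J 0 = I" "\<And>k. infinite (J k)" "\<And>k. J (Suc k) \<subseteq> J k"
    and "\<forall>k. \<exists>b. \<forall>n\<in>J (Suc k). f n k = b" by blast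
  then obtain g where g: "\<And>k n. n \<in> J (Suc k) \<Longrightarrow> f n k = g k" by metis
  have dec: "J l \<subseteq> J k" if "k \<le> l" for k l using lift_Suc_antimono_le[of J] J(3) that by blast
  have "J k \<subseteq> {n \<in> I. \<forall>i<k. f n i = g i}" for k
    using dec[of 0 k] J(1) g dec by (auto simp: subset_iff) (meson Suc_leI)
  then show ?thesis using J(2) by (meson infinite_super)
qed

lemma konig_int:
  fixes f :: "nat \<Rightarrow> int \<Rightarrow> 'b"
  assumes "finite B" "\<And>n i. f n i \<in> B" "infinite I"
  shows "\<exists>g. \<forall>k. infinite {n \<in> I. agree k (f n) g}"
proof -
  obtain g where g: "\<forall>k. infinite {n \<in> I. \<forall>i<k. f n (int_decode i) = g i}"
    using konig_nat[of B "\<lambda>n i. f n (int_decode i)" I] assms by auto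
  have "infinite {n \<in> I. agree k (f n) (\<lambda>i. g (int_encode i))}" for k
  proof -
    have "finite (int_encode ` {-int k..int k})" by simp
    then obtain N where N: "int_encode ` {-int k..int k} \<subseteq> {..<N}"
      using finite_nat_iff_bounded by blast
    have "{n \<in> I. \<forall>i<N. f n (int_decode i) = g i} \<subseteq> {n \<in> I. agree k (f n) (\<lambda>i. g (int_encode i))}"
    proof (clarsimp simp: agree_def)
      fix n i assume h: "\<forall>i<N. f n (int_decode i) = g i" "\<bar>i\<bar> \<le> int k"
      then have "i \<in> {-int k..int k}" by auto
      then have "int_encode i < N" using N by blast
      then show "f n i = g (int_encode i)" using h(1) by force
    qed
    then show ?thesis using g infinite_super by blast
  qed
  then show ?thesis by blast
qed

text \<open>Closedness is stated through central windows, the form in which the compactness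
  arguments use it.\<close>

locale closed_shift =
  fixes A :: "'a set" and X :: "(int \<Rightarrow> 'a) set"
  assumes finite_alphabet: "finite A"
    and range_sub: "x \<in> X \<Longrightarrow> x i \<in> A"
    and translate_in: "x \<in> X \<Longrightarrow> translate k x \<in> X"
    and limit_in: "(\<And>m. \<exists>y\<in>X. agree m y x) \<Longrightarrow> x \<in> X"
begin

lemma sequence_limit:
  assumes "\<And>n::nat. f n \<in> X" "infinite I"
  obtains g where "g \<in> X" "\<And>k. infinite {n \<in> I. agree k (f n) g}"
proof -
  obtain g where g: "\<forall>k. infinite {n \<in> I. agree k (f n) g}"
    using konig_int[OF finite_alphabet, of f I] assms range_sub by auto
  have "\<exists>y\<in>X. agree m y g" for m
  proof -
    have "{n \<in> I. agree m (f n) g} \<noteq> {}" using g by (metis finite.emptyI)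
    then show ?thesis using assms(1) by blast
  qed
  then show ?thesis using that[of g] g limit_in by blast
qed

end

lemma openin_shift_cylinder:
  assumes "openin (shift_topology A) U" "x \<in> U"
  obtains m where "\<And>y. y \<in> full_shift A \<Longrightarrow> agree m y x \<Longrightarrow> y \<in> U"
proof -
  obtain V where V: "finite {i. V i \<noteq> A}" "\<forall>i. V i \<subseteq> A"
      "x \<in> Pi\<^sub>E UNIV V" "Pi\<^sub>E UNIV V \<subseteq> U"
    using assms unfolding shift_topology_def openin_product_topology_alt by force
  have "finite (nat ` abs ` {i. V i \<noteq> A})" using V(1) by simp
  then obtain m where m: "nat ` abs ` {i. V i \<noteq> A} \<subseteq> {..<m}"
    using finite_nat_iff_bounded by blast
  show ?thesis
  proof
    fix y assume y: "y \<in> full_shift A" "agree m y x"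
    have "y i \<in> V i" for i
    proof (cases "V i = A")
      case True then show ?thesis using y(1) by (auto simp: full_shift_def)
    next
      case False
      then have "nat \<bar>i\<bar> < m" using m by blast
      then have "y i = x i" using y(2) by (simp add: agree_def)
      then show ?thesis using V(3) by (auto simp: PiE_iff)
    qed
    then show "y \<in> U" using V(4) by (auto simp: PiE_iff)
  qed
qed

lemma shift_space_closed_shift:
  assumes "shift_space A X" shows "closed_shift A X"
proof
  note s = assms[unfolded shift_space_def]
  have sub: "X \<subseteq> full_shift A" using s closedin_subset topspace_shift_topology by metis
  show "finite A" using s by simp
  show "x i \<in> A" if "x \<in> X" for x i using sub that by (auto simp: full_shift_def)
  have up: "translate (int n) x \<in> X" if "x \<in> X" for x n
  proof (induction n)
    case (Suc n)
    then have "shift_map (translate (int n) x) \<in> X" using s by blast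
    then show ?case by (simp add: shift_map_def translate_def add.commute add.left_commute)
  qed (use that in simp)
  \<comment> \<open>Surjectivity of the shift on \<open>X\<close> supplies the preimages that
    negative translations need.\<close>
  have down: "translate (- int n) x \<in> X" if "x \<in> X" for x n
  proof (induction n)
    case (Suc n)
    then obtain y where y: "y \<in> X" "translate (- int n) x = shift_map y" using s by blast
    have "translate (- int (Suc n)) x = y"
    proof
      fix i show "translate (- int (Suc n)) x i = y i"
        using fun_cong[OF y(2), of "i - 1"] by (simp add: shift_map_def algebra_simps)
    qed
    then show ?case using y by simp
  qed (use that in simp)
  show "translate k x \<in> X" if "x \<in> X" for x k
    by (cases k rule: int_cases2) (use up down that in auto)
  show "x \<in> X" if lim: "\<And>m. \<exists>y\<in>X. agree m y x" for x
  proof (rule ccontr)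
    assume "x \<notin> X"
    have "x i \<in> A" for i
    proof -
      obtain y where y: "y \<in> X" "agree (nat \<bar>i\<bar>) y x" using lim by blast
      then have "y i \<in> A" using sub by (auto simp: full_shift_def)
      then show ?thesis using y(2) by (simp add: agree_def)
    qed
    then have "x \<in> full_shift A" by (auto simp: full_shift_def)
    then have "x \<in> full_shift A - X" using \<open>x \<notin> X\<close> by simp
    moreover have "openin (shift_topology A) (full_shift A - X)"
      using s by (simp add: closedin_def topspace_shift_topology)
    ultimately obtain m where "\<And>y. y \<in> full_shift A \<Longrightarrow> agree m y x \<Longrightarrow> y \<in> full_shift A - X"
      using openin_shift_cylinder by metis
    then show False using lim[of m] sub by blast
  qed
qed

text \<open>What is retained of an SFT cover that is injective on an open set. One radius
  \<open>K\<close> serves as gluing window and as coding radius of \<open>\<pi>\<close>. The open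
  set has shrunk to a cylinder around \<open>p\<close>. The bound on \<open>k\<close> in
  \<open>transitive\<close> allows a point to be altered to the right of \<open>k\<close> without
  touching its window around 0.\<close>

locale cover = closed_shift B Y
  for B :: "'b set" and Y :: "(int \<Rightarrow> 'b) set" +
  fixes \<pi> :: "(int \<Rightarrow> 'b) \<Rightarrow> int \<Rightarrow> 'a" and K :: nat
  assumes glue: "y \<in> Y \<Longrightarrow> y' \<in> Y \<Longrightarrow> agree K y y' \<Longrightarrow> (\<lambda>i. if i \<le> 0 then y i else y' i) \<in> Y"
    and map_translate: "y \<in> Y \<Longrightarrow> \<pi> (translate k y) = translate k (\<pi> y)"
    and map_local: "y \<in> Y \<Longrightarrow> y' \<in> Y \<Longrightarrow> agree K y y' \<Longrightarrow> \<pi> y 0 = \<pi> y' 0"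
    and injective: "\<exists>p\<in>Y. \<exists>m. \<forall>y\<in>Y. \<forall>y'\<in>Y. agree m y p \<longrightarrow> agree m y' p \<longrightarrow> \<pi> y = \<pi> y' \<longrightarrow> y = y'"
    and transitive: "y \<in> Y \<Longrightarrow> y' \<in> Y \<Longrightarrow>
      \<exists>z\<in>Y. \<exists>k\<ge>int M. agree M z y \<and> agree M (translate k z) y'"
begin

section \<open>Closing properties, magic words and crossing\<close>

lemma glue_at:
  assumes "y \<in> Y" "y' \<in> Y" "\<And>i. \<bar>i - h\<bar> \<le> int K \<Longrightarrow> y i = y' i"
  shows "(\<lambda>i. if i \<le> h then y i else y' i) \<in> Y"
proof -
  have "agree K (translate h y) (translate h y')" using assms(3) by (simp add: agree_def)
  then have "(\<lambda>i. if i \<le> 0 then translate h y i else translate h y' i) \<in> Y" (is "?g \<in> Y")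
    using glue assms translate_in by blast
  moreover have "translate (-h) ?g = (\<lambda>i. if i \<le> h then y i else y' i)" by auto
  ultimately show ?thesis using translate_in by metis
qed

lemma map_local_at:
  assumes "y \<in> Y" "y' \<in> Y" "\<And>i. \<bar>i - h\<bar> \<le> int K \<Longrightarrow> y i = y' i"
  shows "\<pi> y h = \<pi> y' h"
proof -
  have "agree K (translate h y) (translate h y')" using assms(3) by (simp add: agree_def)
  then have "\<pi> (translate h y) 0 = \<pi> (translate h y') 0" 
    using map_local assms translate_in by blast
  then show ?thesis using assms by (simp add: map_translate)
qed

text \<open>Irreducibility replaces the common past of \<open>y\<close> and \<open>y'\<close> by one
  that passes through the cylinder on which \<open>\<pi>\<close> is injective. The two new points
  still have equal images, hence are equal, and so are the right halves of \<open>y\<close> and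
  \<open>y'\<close>.\<close>

lemma right_closing:
  assumes y: "y \<in> Y" "y' \<in> Y" and left: "\<And>i. i \<le> 0 \<Longrightarrow> y i = y' i" and eq: "\<pi> y = \<pi> y'"
  shows "y = y'"
proof -
  obtain p m where p: "p \<in> Y" and inj: "\<And>z z'. z \<in> Y \<Longrightarrow> z' \<in> Y \<Longrightarrow> agree m z p \<Longrightarrow> agree m z' p \<Longrightarrow> \<pi> z = \<pi> z' \<Longrightarrow> z = z'"
    using injective by blast
  define M where "M = max m K"
  \<comment> \<open>The splice is made at coordinate -3K of \<open>y\<close> and \<open>y'\<close>,
    so that the gluing window around it and the coding windows of all coordinates up to it lie where
    the two points agree.\<close>
  define t where "t = translate (- int (3 * K)) y"
  obtain w k where w: "w \<in> Y" "k \<ge> int M" "agree M w p" "agree M (translate k w) t"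
    using transitive[OF p, of t M] translate_in[OF y(1)] unfolding t_def by blast
  define g where "g v = (\<lambda>i. if i \<le> k then w i else translate (- k - int (3 * K)) v i)" for v
  have wt: "w i = y (i - k - 3 * K)" if "\<bar>i - k\<bar> \<le> int K" for i
    using agree_translateD[OF w(4), of i] that by (simp add: t_def M_def algebra_simps)
  have wt': "w i = y' (i - k - 3 * K)" if "\<bar>i - k\<bar> \<le> int K" for i
    using wt[OF that] left[of "i - k - 3 * K"] that by simp
  have gin: "g y \<in> Y" "g y' \<in> Y"
    unfolding g_def using wt wt' y w(1) 
    by (intro glue_at translate_in; simp add: algebra_simps)+
  have ag: "agree m (g y) p" "agree m (g y') p"
    using w(2,3) by (auto simp: agree_def g_def M_def)
  have same: "g y i = g y' i" if "i \<le> k + 3 * K" for i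
    using that left[of "i - k - 3 * K"] by (auto simp: g_def algebra_simps)
  have tail: "g y i = translate (- k - int (3 * K)) y i" "g y' i = translate (- k - int (3 * K)) y' i"
    if "i \<ge> k - int K" for i
    using that wt[of i] wt'[of i] by (auto simp: g_def algebra_simps)
  \<comment> \<open>Up to the splice both points have the same coding windows; beyond it the windows
    show translates of \<open>y\<close> and \<open>y'\<close>, whose images agree by
    assumption.\<close>
  have "\<pi> (g y) i = \<pi> (g y') i" for i
  proof (cases "i \<le> k")
    case True
    then show ?thesis using same by (intro map_local_at gin) auto
  next
    case False
    have "\<pi> (g y) i = \<pi> (translate (- k - int (3 * K)) y) i"
      using False tail by (intro map_local_at gin translate_in y) auto
    also have "\<dots> = \<pi> (translate (- k - int (3 * K)) y') i" using y eq by (simp add: map_translate)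
    also have "\<dots> = \<pi> (g y') i"
      using False tail by (intro map_local_at gin translate_in y) auto
    finally show ?thesis .
  qed
  then have gg: "g y = g y'" using inj[OF gin ag] by blast
  show ?thesis
  proof
    fix i show "y i = y' i"
    proof (cases "i \<le> 0")
      case False
      then show ?thesis using fun_cong[OF gg, of "i + k + 3 * K"]
        by (simp add: g_def split: if_splits)
    qed (rule left)
  qed
qed

text \<open>Compactness turns right closing into a uniform delay: counterexamples for every
  \<open>D\<close> would have two limit points with equal pasts and equal images that still differ
  at coordinate K+1.\<close>

lemma right_delay_one:
  "\<exists>D. \<forall>y\<in>Y. \<forall>y'\<in>Y. agree K y y' \<longrightarrow> (\<forall>i. 0 \<le> i \<and> i \<le> int D \<longrightarrow> \<pi> y i = \<pi> y' i) \<longrightarrow>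
     y (int K + 1) = y' (int K + 1)"
proof (rule ccontr)
  assume "\<not> ?thesis"
  then have "\<forall>D. \<exists>y y'. y \<in> Y \<and> y' \<in> Y \<and> agree K y y' \<and> (\<forall>i. 0 \<le> i \<and> i \<le> int D \<longrightarrow> \<pi> y i = \<pi> y' i) \<and> y (int K + 1) \<noteq> y' (int K + 1)"
    by blast
  then obtain f f' where f: "\<And>D. f D \<in> Y" "\<And>D. f' D \<in> Y" "\<And>D. agree K (f D) (f' D)"
    "\<And>D i. 0 \<le> i \<Longrightarrow> i \<le> int D \<Longrightarrow> \<pi> (f D) i = \<pi> (f' D) i"
    "\<And>D. f D (int K + 1) \<noteq> f' D (int K + 1)"
    by metis
  \<comment> \<open>The members of a bad pair agree only on a window. Splicing the left half of
    \<open>f D\<close> to the right half of \<open>f' D\<close> gives a partner of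
    \<open>f D\<close> that shares its whole past.\<close>
  define e where "e D = (\<lambda>i. if i \<le> 0 then f D i else f' D i)" for D
  have e: "e D \<in> Y" for D unfolding e_def using glue f by blast
  have eleft: "f D i = e D i" if "i \<le> int K" for D i
    using that f(3)[of D] by (auto simp: e_def agree_def)
  have eright: "f' D i = e D i" if "i \<ge> - int K" for D i
    using that f(3)[of D] by (auto simp: e_def agree_def)
  have pie: "\<pi> (f D) i = \<pi> (e D) i" if "i \<le> int D" for D i
  proof (cases "i \<le> 0")
    case True then show ?thesis using eleft by (intro map_local_at f e) auto
  next
    case False
    then have "\<pi> (f' D) i = \<pi> (e D) i" using eright by (intro map_local_at f e) auto
    then show ?thesis using f(4)[of i D] False that by simp
  qed
  obtain g where g: "g \<in> Y" "\<And>k. infinite {n \<in> UNIV. agree k (f n) g}"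
    using sequence_limit[of f UNIV] f(1) by auto
  \<comment> \<open>\<open>r\<close> selects indices along which \<open>f\<close> converges; a
    second extraction along \<open>r\<close> makes \<open>e\<close> converge as well.\<close>
  define I where "I k = {n. agree k (f n) g}" for k
  have "\<forall>k. \<exists>n. n \<in> I k \<and> n \<ge> k" using g(2) unfolding I_def by (metis (mono_tags, lifting) UNIV_I infinite_nat_iff_unbounded_le mem_Collect_eq)
  then obtain r where "\<forall>k. r k \<in> I k \<and> r k \<ge> k" using choice[of "\<lambda>k n. n \<in> I k \<and> n \<ge> k"] by blast
  then have r: "\<And>k. agree k (f (r k)) g" "\<And>k. r k \<ge> k" by (auto simp: I_def)
  obtain g' where g': "g' \<in> Y" "\<And>k. infinite {n \<in> UNIV. agree k (e (r n)) g'}"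
    using sequence_limit[of "\<lambda>n. e (r n)" UNIV] e by auto
  have approx: "\<exists>n. agree k (f n) g \<and> agree k (e n) g' \<and> n \<ge> k" for k
  proof -
    obtain n where "n \<ge> k" "agree k (e (r n)) g'"
      using g'(2)[of k] by (metis (mono_tags, lifting) infinite_nat_iff_unbounded_le mem_Collect_eq)
    then show ?thesis using r agree_mono le_trans by blast
  qed
  have "g i = g' i" if "i \<le> 0" for i
  proof -
    obtain n where "agree (nat \<bar>i\<bar>) (f n) g" "agree (nat \<bar>i\<bar>) (e n) g'" using approx by blast
    then show ?thesis using eleft[of i n] that by (auto simp: agree_def)
  qed
  moreover have "\<pi> g i = \<pi> g' i" for i
  proof -
    obtain n where n: "agree (nat \<bar>i\<bar> + K) (f n) g" "agree (nat \<bar>i\<bar> + K) (e n) g'" "n \<ge> nat \<bar>i\<bar> + K"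
      using approx by blast
    have "\<pi> g i = \<pi> (f n) i" using n(1) by (intro map_local_at f g) (auto simp: agree_def)
    also have "\<dots> = \<pi> (e n) i" using n(3) by (intro pie) auto
    also have "\<dots> = \<pi> g' i" using n(2) by (intro map_local_at e g') (auto simp: agree_def)
    finally show ?thesis .
  qed
  ultimately have "g = g'" using right_closing g(1) g'(1) by blast
  obtain n where "agree (K + 1) (f n) g" "agree (K + 1) (e n) g'" using approx by blast
  then have "f n (int K + 1) = g (int K + 1)" "e n (int K + 1) = g' (int K + 1)"
    by (auto simp: agree_def)
  then show False using \<open>g = g'\<close> eright[of "int K + 1" n] f(5)[of n] by simp
qed

text \<open>The one-step delay is iterated. Each step moves the window of agreement by one
  coordinate, as long as the images are known to agree up to \<open>D\<close> coordinates beyond the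
  centre of the window.\<close>

lemma right_delay:
  obtains D where "\<And>y y' h n i. y \<in> Y \<Longrightarrow> y' \<in> Y \<Longrightarrow> (\<And>i. \<bar>i - h\<bar> \<le> int K \<Longrightarrow> y i = y' i) \<Longrightarrow>
     (\<And>i. h \<le> i \<Longrightarrow> i \<le> n \<Longrightarrow> \<pi> y i = \<pi> y' i) \<Longrightarrow> h \<le> i \<Longrightarrow> i \<le> n - int D \<Longrightarrow> y i = y' i"
proof -
  obtain D where D: "\<And>y y'. y \<in> Y \<Longrightarrow> y' \<in> Y \<Longrightarrow> agree K y y' \<Longrightarrow>
      (\<And>i. 0 \<le> i \<Longrightarrow> i \<le> int D \<Longrightarrow> \<pi> y i = \<pi> y' i) \<Longrightarrow> y (int K + 1) = y' (int K + 1)"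
    using right_delay_one by blast
  have "y i = y' i"
    if y: "y \<in> Y" "y' \<in> Y" and ag: "\<And>i. \<bar>i - h\<bar> \<le> int K \<Longrightarrow> y i = y' i"
      and pe: "\<And>i. h \<le> i \<Longrightarrow> i \<le> n \<Longrightarrow> \<pi> y i = \<pi> y' i" and i: "h \<le> i" "i \<le> n - int D"
    for y y' h n i
  proof -
    have "\<forall>i. h - int K \<le> i \<and> i \<le> h + int K + int j \<longrightarrow> y i = y' i" if "h + int j + int D \<le> n + 1" for j
      using that
    proof (induction j)
      case 0 then show ?case using ag by auto
    next
      case (Suc j)
      then have IH: "\<And>i. h - int K \<le> i \<Longrightarrow> i \<le> h + int K + int j \<Longrightarrow> y i = y' i" by auto
      have "translate (h + int j) y (int K + 1) = translate (h + int j) y' (int K + 1)"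
      proof (rule D[of "translate (h + int j) y" "translate (h + int j) y'"])
        show "agree K (translate (h + int j) y) (translate (h + int j) y')"
          using IH by (auto simp: agree_def)
        show "\<pi> (translate (h + int j) y) i = \<pi> (translate (h + int j) y') i" if "0 \<le> i" "i \<le> int D" for i
          using that Suc.prems y pe by (simp add: map_translate)
      qed (use y translate_in in auto)
      then have new: "y (h + int K + int j + 1) = y' (h + int K + int j + 1)" by (simp add: algebra_simps)
      show ?case
      proof (intro allI impI)
        fix i assume "h - int K \<le> i \<and> i \<le> h + int K + int (Suc j)"
        then consider "h - int K \<le> i \<and> i \<le> h + int K + int j" | "i = h + int K + int j + 1" by fastforce
        then show "y i = y' i" using IH new by cases auto
      qed
    qed
    from this[of "nat (i - h)"] show ?thesis using i by auto
  qed
  then show ?thesis by (rule that)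
qed

lemma cover_flip: "cover B (flip ` Y) (\<lambda>y. flip (\<pi> (flip y))) K"
proof
  have ft: "translate k (flip x) = flip (translate (- k) x)" for k and x :: "int \<Rightarrow> 'c"
    by (auto simp: flip_def translate_def)
  have ft': "flip (translate k x) = translate (- k) (flip x)" for k and x :: "int \<Rightarrow> 'b"
    by (auto simp: flip_def translate_def)
  have fin: "z \<in> flip ` Y \<longleftrightarrow> flip z \<in> Y" for z by (metis flip_flip image_iff)
  show "finite B" by (rule finite_alphabet)
  show "x i \<in> B" if "x \<in> flip ` Y" for x i using that range_sub by auto
  show "translate k x \<in> flip ` Y" if "x \<in> flip ` Y" for x k
    using that translate_in[of "flip x" "- k"] by (simp add: fin ft')
  show "x \<in> flip ` Y" if lim: "\<And>m. \<exists>y\<in>flip ` Y. agree m y x" for x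
    unfolding fin
  proof (rule limit_in)
    fix m obtain y where "y \<in> Y" "agree m (flip y) x" using lim by blast
    then show "\<exists>y\<in>Y. agree m y (flip x)" by (metis agree_flip flip_flip)
  qed
  show "(\<lambda>i. if i \<le> 0 then y i else y' i) \<in> flip ` Y"
    if "y \<in> flip ` Y" "y' \<in> flip ` Y" and ag: "agree K y y'" for y y'
  proof -
    have "(\<lambda>i. if i \<le> 0 then flip y' i else flip y i) \<in> Y"
      using that agree_sym by (intro glue[of "flip y'" "flip y"]) (simp_all add: fin)
    \<comment> \<open>Reversal exchanges the half-lines, and coordinate 0 changes sides; the two
      points agree there, so the splice is the same.\<close>
    moreover have "flip (\<lambda>i. if i \<le> 0 then y i else y' i) = (\<lambda>i. if i \<le> 0 then flip y' i else flip y i)"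
    proof
      fix i show "flip (\<lambda>i. if i \<le> 0 then y i else y' i) i = (if i \<le> 0 then flip y' i else flip y i)"
        using ag by (cases "i = 0") (auto simp: agree_def)
    qed
    ultimately show ?thesis by (simp add: fin)
  qed
  show "flip (\<pi> (flip (translate k y))) = translate k (flip (\<pi> (flip y)))" if "y \<in> flip ` Y" for y k
    using that map_translate by (auto simp: ft)
  show "flip (\<pi> (flip y)) 0 = flip (\<pi> (flip y')) 0"
    if "y \<in> flip ` Y" "y' \<in> flip ` Y" "agree K y y'" for y y'
    using that map_local by auto
  obtain p m where p: "p \<in> Y" and inj: "\<And>z z'. z \<in> Y \<Longrightarrow> z' \<in> Y \<Longrightarrow> agree m z p \<Longrightarrow> agree m z' p \<Longrightarrow> \<pi> z = \<pi> z' \<Longrightarrow> z = z'"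
    using injective by blast
  show "\<exists>p\<in>flip ` Y. \<exists>m. \<forall>y\<in>flip ` Y. \<forall>y'\<in>flip ` Y. agree m y p \<longrightarrow> agree m y' p \<longrightarrow>
      flip (\<pi> (flip y)) = flip (\<pi> (flip y')) \<longrightarrow> y = y'"
  proof (intro bexI[of _ "flip p"] exI[of _ m] ballI impI)
    fix y y' assume "y \<in> flip ` Y" "y' \<in> flip ` Y" "agree m y (flip p)" "agree m y' (flip p)"
      "flip (\<pi> (flip y)) = flip (\<pi> (flip y'))"
    then have "flip y = flip y'" by (intro inj) (metis fin agree_flip flip_flip)+
    then show "y = y'" by (metis flip_flip)
  qed (use p in auto)
  show "\<exists>z\<in>flip ` Y. \<exists>k\<ge>int M. agree M z y \<and> agree M (translate k z) y'"
    if yy: "y \<in> flip ` Y" "y' \<in> flip ` Y" for y y' M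
  proof -
    \<comment> \<open>Time runs backwards, so the connecting orbit is taken from
      \<open>flip y'\<close> to \<open>flip y\<close>.\<close>
    obtain z k where z: "z \<in> Y" "k \<ge> int M" "agree M z (flip y')" "agree M (translate k z) (flip y)"
      using transitive[of "flip y'" "flip y" M] yy unfolding fin by blast
    show ?thesis
    proof (intro bexI[of _ "flip (translate k z)"] exI[of _ k] conjI)
      show "agree M (flip (translate k z)) y" using z(4) by (metis agree_flip flip_flip)
      show "agree M (translate k (flip (translate k z))) y'"
        using z(3) by (simp add: ft) (metis agree_flip flip_flip)
    qed (use z translate_in in auto)
  qed
qed

lemma left_delay:
  obtains D where "\<And>y y' h n i. y \<in> Y \<Longrightarrow> y' \<in> Y \<Longrightarrow> (\<And>i. \<bar>i - h\<bar> \<le> int K \<Longrightarrow> y i = y' i) \<Longrightarrow>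
     (\<And>i. n \<le> i \<Longrightarrow> i \<le> h \<Longrightarrow> \<pi> y i = \<pi> y' i) \<Longrightarrow> n + int D \<le> i \<Longrightarrow> i \<le> h \<Longrightarrow> y i = y' i"
proof -
  obtain D where D: "\<And>y y' h n i. y \<in> flip ` Y \<Longrightarrow> y' \<in> flip ` Y \<Longrightarrow> (\<And>i. \<bar>i - h\<bar> \<le> int K \<Longrightarrow> y i = y' i) \<Longrightarrow>
     (\<And>i. h \<le> i \<Longrightarrow> i \<le> n \<Longrightarrow> flip (\<pi> (flip y)) i = flip (\<pi> (flip y')) i) \<Longrightarrow> 
     h \<le> i \<Longrightarrow> i \<le> n - int D \<Longrightarrow> y i = y' i"
    apply (rule cover.right_delay[OF cover_flip])
    subgoal premises p for D by (rule p(1), rule p(2))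
    done
  have "y i = y' i" if "y \<in> Y" "y' \<in> Y" "\<And>i. \<bar>i - h\<bar> \<le> int K \<Longrightarrow> y i = y' i"
    "\<And>i. n \<le> i \<Longrightarrow> i \<le> h \<Longrightarrow> \<pi> y i = \<pi> y' i" "n + int D \<le> i" "i \<le> h" for y y' h n i
    using D[of "flip y" "flip y'" "-h" "-n" "-i"] that by force
  then show ?thesis by (rule that)
qed

text \<open>The window of \<open>x0\<close> is one over which the number of central blocks of lifts is minimal, so
  prolonging the window cannot eliminate a block.\<close>

lemma magic_word:
  shows "\<exists>x0\<in>\<pi> ` Y. \<exists>m. \<forall>y\<in>Y. \<forall>x\<in>\<pi> ` Y. agree m (\<pi> y) x0 \<longrightarrow> agree m x x0 \<longrightarrow>
    (\<exists>y'\<in>Y. \<pi> y' = x \<and> agree K y' y)"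
proof -
  define W where "W x m = (\<lambda>y. map y [- int K..int K]) ` {y \<in> Y. agree m (\<pi> y) x}" for x m
  have agW: "map y [- int K..int K] = map y' [- int K..int K] \<longleftrightarrow> agree K y y'" for y y' :: "int \<Rightarrow> 'b"
    by (auto simp: agree_def abs_le_iff)
  have fin: "finite (W x m)" for x m
  proof (rule finite_subset)
    show "W x m \<subseteq> {xs. set xs \<subseteq> B \<and> length xs = length [- int K..int K]}"
      using range_sub by (auto simp: W_def)
  qed (rule finite_lists_length_eq[OF finite_alphabet])
  have mono: "W x m' \<subseteq> W x m" if "m \<le> m'" for x m m'
    using that agree_mono by (fastforce simp: W_def)
  define P where "P c \<longleftrightarrow> (\<exists>x\<in>\<pi> ` Y. \<exists>m. card (W x m) = c)" for c
  define c where "c = (LEAST c. P c)"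
  have "\<exists>c. P c" using injective unfolding P_def by blast
  then have "P c" unfolding c_def by (rule LeastI_ex)
  have least: "c \<le> card (W x m)" if "x \<in> \<pi> ` Y" for x m
    unfolding c_def using that by (intro Least_le) (auto simp: P_def)
  obtain x0 m where x0: "x0 \<in> \<pi> ` Y" "card (W x0 m) = c" using \<open>P c\<close> unfolding P_def by blast
  have "\<exists>y'\<in>Y. \<pi> y' = x \<and> agree K y' y"
    if y: "y \<in> Y" "x \<in> \<pi> ` Y" "agree m (\<pi> y) x0" "agree m x x0" for x y
  proof -
    have W0: "W x m = W x0 m" using y(4) unfolding W_def by (metis agree_sym agree_trans)
    have "map y [- int K..int K] \<in> W x n" for n
    proof -
      have "W x (max m n) = W x m"
        using least[OF y(2)] x0(2) W0 by (intro card_seteq fin mono) simp_all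
      then have "W x m \<subseteq> W x n" using mono[of n "max m n" x] by simp
      moreover have "map y [- int K..int K] \<in> W x m" unfolding W0 unfolding W_def using y by blast
      ultimately show ?thesis by blast
    qed
    then have "\<exists>z\<in>Y. agree n (\<pi> z) x \<and> map y [- int K..int K] = map z [- int K..int K]" for n
      unfolding W_def by blast
    then have "\<exists>z\<in>Y. agree n (\<pi> z) x \<and> agree K z y" for n
      unfolding agW using agree_sym by metis
    then obtain f where f: "\<And>n. f n \<in> Y" "\<And>n. agree n (\<pi> (f n)) x" "\<And>n. agree K (f n) y" by metis
    \<comment> \<open>An accumulation point of these approximate lifts is a lift of \<open>x\<close>
      that carries the block of \<open>y\<close>.\<close>
    obtain g where g: "g \<in> Y" "\<And>k. infinite {n \<in> UNIV. agree k (f n) g}"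
      using sequence_limit[of f UNIV] f by auto
    have big: "\<exists>n\<ge>k. agree k (f n) g" for k
      using g(2)[of k] by (metis (mono_tags, lifting) infinite_nat_iff_unbounded_le mem_Collect_eq)
    have "\<pi> g i = x i" for i
    proof -
      obtain n where n: "n \<ge> nat \<bar>i\<bar> + K" "agree (nat \<bar>i\<bar> + K) (f n) g" using big by blast
      have "\<pi> g i = \<pi> (f n) i" using n(2) by (intro map_local_at f g) (auto simp: agree_def)
      also have "\<dots> = x i" using f(2)[of n] n(1) by (auto simp: agree_def)
      finally show ?thesis .
    qed
    moreover have "agree K g y" using big[of K] f(3) agree_sym agree_trans by metis
    ultimately show ?thesis using g(1) by blast
  qed
  then show ?thesis using x0(1) by blast
qed

text \<open>
  With the magic window of \<open>x0\<close> at \<open>0\<close> in \<open>a\<close> and \<open>b\<close>, and at \<open>l\<close> in \<open>b\<close> and \<open>c\<close>, one lift of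
  \<open>b\<close> is compared with a lift of \<open>a\<close> (right delay) and with a lift of \<open>c\<close> (left delay).
\<close>

lemma crossing:
  obtains x0 m L where "x0 \<in> \<pi> ` Y"
    and "\<And>a b c i j l. a \<in> \<pi> ` Y \<Longrightarrow> b \<in> \<pi> ` Y \<Longrightarrow> c \<in> \<pi> ` Y \<Longrightarrow>
     agree m a x0 \<Longrightarrow> agree m b x0 \<Longrightarrow> agree m (translate l b) x0 \<Longrightarrow> agree m (translate l c) x0 \<Longrightarrow>
     0 \<le> i \<Longrightarrow> i + int L \<le> j \<Longrightarrow> j \<le> l \<Longrightarrow>
     (\<And>k. 0 \<le> k \<Longrightarrow> k \<le> j \<Longrightarrow> a k = b k) \<Longrightarrow> (\<And>k. i \<le> k \<Longrightarrow> k \<le> l \<Longrightarrow> b k = c k) \<Longrightarrow>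
     \<exists>e\<in>\<pi> ` Y. (\<forall>k\<le>j. e k = c k) \<and> (\<forall>k\<ge>i. e k = a k)"
proof -
  obtain x0 m where x0: "x0 \<in> \<pi> ` Y"
    and magic: "\<And>y x. y \<in> Y \<Longrightarrow> x \<in> \<pi> ` Y \<Longrightarrow> agree m (\<pi> y) x0 \<Longrightarrow> agree m x x0 \<Longrightarrow>
      \<exists>y'\<in>Y. \<pi> y' = x \<and> agree K y' y"
    using magic_word by blast
  obtain D where D: "\<And>y y' h n i. y \<in> Y \<Longrightarrow> y' \<in> Y \<Longrightarrow> (\<And>i. \<bar>i - h\<bar> \<le> int K \<Longrightarrow> y i = y' i) \<Longrightarrow>
     (\<And>i. h \<le> i \<Longrightarrow> i \<le> n \<Longrightarrow> \<pi> y i = \<pi> y' i) \<Longrightarrow> h \<le> i \<Longrightarrow> i \<le> n - int D \<Longrightarrow> y i = y' i"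
    apply (rule right_delay)
    subgoal premises p for D by (rule p(1), rule p(2))
    done
  obtain D' where D': "\<And>y y' h n i. y \<in> Y \<Longrightarrow> y' \<in> Y \<Longrightarrow> (\<And>i. \<bar>i - h\<bar> \<le> int K \<Longrightarrow> y i = y' i) \<Longrightarrow>
     (\<And>i. n \<le> i \<Longrightarrow> i \<le> h \<Longrightarrow> \<pi> y i = \<pi> y' i) \<Longrightarrow> n + int D' \<le> i \<Longrightarrow> i \<le> h \<Longrightarrow> y i = y' i"
    apply (rule left_delay)
    subgoal premises p for D by (rule p(1), rule p(2))
    done
  \<comment> \<open>Of the overlap from \<open>i\<close> to \<open>j\<close>, the delays cost D
    coordinates on the right and D' on the left; the summand 2K leaves room for one gluing window in
    what remains.\<close>
  have "\<exists>e\<in>\<pi> ` Y. (\<forall>k\<le>j. e k = c k) \<and> (\<forall>k\<ge>i. e k = a k)"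
    if abc: "a \<in> \<pi> ` Y" "b \<in> \<pi> ` Y" "c \<in> \<pi> ` Y"
      and W: "agree m a x0" "agree m b x0" "agree m (translate l b) x0" "agree m (translate l c) x0"
      and ij: "0 \<le> i" "i + int (D + D' + 2 * K) \<le> j" "j \<le> l"
      and ab: "\<And>k. 0 \<le> k \<Longrightarrow> k \<le> j \<Longrightarrow> a k = b k" and bc: "\<And>k. i \<le> k \<Longrightarrow> k \<le> l \<Longrightarrow> b k = c k"
    for a b c i j l
  proof -
    obtain yb where yb: "yb \<in> Y" "\<pi> yb = b" using abc by blast
    obtain ya where ya: "ya \<in> Y" "\<pi> ya = a" "agree K ya yb" using magic[of yb a] yb abc W by blast
    have tr: "translate k z \<in> \<pi> ` Y" if z: "z \<in> \<pi> ` Y" for z k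
    proof -
      obtain y where y: "y \<in> Y" "z = \<pi> y" using z by blast
      then have "translate k z = \<pi> (translate k y)" by (simp add: map_translate)
      then show ?thesis using y translate_in by blast
    qed
    obtain yc' where yc': "yc' \<in> Y" "\<pi> yc' = translate l c" "agree K yc' (translate l yb)"
      using magic[of "translate l yb" "translate l c"] tr abc W yb translate_in map_translate by metis
    define yc where "yc = translate (- l) yc'"
    have yc: "yc \<in> Y" "\<pi> yc = c" using yc' translate_in by (auto simp: yc_def map_translate)
    have ycb: "yc k = yb k" if "\<bar>k - l\<bar> \<le> int K" for k
    proof -
      have "yc' (k - l) = translate l yb (k - l)" using yc'(3) that unfolding agree_def by blast
      then show ?thesis by (simp add: yc_def)
    qed
    have A: "ya k = yb k" if "0 \<le> k" "k \<le> j - int D" for k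
      by (rule D[of ya yb 0 j k]) (use ya yb ab that in \<open>auto simp: agree_def\<close>)
    have C: "yb k = yc k" if "i + int D' \<le> k" "k \<le> l" for k
      by (rule D'[of yb yc l i k]) (use yc yb bc that ycb in auto)
    define h where "h = i + int D' + int K"
    have AC: "yc k = ya k" if "\<bar>k - h\<bar> \<le> int K" for k
      using that A[of k] C[of k] ij by (auto simp: h_def)
    define g where "g = (\<lambda>k. if k \<le> h then yc k else ya k)"
    have g: "g \<in> Y" unfolding g_def using AC by (intro glue_at ya yc) auto
    have L: "\<pi> g k = c k" if "k \<le> h" for k
      unfolding yc(2)[symmetric] using that AC by (intro map_local_at g yc) (auto simp: g_def)
    have R: "\<pi> g k = a k" if "h \<le> k" for k
      unfolding ya(2)[symmetric] using that AC by (intro map_local_at g ya) (auto simp: g_def)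
    show ?thesis
    proof (intro bexI[of _ "\<pi> g"] conjI allI impI)
      fix k
      \<comment> \<open>Between \<open>i\<close> and \<open>j\<close> the points \<open>a\<close>,
        \<open>b\<close> and \<open>c\<close> coincide, so each half of the splice may be claimed up
        to the far end of the overlap.\<close>
      show "\<pi> g k = c k" if "k \<le> j"
        using that L R ab[of k] bc[of k] ij by (cases "k \<le> h") (auto simp: h_def)
      show "\<pi> g k = a k" if "i \<le> k"
        using that L R ab[of k] bc[of k] ij by (cases "k \<le> h") (auto simp: h_def)
    qed (use g in simp)
  qed
  then show ?thesis by (rule that[OF x0])
qed

end

section \<open>Languages and right rays\<close>

definition word_at :: "(int \<Rightarrow> 'a) \<Rightarrow> int \<Rightarrow> 'a list \<Rightarrow> bool" where
  "word_at x c w \<longleftrightarrow> (\<forall>k<length w. x (c + int k) = w ! k)"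

lemma word_at_append: "word_at x c (u @ v) \<longleftrightarrow> word_at x c u \<and> word_at x (c + int (length u)) v"
proof (intro iffI conjI)
  assume h: "word_at x c (u @ v)"
  show "word_at x c u" unfolding word_at_def
  proof (intro allI impI)
    fix k assume "k < length u" then show "x (c + int k) = u ! k"
      using h[unfolded word_at_def, rule_format, of k] by (simp add: nth_append)
  qed
  show "word_at x (c + int (length u)) v" unfolding word_at_def
  proof (intro allI impI)
    fix k assume "k < length v" then show "x (c + int (length u) + int k) = v ! k"
      using h[unfolded word_at_def, rule_format, of "length u + k"] by (simp add: nth_append add.assoc)
  qed
next
  assume h: "word_at x c u \<and> word_at x (c + int (length u)) v"
  show "word_at x c (u @ v)" unfolding word_at_def
  proof (intro allI impI)
    fix k assume k: "k < length (u @ v)"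
    show "x (c + int k) = (u @ v) ! k"
    proof (cases "k < length u")
      case True then show ?thesis using h by (simp add: word_at_def nth_append)
    next
      case False
      then have "k - length u < length v" using k by simp
      then have "x (c + int (length u) + int (k - length u)) = v ! (k - length u)"
        using h unfolding word_at_def by blast
      then show ?thesis using False by (simp add: nth_append of_nat_diff)
    qed
  qed
qed

lemma word_at_translate: "word_at (translate d x) c w \<longleftrightarrow> word_at x (c + d) w"
  by (simp add: word_at_def add.commute add.left_commute)

lemma word_at_eq:
  assumes "word_at x c w" "word_at y c w" "c \<le> k" "k < c + int (length w)"
  shows "x k = y k"
proof -
  have "nat (k - c) < length w" "k = c + int (nat (k - c))" using assms by auto
  then show ?thesis using assms(1,2) unfolding word_at_def by metis
qed

lemma word_at_cong:
  assumes "word_at x c w" "\<And>k. c \<le> k \<Longrightarrow> k < c + int (length w) \<Longrightarrow> y k = x k"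
  shows "word_at y c w"
  using assms by (simp add: word_at_def)

lemma word_at_window: "word_at x (- int m) (map y [- int m..int m]) \<longleftrightarrow> agree m x y"
proof
  assume h: "word_at x (- int m) (map y [- int m..int m])"
  show "agree m x y" unfolding agree_def
  proof (intro allI impI)
    fix i assume "\<bar>i\<bar> \<le> int m"
    then have i: "- int m \<le> i" "i \<le> int m" by auto
    then have "nat (i + m) < length (map y [- int m..int m])" by auto
    then have "x (- int m + int (nat (i + m))) = map y [- int m..int m] ! nat (i + m)"
      using h unfolding word_at_def by blast
      moreover have "- int m + int (nat (i + m)) = i" "map y [- int m..int m] ! nat (i + m) = y i"
        using i by (simp_all add: nth_upto)
      ultimately show "x i = y i" by simp
  qed
qed (auto simp: word_at_def agree_def nth_upto)

lemma language_iff_occurrence: "w \<in> language X \<longleftrightarrow> (\<exists>x\<in>X. \<exists>c. word_at x c w)"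
  by (auto simp: language_def occurs_in_def word_at_def)

lemma language_appendD: "u @ v \<in> language X \<Longrightarrow> u \<in> language X \<and> v \<in> language X"
  unfolding language_iff_occurrence word_at_append by blast

context closed_shift
begin

text \<open>Translation invariance moves an occurrence to any prescribed position
  \<open>c\<close>.\<close>

lemma language_iff: "w \<in> language X \<longleftrightarrow> (\<exists>x\<in>X. word_at x c w)"
proof
  assume "w \<in> language X"
  then obtain x d where x: "x \<in> X" "word_at x d w" by (auto simp: language_iff_occurrence)
  have "word_at (translate (d - c) x) c w" using x by (simp add: word_at_translate)
  then show "\<exists>x\<in>X. word_at x c w" using x translate_in by blast
qed (auto simp: language_iff_occurrence)

lemma language_lists: "w \<in> language X \<Longrightarrow> w \<in> lists A"
  unfolding language_iff_occurrence word_at_def lists_eq_set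
  by (auto simp: in_set_conv_nth) (metis range_sub)

lemma right_ray_prefix:
  assumes "r \<in> right_rays X" shows "prefix n r \<in> language X"
  using assms unfolding language_iff[of _ 0] right_rays_def word_at_def by auto

text \<open>A point of \<open>X\<close> realising the ray is found as an accumulation point of
  points that realise longer and longer prefixes.\<close>

lemma right_rayI:
  assumes "\<And>n. \<exists>k\<ge>n. prefix k r \<in> language X"
  shows "r \<in> right_rays X"
proof -
  have "\<forall>n. \<exists>x\<in>X. \<forall>i<n. x (int i) = r i"
  proof
    fix n obtain k where k: "k \<ge> n" "prefix k r \<in> language X" using assms by blast
    then obtain x where "x \<in> X" "word_at x 0 (prefix k r)" using language_iff by blast
    then show "\<exists>x\<in>X. \<forall>i<n. x (int i) = r i" using k(1) by (intro bexI[of _ x]) (auto simp: word_at_def)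
  qed
  then obtain f where f: "\<And>n. f n \<in> X" "\<And>n i. i < n \<Longrightarrow> f n (int i) = r i" by metis
  obtain g where g: "g \<in> X" "\<And>k. infinite {n \<in> UNIV. agree k (f n) g}"
    using sequence_limit[of f UNIV] f by auto
  have "g (int i) = r i" for i
  proof -
    obtain n where "n \<ge> Suc i" "agree i (f n) g"
      using g(2)[of i] by (metis (mono_tags, lifting) infinite_nat_iff_unbounded_le mem_Collect_eq)
    then show ?thesis using f(2)[of i n] by (simp add: agree_def)
  qed
  then show ?thesis using g(1) by (auto simp: right_rays_def intro!: exI[of _ g])
qed

lemma prefix_conc: "prefix (length u + k) (u \<frown> r) = u @ prefix k r"
  by (rule nth_equalityI) (auto simp: nth_append)

lemma right_ray_concI:
  assumes "\<And>k. u @ prefix k r \<in> language X" shows "u \<frown> r \<in> right_rays X"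
proof (rule right_rayI)
  fix n show "\<exists>k\<ge>n. prefix k (u \<frown> r) \<in> language X"
    using assms prefix_conc by (intro exI[of _ "length u + n"]) auto
qed

lemma right_ray_conc_tail:
  assumes "u \<frown> r \<in> right_rays X" shows "r \<in> right_rays X"
proof (rule right_rayI)
  fix n show "\<exists>k\<ge>n. prefix k r \<in> language X"
    using right_ray_prefix[OF assms, of "length u + n"] language_appendD
    unfolding prefix_conc by (intro exI[of _ n]) blast
qed

text \<open>Irreducibility extends every admissible word to one ending in a further
  \<open>W\<close>; the ray is the union of a chain of such extensions.\<close>

lemma recurrent_ray:
  assumes irr: "irreducible_shift X" and W: "W \<in> language X" "W \<noteq> []"
  obtains r where "r \<in> right_rays X" "\<forall>n. \<exists>i\<ge>n. r [i \<rightarrow> i + length W] = W"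
proof -
  have "\<exists>f. \<forall>n. (f n \<in> language X \<and> n \<le> length (f n)) \<and> (\<exists>v. f (Suc n) = f n @ v @ W)"
  proof (rule dependent_nat_choice)
    fix x n assume x: "x \<in> language X \<and> n \<le> length x"
    then obtain v where "x @ v @ W \<in> language X" using irr W unfolding irreducible_shift_def by blast
    moreover have "Suc 0 \<le> length W" using W by (cases W) auto
    ultimately show "\<exists>y. (y \<in> language X \<and> Suc n \<le> length y) \<and> (\<exists>v. y = x @ v @ W)"
      using x by (intro exI[of _ "x @ v @ W"]) auto
  qed (use W in auto)
  then obtain f where f: "\<And>n. f n \<in> language X" "\<And>n. n \<le> length (f n)"
    "\<And>n. \<exists>v. f (Suc n) = f n @ v @ W" by blast
  \<comment> \<open>\<open>f (Suc i)\<close> is long enough to have an entry at \<open>i\<close>,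
    and all sufficiently long members of the chain agree there.\<close>
  define r where "r i = f (Suc i) ! i" for i
  have ext: "\<exists>v. f (n + d) = f n @ v" for n d
    by (induction d) (use f(3) in \<open>auto, metis append.assoc\<close>)
  have rf: "r i = f n ! i" if i: "i < length (f n)" for i n
  proof (cases "Suc i \<le> n")
    case True
    then obtain v where "f n = f (Suc i) @ v" using ext[of "Suc i" "n - Suc i"] by auto
    then show ?thesis using f(2)[of "Suc i"] by (simp add: r_def nth_append)
  next
    case False
    then obtain v where "f (Suc i) = f n @ v" using ext[of n "Suc i - n"] by auto
    then show ?thesis using i by (simp add: r_def nth_append)
  qed
  have pre: "prefix (length (f n)) r = f n" for n
    using rf by (intro nth_equalityI) auto
  show ?thesis
  proof
    show "r \<in> right_rays X"
      by (rule right_rayI) (use pre f in metis)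
    show "\<forall>n. \<exists>i\<ge>n. r [i \<rightarrow> i + length W] = W"
    proof
      fix n
      obtain v where v: "f (Suc n) = f n @ v @ W" using f(3) by blast
      have "r [length (f n @ v) \<rightarrow> length (f n @ v) + length W] = W"
      proof (rule nth_equalityI)
        fix k assume "k < length (r [length (f n @ v) \<rightarrow> length (f n @ v) + length W])"
        then have "k < length W" by simp
        then show "r [length (f n @ v) \<rightarrow> length (f n @ v) + length W] ! k = W ! k"
          using rf[of "length (f n @ v) + k" "Suc n"] v by (simp add: nth_append)
      qed simp
      then show "\<exists>i\<ge>n. r [i \<rightarrow> i + length W] = W"
        using f(2)[of n] by (intro exI[of _ "length (f n @ v)"]) auto
    qed
  qed
qed

text \<open>The inadmissible words of length n+1 serve as forbidden words. If all blocks of this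
  length in a sequence are admissible, gluing along overlaps of length n prolongs them to the left
  one letter at a time.\<close>

lemma SFT_if_gluing_words:
  assumes X: "shift_space A X"
    and glue: "\<And>u t v. length t = n \<Longrightarrow> u @ t \<in> language X \<Longrightarrow> t @ v \<in> language X \<Longrightarrow> u @ t @ v \<in> language X"
  shows "SFT A X"
proof -
  define F where "F = {w \<in> lists A. length w = Suc n} - language X"
  have "finite F" unfolding F_def lists_eq_set using finite_lists_length_eq[OF finite_alphabet, of "Suc n"]
    by (auto simp: conj_commute)
  have "x \<in> X" if x: "x \<in> full_shift A" "\<And>w. w \<in> F \<Longrightarrow> \<not> occurs_in w x" for x
  proof -
    define V where "V i k = map (\<lambda>l. x (i + int l)) [0..<k]" for i k
    have V: "word_at x i (V i k)" for i k by (simp add: V_def word_at_def)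
    have base: "V i (Suc n) \<in> language X" for i
    proof -
      have "V i (Suc n) \<in> lists A" using x(1) by (fastforce simp: V_def full_shift_def)
      moreover have "occurs_in (V i (Suc n)) x" using V[of i "Suc n"] by (auto simp: occurs_in_def word_at_def)
      ultimately show ?thesis using x(2)[of "V i (Suc n)"] by (auto simp: F_def V_def)
    qed
    have "V i (Suc n + j) \<in> language X" for i j
    proof (induction j arbitrary: i)
      case (Suc j)
      define t where "t = V (i + 1) n"
      define v where "v = V (i + 1 + int n) (Suc j)"
      have tv: "t @ v = V (i + 1) (Suc n + j)"
        by (rule nth_equalityI) (auto simp: t_def v_def V_def nth_append of_nat_diff algebra_simps simp del: upt_Suc)
      have ut: "[x i] @ t = V i (Suc n)"
        by (rule nth_equalityI) (auto simp: t_def V_def nth_Cons' of_nat_diff algebra_simps simp del: upt_Suc)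
      have utv: "[x i] @ t @ v = V i (Suc n + Suc j)" unfolding tv
        by (rule nth_equalityI) (auto simp: t_def V_def nth_Cons' of_nat_diff algebra_simps simp del: upt_Suc)
      have "length t = n" by (simp add: t_def V_def)
      moreover have "[x i] @ t \<in> language X" unfolding ut by (rule base)
      moreover have "t @ v \<in> language X" unfolding tv by (rule Suc.IH)
      ultimately show ?case using glue unfolding utv[symmetric] by blast
    qed (use base in simp)
    note long = this
    show ?thesis
    proof (rule limit_in)
      fix m :: nat
      have "V (- int m) (Suc n + 2 * m) \<in> language X" by (rule long)
      then obtain y where y: "y \<in> X" "word_at y (- int m) (V (- int m) (Suc n + 2 * m))"
        using language_iff by blast
      then have "agree m y x" using word_at_eq[OF y(2) V] by (auto simp: agree_def V_def)
      then show "\<exists>y\<in>X. agree m y x" using y by blast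
    qed
  qed
  moreover have "x \<in> full_shift A" if "x \<in> X" for x using that range_sub by (auto simp: full_shift_def)
  moreover have "\<not> occurs_in w x" if "x \<in> X" "w \<in> F" for x w
    using that by (auto simp: F_def language_def)
  ultimately have "X = {x \<in> full_shift A. \<forall>w\<in>F. \<not> occurs_in w x}" by blast
  moreover have "F \<subseteq> lists A" by (auto simp: F_def)
  ultimately show ?thesis unfolding SFT_def using X \<open>finite F\<close> by blast
qed

end

section \<open>From the definitions to a cover\<close>

lemma SFT_glue:
  assumes "SFT B Y"
  shows "\<exists>K. \<forall>y\<in>Y. \<forall>y'\<in>Y. agree K y y' \<longrightarrow> (\<lambda>i. if i \<le> 0 then y i else y' i) \<in> Y"
proof -
  obtain F where F: "finite F" "Y = {x \<in> full_shift B. \<forall>w\<in>F. \<not> occurs_in w x}"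
    using assms unfolding SFT_def by blast
  \<comment> \<open>With \<open>K\<close> at least the length of every forbidden word, an occurrence
    starting at or left of 0 ends where the spliced point still agrees with \<open>y\<close>; any
    other lies where it agrees with \<open>y'\<close>.\<close>
  obtain K where K: "\<And>w. w \<in> F \<Longrightarrow> length w \<le> K"
    using finite_nat_set_iff_bounded_le[of "length ` F"] F(1) by auto
  have "(\<lambda>i. if i \<le> 0 then y i else y' i) \<in> Y"
    if y: "y \<in> Y" "y' \<in> Y" and ag: "agree K y y'" for y y'
  proof -
    define z where "z = (\<lambda>i. if i \<le> 0 then y i else y' i)"
    have l: "z i = y i" if "i \<le> int K" for i using that ag by (auto simp: z_def agree_def)
    have r: "z i = y' i" if "- int K \<le> i" for i using that ag by (auto simp: z_def agree_def)
    have "\<not> occurs_in w z" if w: "w \<in> F" for w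
    proof
      assume "occurs_in w z"
      then obtain i where i: "\<And>k. k < length w \<Longrightarrow> z (i + int k) = w ! k" by (auto simp: occurs_in_def)
      have "occurs_in w y \<or> occurs_in w y'"
      proof (cases "i \<le> 0")
        case True
        then have "\<forall>k<length w. y (i + int k) = w ! k" using i l K[OF w] by force
        then show ?thesis by (auto simp: occurs_in_def)
      next
        case False
        then have "\<forall>k<length w. y' (i + int k) = w ! k" using i r by force
        then show ?thesis by (auto simp: occurs_in_def)
      qed
      then show False using y w F(2) by auto
    qed
    moreover have "z \<in> full_shift B" using y F(2) by (auto simp: z_def full_shift_def)
    ultimately show ?thesis using F(2) by (simp add: z_def)
  qed
  then show ?thesis by blast
qed

lemma factor_map_translate:
  assumes "shift_space B Y" "factor_map B Y A X \<pi>" "y \<in> Y"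
  shows "\<pi> (translate k y) = translate k (\<pi> y)"
proof -
  interpret closed_shift B Y using assms shift_space_closed_shift by blast
  have sm: "shift_map y = translate 1 y" for y :: "int \<Rightarrow> 'c" by (simp add: shift_map_def translate_def)
  have one: "\<pi> (translate 1 y) = translate 1 (\<pi> y)" if "y \<in> Y" for y
    using assms(2) that unfolding factor_map_def by (simp add: shift_map_def translate_def)
  have up: "\<pi> (translate (int n) y) = translate (int n) (\<pi> y)" if "y \<in> Y" for y n
  proof (induction n)
    case (Suc n)
    have "\<pi> (translate (int (Suc n)) y) = \<pi> (translate 1 (translate (int n) y))" by simp
    also have "\<dots> = translate 1 (translate (int n) (\<pi> y))"
      using one translate_in[OF that] Suc.IH by metis
    finally show ?case by (simp del: translate_apply)
  qed simp
  show ?thesis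
  proof (cases k rule: int_cases2)
    case (nonneg n) then show ?thesis using up assms(3) by simp
  next
    case (nonpos n)
    have "\<pi> y = translate (int n) (\<pi> (translate (- int n) y))"
      using up[OF translate_in[OF assms(3)], of n "- int n"] by simp
    then have "translate (- int n) (\<pi> y) = \<pi> (translate (- int n) y)" 
      by (metis translate_translate add.left_inverse translate_0)
    then show ?thesis using nonpos by simp
  qed
qed

text \<open>The Curtis-Hedlund-Lyndon argument: if no window determined coordinate 0 of the image,
  pairs agreeing on growing windows would accumulate at a point where this coordinate is not
  continuous.\<close>

lemma factor_map_local:
  assumes "shift_space B Y" "factor_map B Y A X \<pi>"
  shows "\<exists>K. \<forall>y\<in>Y. \<forall>y'\<in>Y. agree K y y' \<longrightarrow> \<pi> y 0 = \<pi> y' 0"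
proof (rule ccontr)
  interpret closed_shift B Y using assms shift_space_closed_shift by blast
  have cont: "continuous_map (subtopology (shift_topology B) Y) (subtopology (shift_topology A) X) \<pi>"
    using assms(2) unfolding factor_map_def by blast
  have Ysub: "Y \<subseteq> full_shift B" using range_sub by (auto simp: full_shift_def)
  assume "\<not> ?thesis"
  then have "\<forall>K. \<exists>y y'. y \<in> Y \<and> y' \<in> Y \<and> agree K y y' \<and> \<pi> y 0 \<noteq> \<pi> y' 0" by blast
  then obtain f f' where f: "\<And>n. f n \<in> Y" "\<And>n. f' n \<in> Y" "\<And>n. agree n (f n) (f' n)"
    "\<And>n. \<pi> (f n) 0 \<noteq> \<pi> (f' n) 0" by metis
  obtain g where g: "g \<in> Y" "\<And>k. infinite {n \<in> UNIV. agree k (f n) g}"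
    using sequence_limit[of f UNIV] f by auto
  have "continuous_map (subtopology (shift_topology B) Y) (discrete_topology A) (\<lambda>y. \<pi> y 0)"
  proof -
    have "continuous_map (shift_topology A) (discrete_topology A) (\<lambda>x. x 0)"
      unfolding shift_topology_def by (rule continuous_map_product_projection) simp
    then show ?thesis
      using continuous_map_compose[OF continuous_map_into_fulltopology[OF cont]] by (auto simp: o_def)
  qed
  moreover have "\<pi> g 0 \<in> A"
    using calculation g(1) Ysub unfolding continuous_map_def by (auto simp: topspace_shift_topology)
  ultimately have "openin (subtopology (shift_topology B) Y)
      {y \<in> topspace (subtopology (shift_topology B) Y). \<pi> y 0 \<in> {\<pi> g 0}}"
    by (intro openin_continuous_map_preimage[where Y = "discrete_topology A"]) simp_all
  then obtain T where T: "openin (shift_topology B) T" "{y \<in> Y. \<pi> y 0 = \<pi> g 0} = T \<inter> Y"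
    using Ysub by (auto simp: openin_subtopology topspace_shift_topology Int_absorb1)
  have "g \<in> T" using T(2) g(1) by blast
  then obtain m where m: "\<And>y. y \<in> full_shift B \<Longrightarrow> agree m y g \<Longrightarrow> y \<in> T"
    using openin_shift_cylinder[OF T(1)] by blast
  have same: "\<pi> y 0 = \<pi> g 0" if "y \<in> Y" "agree m y g" for y using T(2) m that Ysub by blast
  obtain n where n: "n \<ge> m" "agree m (f n) g"
    using g(2)[of m] by (metis (mono_tags, lifting) infinite_nat_iff_unbounded_le mem_Collect_eq)
  have "agree m (f' n) g" using n f(3)[of n] by (metis agree_mono agree_sym agree_trans)
  then show False using same[OF f(1) n(2)] same[OF f(2)] f(4) by metis
qed

lemma irreducible_shift_transitive:
  assumes "closed_shift B Y" "irreducible_shift Y" "y \<in> Y" "y' \<in> Y"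
  shows "\<exists>z\<in>Y. \<exists>k\<ge>int M. agree M z y \<and> agree M (translate k z) y'"
proof -
  interpret closed_shift B Y by fact
  define w where "w y = map y [- int M..int M]" for y :: "int \<Rightarrow> 'a"
  have "w y \<in> language Y" "w y' \<in> language Y"
    unfolding language_iff[of _ "- int M"] w_def word_at_window using assms(3,4) by (auto simp: agree_def)
  then obtain v where "w y @ v @ w y' \<in> language Y" using assms(2) unfolding irreducible_shift_def by blast
  then obtain z where z: "z \<in> Y" "word_at z (- int M) (w y @ v @ w y')"
    using language_iff by blast
  define k where "k = int (length (w y @ v))"
  have "agree M z y" using z(2) by (simp add: word_at_append w_def word_at_window)
  moreover have "agree M (translate k z) y'"
    unfolding word_at_window[symmetric] word_at_translate
    using z(2) by (simp add: word_at_append w_def k_def add.assoc)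
  ultimately show ?thesis using z(1) by (intro bexI[of _ z] exI[of _ k]) (auto simp: k_def w_def)
qed

lemma AFT_cover:
  assumes "AFT A X"
  obtains B :: "nat set" and Y \<pi> K where "cover B Y \<pi> K" "\<pi> ` Y = X"
proof -
  obtain B :: "nat set" and Y \<pi> U where *: "SFT B Y" "irreducible_shift Y" "factor_map B Y A X \<pi>"
    "openin (subtopology (shift_topology B) Y) U" "U \<noteq> {}" "inj_on \<pi> U"
    using assms unfolding AFT_def by blast
  have Y: "shift_space B Y" using *(1) by (simp add: SFT_def)
  interpret closed_shift B Y using Y shift_space_closed_shift by blast
  have Ysub: "Y \<subseteq> full_shift B" using range_sub by (auto simp: full_shift_def)
  obtain K1 where K1: "\<And>y y'. y \<in> Y \<Longrightarrow> y' \<in> Y \<Longrightarrow> agree K1 y y' \<Longrightarrow> (\<lambda>i. if i \<le> 0 then y i else y' i) \<in> Y"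
    using SFT_glue[OF *(1)] by blast
  obtain K2 where K2: "\<And>y y'. y \<in> Y \<Longrightarrow> y' \<in> Y \<Longrightarrow> agree K2 y y' \<Longrightarrow> \<pi> y 0 = \<pi> y' 0"
    using factor_map_local[OF Y *(3)] by blast
  obtain p where p: "p \<in> U" using *(5) by blast
  obtain V where V: "openin (shift_topology B) V" "U = V \<inter> Y" using *(4) by (auto simp: openin_subtopology)
  then obtain m where m: "\<And>y. y \<in> full_shift B \<Longrightarrow> agree m y p \<Longrightarrow> y \<in> V"
    using p openin_shift_cylinder by (metis IntD1)
  have "cover B Y \<pi> (max K1 K2)"
  proof
    show "(\<lambda>i. if i \<le> 0 then y i else y' i) \<in> Y" if "y \<in> Y" "y' \<in> Y" "agree (max K1 K2) y y'" for y y'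
      using that K1 agree_mono max.cobounded1 by metis
    show "\<pi> y 0 = \<pi> y' 0" if "y \<in> Y" "y' \<in> Y" "agree (max K1 K2) y y'" for y y'
      using that K2 agree_mono max.cobounded2 by metis
    show "\<pi> (translate k y) = translate k (\<pi> y)" if "y \<in> Y" for y k
      using factor_map_translate[OF Y *(3) that] .
    show "\<exists>p\<in>Y. \<exists>m. \<forall>y\<in>Y. \<forall>y'\<in>Y. agree m y p \<longrightarrow> agree m y' p \<longrightarrow> \<pi> y = \<pi> y' \<longrightarrow> y = y'"
    proof (intro bexI[of _ p] exI[of _ m] ballI impI)
      show "p \<in> Y" using p V by blast
      fix y y' assume "y \<in> Y" "y' \<in> Y" "agree m y p" "agree m y' p" "\<pi> y = \<pi> y'"
      then show "y = y'" using m V(2) Ysub *(6) unfolding inj_on_def by blast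
    qed
    show "\<exists>z\<in>Y. \<exists>k\<ge>int M. agree M z y \<and> agree M (translate k z) y'" if "y \<in> Y" "y' \<in> Y" for y y' M
      using irreducible_shift_transitive[OF closed_shift_axioms *(2) that] .
  qed
  moreover have "\<pi> ` Y = X" using *(3) by (simp add: factor_map_def)
  ultimately show ?thesis by (rule that)
qed

section \<open>Follower sets and failure of finite type\<close>

lemma (in cover) finite_follower_sets:
  assumes X: "closed_shift A (\<pi> ` Y)"
  shows "finite (range (\<lambda>w. {v. w @ v \<in> language (\<pi> ` Y)}))"
proof -
  interpret X: closed_shift A "\<pi> ` Y" by (rule X)
  \<comment> \<open>The follower set of \<open>w\<close> depends only on \<open>E w\<close>, the
    central blocks of lifts in which \<open>w\<close> ends just left of 0, because any continuation
    read from such a block can be glued on. There are only finitely many sets of such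
    blocks.\<close>
  define E where "E w = (\<lambda>y. map y [- int K..int K]) ` {y \<in> Y. word_at (\<pi> y) (- int (length w)) w}" for w
  define G where "G Q = {v. \<exists>y\<in>Y. map y [- int K..int K] \<in> Q \<and> word_at (\<pi> y) 0 v}" for Q
  have "w @ v \<in> language (\<pi> ` Y) \<longleftrightarrow> v \<in> G (E w)" for w v
  proof
    assume "w @ v \<in> language (\<pi> ` Y)"
    then show "v \<in> G (E w)"
      unfolding X.language_iff[of _ "- int (length w)"] G_def E_def by (auto simp: word_at_append)
  next
    assume "v \<in> G (E w)"
    then obtain y y1 where y: "y \<in> Y" "word_at (\<pi> y) 0 v" "y1 \<in> Y" "word_at (\<pi> y1) (- int (length w)) w"
      and "map y [- int K..int K] = map y1 [- int K..int K]"
      unfolding G_def E_def by blast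
    then have ag: "agree K y1 y" by (auto simp: agree_def abs_le_iff)
    define g where "g = (\<lambda>i. if i \<le> 0 then y1 i else y i)"
    have g: "g \<in> Y" unfolding g_def using glue y ag by blast
    have "\<pi> g k = \<pi> y1 k" if "k \<le> 0" for k
      using ag that by (intro map_local_at g y) (auto simp: g_def agree_def)
    then have 1: "word_at (\<pi> g) (- int (length w)) w" by (intro word_at_cong[OF y(4)]) auto
    have "\<pi> g k = \<pi> y k" if "0 \<le> k" for k
      using ag that by (intro map_local_at g y) (auto simp: g_def agree_def)
    then have 2: "word_at (\<pi> g) 0 v" by (intro word_at_cong[OF y(2)]) auto
    show "w @ v \<in> language (\<pi> ` Y)"
      unfolding X.language_iff[of _ "- int (length w)"] using g 1 2 by (auto simp: word_at_append)
  qed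
  then have "range (\<lambda>w. {v. w @ v \<in> language (\<pi> ` Y)}) = range (\<lambda>w. G (E w))" by auto
  moreover have "E w \<in> Pow {xs. set xs \<subseteq> B \<and> length xs = length [- int K..int K]}" for w
    using range_sub by (auto simp: E_def)
  then have "range (\<lambda>w. G (E w)) \<subseteq> G ` Pow {xs. set xs \<subseteq> B \<and> length xs = length [- int K..int K]}"
    by blast
  moreover have "finite (G ` Pow {xs. set xs \<subseteq> B \<and> length xs = length [- int K..int K]})"
    using finite_lists_length_eq[OF finite_alphabet] by blast
  ultimately show ?thesis by (simp add: finite_subset)
qed

text \<open>All that the algebra needs from the shift. Without a witness, words that precede a
  common ray always have a common continuation ending in the magic word \<open>W\<close>, and this
  supplies the points \<open>b\<close> and \<open>c\<close> for \<open>crossing\<close>.\<close>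

lemma not_SFT_witness:
  assumes X: "shift_space A X" and irr: "irreducible_shift X" and "\<not> SFT A X" and "AFT A X"
  obtains u u' z W where "W \<in> language X" "W \<noteq> []" "u \<frown> z \<in> right_rays X" "u' \<frown> z \<in> right_rays X"
    "\<not> (\<exists>p. u @ p @ W \<in> language X \<and> u' @ p @ W \<in> language X)"
proof (rule ccontr)
  note witness = that
  assume neg: "\<not> thesis"
  interpret X: closed_shift A X using X shift_space_closed_shift by blast
  obtain B :: "nat set" and Y \<pi> K where cov: "cover B Y \<pi> K" and XY: "\<pi> ` Y = X"
    using AFT_cover[OF assms(4)] .
  interpret cover B Y \<pi> K by fact
  obtain x0 m L where x0: "x0 \<in> \<pi> ` Y"
    and cross: "\<And>a b c i j l. a \<in> \<pi> ` Y \<Longrightarrow> b \<in> \<pi> ` Y \<Longrightarrow> c \<in> \<pi> ` Y \<Longrightarrow>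
     agree m a x0 \<Longrightarrow> agree m b x0 \<Longrightarrow> agree m (translate l b) x0 \<Longrightarrow> agree m (translate l c) x0 \<Longrightarrow>
     0 \<le> i \<Longrightarrow> i + int L \<le> j \<Longrightarrow> j \<le> l \<Longrightarrow>
     (\<And>k. 0 \<le> k \<Longrightarrow> k \<le> j \<Longrightarrow> a k = b k) \<Longrightarrow> (\<And>k. i \<le> k \<Longrightarrow> k \<le> l \<Longrightarrow> b k = c k) \<Longrightarrow>
     \<exists>e\<in>\<pi> ` Y. (\<forall>k\<le>j. e k = c k) \<and> (\<forall>k\<ge>i. e k = a k)"
    apply (rule crossing)
    subgoal premises p for x0 m L by (rule p(1)[OF p(2)], rule p(3))
    done
  define W where "W = map x0 [- int m..int m]"
  have W: "W \<in> language X" "W \<noteq> []"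
    using x0 unfolding XY X.language_iff[of _ "- int m"] W_def word_at_window by (auto simp: agree_def)
  have lenW: "length W = 2 * m + 1" by (simp add: W_def)
  have ext: "\<exists>p. u @ p @ W \<in> language X \<and> u' @ p @ W \<in> language X"
    if "u \<frown> z \<in> right_rays X" "u' \<frown> z \<in> right_rays X" for u u' z
  proof (rule ccontr)
    assume "\<not> ?thesis"
    from witness[OF W that this] neg show False by contradiction
  qed
  have "\<exists>u t v. length t = n \<and> u @ t \<in> language X \<and> t @ v \<in> language X \<and> u @ t @ v \<notin> language X" for n
    using X.SFT_if_gluing_words[OF X, of n] assms(3) by blast
  then obtain u t v where utv: "\<And>n. length (t n) = n" "\<And>n. u n @ t n \<in> language X"
    "\<And>n. t n @ v n \<in> language X" "\<And>n. u n @ t n @ v n \<notin> language X" by metis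
  have "\<exists>s. W @ s @ t n @ v n \<in> language X" for n
    using irr W utv(3) unfolding irreducible_shift_def by blast
  then obtain s where s: "\<And>n. W @ s n @ t n @ v n \<in> language X" by metis
  text \<open>As follower sets are finite in number, the words to the left of \<open>t n\<close> may be taken
    independent of \<open>n\<close>.\<close>
  define F where "F w = {v. w @ v \<in> language X}" for w
  have "finite (range F)"
    using finite_follower_sets X.closed_shift_axioms unfolding XY F_def by blast
  then have "finite (range F \<times> range F)" by simp
  moreover have "range (\<lambda>n. (F (u n), F (W @ s n))) \<subseteq> range F \<times> range F" by auto
  ultimately have "finite (range (\<lambda>n. (F (u n), F (W @ s n))))" by (rule rev_finite_subset)
  then obtain n0 where n0: "infinite {n \<in> UNIV. (F (u n), F (W @ s n)) = (F (u n0), F (W @ s n0))}"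
    using pigeonhole_infinite[of UNIV "\<lambda>n. (F (u n), F (W @ s n))"] by auto
  define I where "I = {n. F (u n) = F (u n0) \<and> F (W @ s n) = F (W @ s n0)}"
  have I: "infinite I" using n0 unfolding I_def by simp
  define c where "c = u n0"
  define d where "d = W @ s n0"
  \<comment> \<open>Equality of follower sets allows \<open>c\<close> to replace \<open>u n\<close>,
    and \<open>d\<close> to replace \<open>W @ s n\<close>, in front of every word.\<close>
  have cI: "c @ t n \<in> language X" "c @ t n @ v n \<notin> language X" "d @ t n @ v n \<in> language X" if "n \<in> I" for n
  proof -
    have eq: "F c = F (u n)" "F d = F (W @ s n)" using that by (auto simp: I_def c_def d_def)
    show "c @ t n \<in> language X" "c @ t n @ v n \<notin> language X" "d @ t n @ v n \<in> language X"
      using utv(2,4)[of n] s[of n] eq unfolding F_def set_eq_iff mem_Collect_eq append.assoc by blast+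
  qed
  \<comment> \<open>\<open>konig_nat\<close> speaks of infinite sequences, so \<open>t n\<close> is
    padded by a letter of \<open>A\<close>; on a fixed prefix the padding is gone once
    \<open>n\<close> is large.\<close>
  define f where "f n i = (if i < n then t n ! i else x0 0)" for n i
  have "f n i \<in> A" for n i
  proof (cases "i < n")
    case True
    have "t n \<in> lists A" using X.language_lists language_appendD[OF utv(2)] by blast
    then show ?thesis using True utv(1)[of n] by (auto simp: f_def lists_eq_set subset_iff intro!: nth_mem)
  next
    case False
    then show ?thesis using X.range_sub x0 XY by (simp add: f_def)
  qed
  then have "\<exists>g. \<forall>k. infinite {n \<in> I. \<forall>i<k. f n i = g i}"
    by (intro konig_nat[OF X.finite_alphabet _ I])
  then obtain g where "\<forall>k. infinite {n \<in> I. \<forall>i<k. f n i = g i}" ..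
  then have g: "infinite {n \<in> I. \<forall>i<k. f n i = g i}" for k ..
  have gt: "\<exists>n\<in>I. n \<ge> k \<and> take k (t n) = prefix k g" for k
  proof -
    have "\<exists>n\<ge>k. n \<in> {n \<in> I. \<forall>i<k. f n i = g i}"
      using g[of k] unfolding infinite_nat_iff_unbounded_le by (rule spec)
    then obtain n where n: "n \<ge> k" "n \<in> I" "\<forall>i<k. f n i = g i" by blast
    then have "take k (t n) = prefix k g"
      using utv(1)[of n] by (intro nth_equalityI) (auto simp: f_def)
    then show ?thesis using n by blast
  qed
  have pre: "c @ prefix k g \<in> language X" "d @ prefix k g \<in> language X" for k
  proof -
    obtain n where n: "n \<in> I" "take k (t n) = prefix k g" using gt by blast
    have "t n = prefix k g @ drop k (t n)" using n(2) by (metis append_take_drop_id)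
    then have "(c @ prefix k g) @ drop k (t n) \<in> language X" "(d @ prefix k g) @ drop k (t n) @ v n \<in> language X"
      using cI(1,3)[OF n(1)] by (metis append.assoc)+
    then show "c @ prefix k g \<in> language X" "d @ prefix k g \<in> language X"
      using language_appendD by blast+
  qed
  have rays: "c \<frown> g \<in> right_rays X" "d \<frown> g \<in> right_rays X" using X.right_ray_concI pre by blast+
  \<comment> \<open>The first L+1 letters of the common ray become the overlap:
    \<open>crossing\<close> asks for \<open>i + L \<le> j\<close>, and if \<open>q\<close> starts at
    \<open>i\<close>, its last letter sits at \<open>i + L\<close>.\<close>
  define q where "q = prefix (Suc L) g"
  have gq: "g = q \<frown> suffix (Suc L) g" unfolding q_def by (rule prefix_suffix)
  have lenq: "length q = Suc L" by (simp add: q_def)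
  have "(c @ q) \<frown> suffix (Suc L) g \<in> right_rays X" "(d @ q) \<frown> suffix (Suc L) g \<in> right_rays X"
    using rays by (metis conc_conc gq)+
  then obtain p where p: "(c @ q) @ p @ W \<in> language X" "(d @ q) @ p @ W \<in> language X"
    using ext by blast
  obtain n where n: "n \<in> I" "take (Suc L) (t n) = q" using gt[of "Suc L"] unfolding q_def by blast
  define r where "r = drop (Suc L) (t n) @ v n"
  have qr: "t n @ v n = q @ r" unfolding r_def n(2)[symmetric] by simp
  \<comment> \<open>Coordinates are chosen so that the \<open>W\<close> at the head of
    \<open>d\<close> is centred at 0. Then \<open>q\<close> starts at \<open>i\<close>, and the
    \<open>W\<close> that follows \<open>q\<close> and \<open>p\<close> is centred at
    \<open>l\<close>.\<close>
  define i where "i = - int m + int (length d)"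
  define l where "l = i + int (Suc L) + int (length p) + int m"
  have i: "0 \<le> i" by (simp add: i_def d_def lenW)
  obtain xa where xa: "xa \<in> X" "word_at xa (- int m) (d @ q @ r)"
    using cI(3)[OF n(1)] X.language_iff unfolding qr by blast
  obtain xb where xb: "xb \<in> X" "word_at xb (- int m) (d @ q @ p @ W)"
    using p(2) X.language_iff by (metis append.assoc)
  obtain xc where xc: "xc \<in> X" "word_at xc (i - int (length c)) (c @ q @ p @ W)"
    using p(1) X.language_iff by (metis append.assoc)
  have xa': "word_at xa (- int m) (d @ q)" "word_at xa i q" "word_at xa (i + int (length q)) r"
    using xa(2) by (simp_all add: word_at_append i_def)
  have xb': "word_at xb (- int m) (d @ q)" "word_at xb i (q @ p @ W)"
    using xb(2) by (simp_all add: word_at_append i_def)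
  have xc': "word_at xc (i - int (length c)) (c @ q)" "word_at xc i (q @ p @ W)"
    using xc(2) by (simp_all add: word_at_append)
  have win: "agree m y x0" if "word_at y (- int m) d" for y
    using that by (simp add: d_def word_at_append W_def word_at_window)
  have winl: "agree m (translate l y) x0" if "word_at y i (q @ p @ W)" for y
  proof -
    have "word_at y (- int m + l) W"
      using that by (simp add: word_at_append l_def lenq add.assoc add.commute add.left_commute)
    then show ?thesis by (simp add: W_def word_at_window[symmetric] word_at_translate)
  qed
  \<comment> \<open>Up to \<open>i + L\<close> the crossed point shows \<open>c @ q\<close>, and
    from \<open>i\<close> on it shows \<open>q @ r\<close>; together they form the inadmissible word
    \<open>c @ t n @ v n\<close>.\<close>
  have "\<exists>e\<in>X. (\<forall>k\<le>i + int L. e k = xc k) \<and> (\<forall>k\<ge>i. e k = xa k)"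
    unfolding XY[symmetric]
  proof (rule cross[where b = xb and l = l])
    show "agree m xa x0" "agree m xb x0"
      using win xa'(1) xb'(1) by (simp_all add: word_at_append)
    show "agree m (translate l xb) x0" "agree m (translate l xc) x0"
      using winl xb'(2) xc'(2) by blast+
    show "xa k = xb k" if "0 \<le> k" "k \<le> i + int L" for k
      using that by (intro word_at_eq[OF xa'(1) xb'(1)]) (auto simp: i_def lenq)
    show "xb k = xc k" if "i \<le> k" "k \<le> l" for k
      using that by (intro word_at_eq[OF xb'(2) xc'(2)]) (auto simp: l_def lenq lenW)
  qed (use xa xb xc XY i in \<open>auto simp: l_def\<close>)
  then obtain e where e: "e \<in> X" "\<And>k. k \<le> i + int L \<Longrightarrow> e k = xc k" "\<And>k. i \<le> k \<Longrightarrow> e k = xa k"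
    by blast
  have "word_at e (i - int (length c)) (c @ q)"
    using e(2) by (intro word_at_cong[OF xc'(1)]) (auto simp: lenq)
  moreover have "word_at e (i + int (length q)) r"
    using e(3) by (intro word_at_cong[OF xa'(3)]) auto
  ultimately have "word_at e (i - int (length c)) (c @ q @ r)"
    by (simp add: word_at_append)
  then have "c @ t n @ v n \<in> language X" unfolding qr using e(1) X.language_iff by blast
  then show False using cI(2)[OF n(1)] by blast
qed

section \<open>Ideals of C*-algebras\<close>

context cstar_algebra
begin

lemma zer_add: "x \<in> carr M \<Longrightarrow> add M (zer M) x = x"
  using add_commute add_zer zer_closed by metis

lemma neg_add: "x \<in> carr M \<Longrightarrow> add M (scl M (- 1) x) x = zer M"
  using add_commute add_neg scl_closed by metis

lemma add_left_cancel:
  assumes "x \<in> carr M" "y \<in> carr M" "z \<in> carr M" "add M x y = add M x z"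
  shows "y = z"
proof -
  have "add M (scl M (- 1) x) (add M x y) = add M (scl M (- 1) x) (add M x z)" using assms by simp
  then show ?thesis using assms neg_add zer_add scl_closed add_assoc by metis
qed

lemma scl_0: "x \<in> carr M \<Longrightarrow> scl M 0 x = zer M"
  using add_left_cancel[of "scl M 0 x" "scl M 0 x" "zer M"] add_scl[of x 0 0]
  by (simp add: scl_closed zer_closed add_zer)

lemma scl_zer: "scl M a (zer M) = zer M"
  using scl_scl[of "zer M" a 0] scl_0[OF zer_closed] zer_closed by simp

lemma mul_zer: "x \<in> carr M \<Longrightarrow> mul M x (zer M) = zer M"
  using mul_scl[of x "zer M" 0] scl_0 mul_closed zer_closed by metis

lemma zer_mul: "x \<in> carr M \<Longrightarrow> mul M (zer M) x = zer M"
  using scl_mul[of "zer M" x 0] scl_0 mul_closed zer_closed by metis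

lemma nrm_zer: "nrm M (zer M) = 0"
  using nrm_eq_0 zer_closed by blast

lemma add_add_swap:
  assumes "a \<in> carr M" "b \<in> carr M" "c \<in> carr M" "d \<in> carr M"
  shows "add M (add M a b) (add M c d) = add M (add M a c) (add M b d)"
  using assms add_assoc add_commute add_closed by metis

lemma sub_closed: "x \<in> carr M \<Longrightarrow> y \<in> carr M \<Longrightarrow> add M x (scl M (- 1) y) \<in> carr M"
  by (simp add: add_closed scl_closed)

lemma dst_nonneg: "x \<in> carr M \<Longrightarrow> y \<in> carr M \<Longrightarrow> 0 \<le> dst M x y"
  by (simp add: dst_def nrm_nonneg sub_closed)

lemma dst_self: "x \<in> carr M \<Longrightarrow> dst M x x = 0"
  by (simp add: dst_def add_neg nrm_zer)

lemma dst_zer: "x \<in> carr M \<Longrightarrow> dst M x (zer M) = nrm M x"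
  by (simp add: dst_def scl_zer add_zer)

lemma dst_eq_0:
  assumes "x \<in> carr M" "y \<in> carr M" "dst M x y = 0" shows "x = y"
proof -
  have "add M x (scl M (- 1) y) = zer M" using assms by (simp add: dst_def nrm_eq_0 sub_closed)
  then have "add M (scl M (- 1) y) x = add M (scl M (- 1) y) y"
    using assms add_commute scl_closed neg_add by metis
  then show ?thesis using add_left_cancel assms scl_closed by blast
qed

lemma dst_add:
  assumes "x \<in> carr M" "y \<in> carr M" "x' \<in> carr M" "y' \<in> carr M"
  shows "dst M (add M x x') (add M y y') \<le> dst M x y + dst M x' y'"
proof -
  have "add M (add M x x') (scl M (- 1) (add M y y')) =
      add M (add M x (scl M (- 1) y)) (add M x' (scl M (- 1) y'))"
    using assms by (simp add: scl_add scl_closed add_add_swap)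
  then show ?thesis unfolding dst_def using assms by (simp add: nrm_add sub_closed)
qed

lemma dst_commute:
  assumes "x \<in> carr M" "y \<in> carr M" shows "dst M x y = dst M y x"
proof -
  have "scl M (- 1) (add M x (scl M (- 1) y)) = add M y (scl M (- 1) x)"
    using assms by (simp add: scl_add scl_closed scl_scl scl_one add_commute)
  then have "nrm M (add M y (scl M (- 1) x)) = cmod (- 1) * nrm M (add M x (scl M (- 1) y))"
    using nrm_scl[OF sub_closed[OF assms], of "-1"] by simp
  then show ?thesis by (simp add: dst_def)
qed

lemma dst_triangle:
  assumes "x \<in> carr M" "y \<in> carr M" "z \<in> carr M"
  shows "dst M x z \<le> dst M x y + dst M y z"
proof -
  have "add M (add M x (scl M (- 1) y)) (add M y (scl M (- 1) z)) =
      add M (add M x (scl M (- 1) z)) (add M (scl M (- 1) y) y)"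
    using assms by (metis add_add_swap add_commute scl_closed)
  also have "\<dots> = add M x (scl M (- 1) z)" using assms by (simp add: neg_add add_zer sub_closed)
  finally show ?thesis unfolding dst_def using assms nrm_add sub_closed by metis
qed

lemma dst_scl:
  assumes "x \<in> carr M" "y \<in> carr M" shows "dst M (scl M a x) (scl M a y) = cmod a * dst M x y"
proof -
  have "add M (scl M a x) (scl M (- 1) (scl M a y)) = scl M a (add M x (scl M (- 1) y))"
    using assms by (simp add: scl_add scl_closed scl_scl)
  then show ?thesis using assms by (simp add: dst_def nrm_scl sub_closed)
qed

lemma dst_mul_left:
  assumes "c \<in> carr M" "x \<in> carr M" "y \<in> carr M"
  shows "dst M (mul M c x) (mul M c y) \<le> nrm M c * dst M x y"
proof -
  have "add M (mul M c x) (scl M (- 1) (mul M c y)) = mul M c (add M x (scl M (- 1) y))"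
    using assms by (simp add: mul_add scl_closed mul_scl)
  then show ?thesis using assms by (simp add: dst_def nrm_mul sub_closed)
qed

lemma dst_mul_right:
  assumes "c \<in> carr M" "x \<in> carr M" "y \<in> carr M"
  shows "dst M (mul M x c) (mul M y c) \<le> dst M x y * nrm M c"
proof -
  have "add M (mul M x c) (scl M (- 1) (mul M y c)) = mul M (add M x (scl M (- 1) y)) c"
    using assms by (simp add: add_mul scl_closed scl_mul)
  then show ?thesis using assms by (simp add: dst_def nrm_mul sub_closed)
qed

lemma limit_unique:
  assumes "\<And>n. \<sigma> n \<in> carr M" "x \<in> carr M" "y \<in> carr M"
    "(\<lambda>n. dst M (\<sigma> n) x) \<longlonglongrightarrow> 0" "(\<lambda>n. dst M (\<sigma> n) y) \<longlonglongrightarrow> 0"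
  shows "x = y"
proof (rule dst_eq_0)
  have "(\<lambda>n. dst M (\<sigma> n) x + dst M (\<sigma> n) y) \<longlonglongrightarrow> 0" using tendsto_add[OF assms(4,5)] by simp
  moreover have "dst M x y \<le> dst M (\<sigma> n) x + dst M (\<sigma> n) y" for n
    using dst_triangle[of x "\<sigma> n" y] dst_commute[of x "\<sigma> n"] assms by simp
  ultimately have "dst M x y \<le> 0" by (intro LIMSEQ_le_const) auto
  then show "dst M x y = 0" using dst_nonneg assms by (simp add: order_antisym)
qed (use assms in auto)

lemma mul_limit_left:
  assumes "c \<in> carr M" "\<And>n. \<sigma> n \<in> carr M" "x \<in> carr M" "(\<lambda>n. dst M (\<sigma> n) x) \<longlonglongrightarrow> 0"
  shows "(\<lambda>n. dst M (mul M c (\<sigma> n)) (mul M c x)) \<longlonglongrightarrow> 0"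
proof (rule Lim_null_comparison)
  show "(\<lambda>n. nrm M c * dst M (\<sigma> n) x) \<longlonglongrightarrow> 0" using tendsto_mult_right_zero[OF assms(4)] .
qed (use assms dst_mul_left dst_nonneg mul_closed in auto)

lemma mul_limit_right:
  assumes "c \<in> carr M" "\<And>n. \<sigma> n \<in> carr M" "x \<in> carr M" "(\<lambda>n. dst M (\<sigma> n) x) \<longlonglongrightarrow> 0"
  shows "(\<lambda>n. dst M (mul M (\<sigma> n) c) (mul M x c)) \<longlonglongrightarrow> 0"
proof (rule Lim_null_comparison)
  show "(\<lambda>n. dst M (\<sigma> n) x * nrm M c) \<longlonglongrightarrow> 0" using tendsto_mult_left_zero[OF assms(4)] .
qed (use assms dst_mul_right dst_nonneg mul_closed in auto)

section \<open>Units and closed ideals\<close>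

lemma generated_subset:
  assumes "cstar_subalgebra M H" "G \<subseteq> H" shows "carr (cstar_generated M G) \<subseteq> H"
  using assms by (auto simp: cstar_generated_def)

text \<open>Put q = adj(p) p, which is self-adjoint. Idempotence and the partial isometry relation
  collapse adj(p - q) (p - q) to q - q - q + q, so p = q by the C*-identity. This is meant for the
  generator of the empty word.\<close>

lemma idempotent_partial_isometry_self_adjoint:
  assumes p: "partial_isometry M p" "mul M p p = p"
  shows "adj M p = p"
proof -
  have c: "p \<in> carr M" "adj M p \<in> carr M" using p(1) adj_closed by (auto simp: partial_isometry_def)
  define q where "q = mul M (adj M p) p"
  have q: "q \<in> carr M" using c by (simp add: q_def mul_closed)
  have aq: "adj M q = q" using c by (simp add: q_def adj_mul adj_adj)
  have aa: "mul M (adj M p) (adj M p) = adj M p" using adj_mul[OF c(1) c(1)] p(2) by simp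
  have pq: "mul M (adj M p) q = q" using c aa by (simp add: q_def mul_assoc[symmetric])
  have qp: "mul M q p = q" using c p(2) by (simp add: q_def mul_assoc)
  have qq: "mul M q q = q"
    using pq p(1) c mul_assoc mul_closed unfolding partial_isometry_def q_def by metis
  have cq: "scl M (- 1) q \<in> carr M" using q scl_closed by blast
  have "mul M (adj M (add M p (scl M (- 1) q))) (add M p (scl M (- 1) q)) =
     mul M (add M (adj M p) (scl M (- 1) q)) (add M p (scl M (- 1) q))"
    using c q cq by (simp add: adj_add adj_scl aq)
  also have "\<dots> = add M (add M q (scl M (- 1) q)) (add M (scl M (- 1) q) q)"
    using c q cq sub_closed
    by (simp add: mul_add add_mul mul_scl scl_mul pq qp qq scl_add scl_scl scl_one q_def[symmetric] add_closed)
  also have "\<dots> = zer M" using q by (simp add: add_neg neg_add add_zer zer_closed)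
  finally have "(nrm M (add M p (scl M (- 1) q)))\<^sup>2 = 0"
    using cstar_identity[OF sub_closed[OF c(1) q]] nrm_zer by simp
  then have "p = q" using dst_eq_0[OF c(1) q] by (simp add: dst_def)
  then show ?thesis using aq by simp
qed

text \<open>The elements on which \<open>p\<close> acts as a two-sided unit form a C*-subalgebra;
  self-adjointness of \<open>p\<close> makes this set closed under adjoints.\<close>

lemma unit_of_generators:
  assumes gen: "carr (cstar_generated M G) = carr M" and p: "p \<in> carr M" "adj M p = p"
    and G: "G \<subseteq> carr M" "\<And>s. s \<in> G \<Longrightarrow> mul M p s = s \<and> mul M s p = s"
    and x: "x \<in> carr M"
  shows "mul M p x = x" "mul M x p = x"
proof -
  define H where "H = {x \<in> carr M. mul M p x = x \<and> mul M x p = x}"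
  have "norm_closed M H"
    unfolding norm_closed_def
  proof (intro allI impI)
    fix \<sigma> l assume s: "range \<sigma> \<subseteq> H" and l: "l \<in> carr M" "(\<lambda>n. dst M (\<sigma> n) l) \<longlonglongrightarrow> 0"
    have sc: "\<And>n. \<sigma> n \<in> carr M" and e: "\<And>n. mul M p (\<sigma> n) = \<sigma> n" "\<And>n. mul M (\<sigma> n) p = \<sigma> n"
      using s by (auto simp: H_def image_subset_iff)
    show "l \<in> H"
      using limit_unique[OF sc _ l(1) _ l(2), of "mul M p l"] mul_limit_left[OF p(1) sc l]
        limit_unique[OF sc _ l(1) _ l(2), of "mul M l p"] mul_limit_right[OF p(1) sc l]
      by (simp add: e H_def l p mul_closed)
  qed
  moreover have "adj M x \<in> H" if "x \<in> H" for x
  proof -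
    have x: "x \<in> carr M" "mul M p x = x" "mul M x p = x" using that by (auto simp: H_def)
    have "mul M p (adj M x) = adj M x" "mul M (adj M x) p = adj M x"
      using adj_mul[OF x(1) p(1)] adj_mul[OF p(1) x(1)] x p(2) by simp_all
    then show ?thesis using x adj_closed by (simp add: H_def)
  qed
  moreover have "mul M x y \<in> H" if "x \<in> H" "y \<in> H" for x y
    using that p by (auto simp: H_def mul_closed mul_assoc[of x y p]) (metis mul_assoc)
  ultimately have "cstar_subalgebra M H"
    unfolding cstar_subalgebra_def
    by (auto simp: H_def zer_closed add_closed scl_closed p mul_zer zer_mul mul_add add_mul mul_scl scl_mul)
  then have "carr M \<subseteq> H" using generated_subset[of H G] gen G by (auto simp: H_def)
  then show "mul M p x = x" "mul M x p = x" using x by (auto simp: H_def)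
qed

definition norm_closure :: "'c set \<Rightarrow> 'c set" where
  "norm_closure J = {x \<in> carr M. \<forall>e>0. \<exists>y\<in>J. dst M x y < e}"

lemma closed_ideal_norm_closure:
  assumes J: "J \<subseteq> carr M" "zer M \<in> J" "\<And>x y. x \<in> J \<Longrightarrow> y \<in> J \<Longrightarrow> add M x y \<in> J"
    "\<And>x a. x \<in> J \<Longrightarrow> scl M a x \<in> J"
    "\<And>x y. x \<in> J \<Longrightarrow> y \<in> carr M \<Longrightarrow> mul M x y \<in> J \<and> mul M y x \<in> J"
  shows "closed_ideal M (norm_closure J)"
  unfolding closed_ideal_def
proof (intro conjI ballI allI)
  have approx: "\<exists>y\<in>J. dst M x y < e" if "x \<in> norm_closure J" "e > 0" for x e
    using that by (simp add: norm_closure_def)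
  show "norm_closure J \<subseteq> carr M" by (auto simp: norm_closure_def)
  show "zer M \<in> norm_closure J"
    using J(2) zer_closed dst_self by (auto simp: norm_closure_def intro!: bexI[of _ "zer M"])
  show "add M x y \<in> norm_closure J" if "x \<in> norm_closure J" "y \<in> norm_closure J" for x y
  proof -
    have c: "x \<in> carr M" "y \<in> carr M" using that by (auto simp: norm_closure_def)
    have "\<exists>z\<in>J. dst M (add M x y) z < e" if "e > 0" for e
    proof -
      have "e / 2 > 0" using that by simp
      then obtain x' y' where x': "x' \<in> J" "dst M x x' < e / 2" "y' \<in> J" "dst M y y' < e / 2"
        using approx[OF \<open>x \<in> norm_closure J\<close>] approx[OF \<open>y \<in> norm_closure J\<close>] by metis
      then have "x' \<in> carr M" "y' \<in> carr M" using J(1) by blast+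
      then have "dst M (add M x y) (add M x' y') < e" using dst_add[of x x' y y'] c x' by simp
      then show ?thesis using J(3) x' by blast
    qed
    then show ?thesis using c add_closed by (simp add: norm_closure_def)
  qed
  \<comment> \<open>Scaling and multiplication by a fixed element are Lipschitz maps preserving
    \<open>J\<close>, hence they preserve its closure; \<open>C + 1\<close> in place of
    \<open>C\<close> avoids a division by 0.\<close>
  have lip: "f x \<in> norm_closure J"
    if x: "x \<in> norm_closure J" and f: "\<And>y. y \<in> J \<Longrightarrow> f y \<in> J" "f x \<in> carr M"
      "\<And>y. y \<in> J \<Longrightarrow> dst M (f x) (f y) \<le> C * dst M x y" "C \<ge> 0" for f x C
  proof -
    have "\<exists>z\<in>J. dst M (f x) z < e" if "e > 0" for e
    proof -
      have "e / (C + 1) > 0" using that f(4) by simp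
      then obtain y where y: "y \<in> J" "dst M x y < e / (C + 1)" using approx[OF x] by blast
      have "dst M (f x) (f y) \<le> C * dst M x y" using f(3) y by blast
      also have "\<dots> \<le> C * (e / (C + 1))" using y f(4) by (intro mult_left_mono) auto
      also have "\<dots> < e" using that f(4) by (simp add: field_simps)
      finally show ?thesis using f(1) y by blast
    qed
    then show ?thesis using f by (simp add: norm_closure_def)
  qed
  have cl: "x \<in> carr M" if "x \<in> norm_closure J" for x using that by (simp add: norm_closure_def)
  show "scl M a x \<in> norm_closure J" if "x \<in> norm_closure J" for x a
    by (rule lip[OF that, where C = "cmod a"]) (use J cl[OF that] scl_closed in \<open>auto simp: dst_scl subset_iff\<close>)
  show "mul M x y \<in> norm_closure J" if "x \<in> norm_closure J" "y \<in> carr M" for x y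
    by (rule lip[OF that(1), where C = "nrm M y"])
      (use J cl[OF that(1)] mul_closed that dst_mul_right[of y x] in \<open>auto simp: subset_iff nrm_nonneg mult.commute\<close>)
  show "mul M y x \<in> norm_closure J" if "x \<in> norm_closure J" "y \<in> carr M" for x y
    by (rule lip[OF that(1), where C = "nrm M y"])
      (use J cl[OF that(1)] mul_closed that dst_mul_left[of y x] in \<open>auto simp: subset_iff nrm_nonneg\<close>)
  show "norm_closed M (norm_closure J)"
    unfolding norm_closed_def
  proof (intro allI impI)
    fix \<sigma> l assume s: "range \<sigma> \<subseteq> norm_closure J" and l: "l \<in> carr M" "(\<lambda>n. dst M (\<sigma> n) l) \<longlonglongrightarrow> 0"
    have "\<exists>y\<in>J. dst M l y < e" if "e > 0" for e
    proof -
      have e: "e / 2 > 0" using that by simp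
      then obtain n where n: "dst M (\<sigma> n) l < e / 2"
        using order_tendstoD(2)[OF l(2) e] by (auto simp: eventually_sequentially)
      have sn: "\<sigma> n \<in> norm_closure J" using s by auto
      then obtain y where y: "y \<in> J" "dst M (\<sigma> n) y < e / 2" using approx e by blast
      have "dst M l y \<le> dst M l (\<sigma> n) + dst M (\<sigma> n) y"
        using l cl[OF sn] y J(1) by (intro dst_triangle) auto
      then have "dst M l y < e" using n y dst_commute[OF l(1) cl[OF sn]] by simp
      then show ?thesis using y by blast
    qed
    then show "l \<in> norm_closure J" using l by (simp add: norm_closure_def)
  qed
qed

text \<open>The limit of the contraction \<open>z \<mapsto> e + r z\<close>, i.e. the Neumann series of \<open>r\<close> for a unit \<open>e\<close>.\<close>

lemma affine_fixed_point:
  assumes e: "e \<in> carr M" and r: "r \<in> carr M" "nrm M r < 1"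
  obtains z where "z \<in> carr M" "z = add M e (mul M r z)"
proof -
  define s where "s n = ((\<lambda>z. add M e (mul M r z)) ^^ n) (zer M)" for n
  have s0: "s 0 = zer M" and sS: "s (Suc n) = add M e (mul M r (s n))" for n by (simp_all add: s_def)
  have sc: "s n \<in> carr M" for n
    by (induction n) (simp_all add: s0 sS zer_closed add_closed mul_closed e r)
  have contr: "dst M (add M e (mul M r x)) (add M e (mul M r y)) \<le> nrm M r * dst M x y"
    if "x \<in> carr M" "y \<in> carr M" for x y
    using dst_add[of e e "mul M r x" "mul M r y"] dst_mul_left[of r x y] that e r dst_self[OF e] mul_closed
    by fastforce
  define q where "q = nrm M r"
  have q: "0 \<le> q" "q < 1" using r nrm_nonneg by (auto simp: q_def)
  \<comment> \<open>\<open>C\<close> is the fixed point of c \<mapsto> nrm e + q c, so the iterates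
    stay in the ball of radius \<open>C\<close>.\<close>
  define C where "C = nrm M e / (1 - q)"
  have C: "C \<ge> 0" using q nrm_nonneg[OF e] by (simp add: C_def)
  have bound: "nrm M (s n) \<le> C" for n
  proof (induction n)
    case (Suc n)
    have "nrm M (s (Suc n)) \<le> nrm M e + q * nrm M (s n)"
      using nrm_add[of e "mul M r (s n)"] nrm_mul[of r "s n"] e r sc mul_closed by (fastforce simp: sS q_def)
    also have "\<dots> \<le> nrm M e + q * C" using Suc q by (simp add: mult_left_mono)
    also have "\<dots> = C" using q by (simp add: C_def field_simps)
    finally show ?case .
  qed (simp add: s0 nrm_zer C)
  have step: "dst M (s (n + m)) (s n) \<le> q ^ n * C" for m n
  proof (induction n)
    case 0
    then show ?case using bound by (simp add: s0 dst_zer sc)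
  next
    case (Suc n)
    have "dst M (s (Suc (n + m))) (s (Suc n)) \<le> q * dst M (s (n + m)) (s n)"
      unfolding sS q_def using contr sc by blast
    also have "\<dots> \<le> q * (q ^ n * C)" using Suc q by (intro mult_left_mono) auto
    finally show ?case by (simp add: mult.assoc)
  qed
  have "\<exists>N. \<forall>m\<ge>N. \<forall>n\<ge>N. dst M (s m) (s n) < d" if "d > 0" for d
  proof -
    have "(\<lambda>n. q ^ n * C) \<longlonglongrightarrow> 0" using LIMSEQ_realpow_zero[OF q] tendsto_mult_left_zero by blast
    moreover have "d / 2 > 0" using that by simp
    ultimately obtain N where N: "q ^ N * C < d / 2"
      using order_tendstoD(2) by (fastforce simp: eventually_sequentially)
    have "dst M (s n) (s N) < d / 2" if "n \<ge> N" for n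
      using step[of N "n - N"] N that by simp
    then have "dst M (s m) (s n) < d" if "m \<ge> N" "n \<ge> N" for m n
      using dst_triangle[OF sc sc sc, of m n N] dst_commute[OF sc sc, of N n] that by (smt (verit) field_sum_of_halves)
    then show ?thesis by blast
  qed
  then obtain z where z: "z \<in> carr M" "(\<lambda>n. dst M (s n) z) \<longlonglongrightarrow> 0"
    using complete[of s] sc by blast
  have "(\<lambda>n. dst M (s (Suc n)) (add M e (mul M r z))) \<longlonglongrightarrow> 0"
  proof (rule Lim_null_comparison)
    show "(\<lambda>n. q * dst M (s n) z) \<longlonglongrightarrow> 0" using tendsto_mult_right_zero[OF z(2)] .
    have "norm (dst M (s (Suc n)) (add M e (mul M r z))) \<le> q * dst M (s n) z" for n
      using contr[OF sc z(1), of n] dst_nonneg[of "s (Suc n)" "add M e (mul M r z)"] sc z e r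
      by (simp add: sS q_def add_closed mul_closed)
    then show "\<forall>\<^sub>F n in sequentially. norm (dst M (s (Suc n)) (add M e (mul M r z))) \<le> q * dst M (s n) z"
      by simp
  qed
  moreover have "(\<lambda>n. dst M (s (Suc n)) z) \<longlonglongrightarrow> 0" using LIMSEQ_Suc[OF z(2)] .
  ultimately have "z = add M e (mul M r z)"
    using limit_unique[of "\<lambda>n. s (Suc n)" z "add M e (mul M r z)"] sc z e r add_closed mul_closed by blast
  then show ?thesis using that z by blast
qed

text \<open>Closing up the kernel makes the argument independent of continuity of
  \<open>\<psi>\<close>. If the closure were everything, some x in the kernel would have distance
  less than 1 from \<open>e\<close>; then r = e - x has the same image as \<open>e\<close>, and
  applying \<open>\<psi>\<close> to a solution of z = e + r z forces the image of \<open>e\<close>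
  to vanish.\<close>

lemma not_simple_if_noninjective_hom:
  assumes N: "cstar_algebra N" and h: "star_hom M N \<psi>"
    and e: "e \<in> carr M" "\<And>x. x \<in> carr M \<Longrightarrow> mul M e x = x" "\<psi> e \<noteq> zer N"
    and a: "a \<in> carr M" "a \<noteq> zer M" "\<psi> a = zer N"
  shows "\<not> simple_cstar M"
proof
  assume simple: "simple_cstar M"
  interpret N: cstar_algebra N by (rule N)
  have hc: "\<psi> x \<in> carr N" if "x \<in> carr M" for x using h that by (auto simp: star_hom_def)
  have hadd: "\<psi> (add M x y) = add N (\<psi> x) (\<psi> y)" and hmul: "\<psi> (mul M x y) = mul N (\<psi> x) (\<psi> y)"
    if "x \<in> carr M" "y \<in> carr M" for x y using h that by (auto simp: star_hom_def)
  have hscl: "\<psi> (scl M b x) = scl N b (\<psi> x)" if "x \<in> carr M" for x b using h that by (auto simp: star_hom_def)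
  have hz: "\<psi> (zer M) = zer N"
    using hscl[OF zer_closed, of 0] scl_0[OF zer_closed] N.scl_0 hc zer_closed by metis
  define J where "J = {x \<in> carr M. \<psi> x = zer N}"
  have "closed_ideal M (norm_closure J)"
    by (rule closed_ideal_norm_closure)
      (auto simp: J_def hz zer_closed add_closed scl_closed mul_closed hadd hscl hmul hc
        N.add_zer N.zer_closed N.scl_zer N.mul_zer N.zer_mul)
  then consider "norm_closure J = {zer M}" | "norm_closure J = carr M"
    using simple by (auto simp: simple_cstar_def)
  then show False
  proof cases
    case 1
    have "a \<in> norm_closure J"
      using a dst_self by (auto simp: norm_closure_def J_def intro!: bexI[of _ a])
    then show False using a 1 by blast
  next
    case 2
    then have "e \<in> norm_closure J" using e by simp
    then obtain x where x: "x \<in> J" "dst M e x < 1" unfolding norm_closure_def using zero_less_one by blast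
    then have xc: "x \<in> carr M" "\<psi> x = zer N" by (auto simp: J_def)
    define r where "r = add M e (scl M (- 1) x)"
    have r: "r \<in> carr M" "nrm M r < 1" using x xc e sub_closed by (auto simp: r_def dst_def)
    have "\<psi> r = \<psi> e"
      using xc e by (simp add: r_def hadd hscl scl_closed N.scl_zer N.add_zer hc)
    obtain z where z: "z \<in> carr M" "z = add M e (mul M r z)"
      using affine_fixed_point[OF e(1) r] by blast
    have "\<psi> z = add N (\<psi> e) (mul N (\<psi> r) (\<psi> z))"
      using z e r hadd hmul mul_closed by metis
    also have "mul N (\<psi> r) (\<psi> z) = \<psi> z" 
      using \<open>\<psi> r = \<psi> e\<close> hmul e z by metis
    finally have "add N (\<psi> z) (\<psi> e) = add N (\<psi> z) (zer N)"
      using N.add_commute[OF hc[OF z(1)] hc[OF e(1)]] N.add_zer[OF hc[OF z(1)]] by simp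
    then show False using N.add_left_cancel[OF hc[OF z(1)] hc[OF e(1)] N.zer_closed] e(3) by simp
  qed
qed

end

section \<open>Operators on square summable sequences\<close>

definition square_summable :: "(nat \<Rightarrow> complex) \<Rightarrow> bool" where
  "square_summable f \<longleftrightarrow> summable (\<lambda>n. (cmod (f n))\<^sup>2)"

lemma square_summable_inner:
  assumes "square_summable f" "square_summable g"
  shows "summable (\<lambda>n. \<bar>f n \<bullet> g n\<bar>)"
proof (rule summable_comparison_test')
  show "summable (\<lambda>n. (cmod (f n))\<^sup>2 + (cmod (g n))\<^sup>2)"
    using assms unfolding square_summable_def by (rule summable_add)
  fix n
  have "\<bar>f n \<bullet> g n\<bar> \<le> cmod (f n) * cmod (g n)" by (rule Cauchy_Schwarz_ineq2)
  also have "\<dots> \<le> (cmod (f n))\<^sup>2 + (cmod (g n))\<^sup>2"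
    using sum_squares_bound[of "cmod (f n)" "cmod (g n)"] mult_nonneg_nonneg[OF norm_ge_zero[of "f n"] norm_ge_zero[of "g n"]]
    unfolding mult.assoc by linarith
  finally show "norm \<bar>f n \<bullet> g n\<bar> \<le> (cmod (f n))\<^sup>2 + (cmod (g n))\<^sup>2" by simp
qed

lemma square_summable_add:
  assumes "square_summable f" "square_summable g"
  shows "square_summable (\<lambda>n. f n + g n)"
proof -
  have eq: "(cmod (f n + g n))\<^sup>2 = (cmod (f n))\<^sup>2 + 2 * (f n \<bullet> g n) + (cmod (g n))\<^sup>2" for n
    by (simp add: power2_norm_eq_inner inner_add inner_commute)
  show ?thesis unfolding square_summable_def eq
    using assms unfolding square_summable_def
    by (intro summable_add summable_mult summable_rabs_cancel[OF square_summable_inner[OF assms]])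
qed

lemma square_summable_mult: "square_summable f \<Longrightarrow> square_summable (\<lambda>n. a * f n)"
  unfolding square_summable_def by (simp add: norm_mult power_mult_distrib summable_mult)

lemma square_summable_scaleR: "square_summable f \<Longrightarrow> square_summable (\<lambda>n. r *\<^sub>R f n)"
  using square_summable_mult[of f "of_real r"] by (simp add: scaleR_conv_of_real)

lemma square_summable_uminus: "square_summable f \<Longrightarrow> square_summable (\<lambda>n. - f n)"
  using square_summable_mult[of f "-1"] by simp

lemma square_summable_0: "square_summable (\<lambda>_. 0)"
  by (simp add: square_summable_def)

text \<open>A type of its own can be made an instance of the class of Banach spaces, which brings
  the complete normed space of bounded operators with it.\<close>

typedef ell2 = "{f. square_summable f}"
  morphisms coords Abs_ell2
  using square_summable_0 by blast

setup_lifting type_definition_ell2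

lemma square_summable_coords: "square_summable (coords x)"
  using coords by blast

instantiation ell2 :: real_inner
begin

lift_definition zero_ell2 :: ell2 is "\<lambda>_. 0" by (rule square_summable_0)

lift_definition plus_ell2 :: "ell2 \<Rightarrow> ell2 \<Rightarrow> ell2" is "\<lambda>f g n. f n + g n"
  by (rule square_summable_add)

lift_definition uminus_ell2 :: "ell2 \<Rightarrow> ell2" is "\<lambda>f n. - f n"
  by (rule square_summable_uminus)

lift_definition minus_ell2 :: "ell2 \<Rightarrow> ell2 \<Rightarrow> ell2" is "\<lambda>f g n. f n - g n"
  using square_summable_add[OF _ square_summable_uminus] by simp

lift_definition scaleR_ell2 :: "real \<Rightarrow> ell2 \<Rightarrow> ell2" is "\<lambda>r f n. r *\<^sub>R f n"
  by (rule square_summable_scaleR)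

text \<open>The inner product of two complex numbers is the real one, so this is the real part of
  the usual inner product of sequences; the norm is the usual one.\<close>

definition inner_ell2 :: "ell2 \<Rightarrow> ell2 \<Rightarrow> real" where
  "inner_ell2 x y = (\<Sum>n. coords x n \<bullet> coords y n)"

definition norm_ell2 :: "ell2 \<Rightarrow> real" where
  "norm_ell2 x = sqrt (inner x x)"

definition dist_ell2 :: "ell2 \<Rightarrow> ell2 \<Rightarrow> real" where
  "dist_ell2 x y = norm (x - y)"

definition sgn_ell2 :: "ell2 \<Rightarrow> ell2" where
  "sgn_ell2 x = inverse (norm x) *\<^sub>R x"

definition uniformity_ell2 :: "(ell2 \<times> ell2) filter" where
  "uniformity_ell2 = (INF e\<in>{0<..}. principal {(x, y). dist x y < e})"

definition open_ell2 :: "ell2 set \<Rightarrow> bool" where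
  "open_ell2 U \<longleftrightarrow> (\<forall>x\<in>U. eventually (\<lambda>(x', y). x' = x \<longrightarrow> y \<in> U) uniformity)"

lemma summable_inner_coords: "summable (\<lambda>n. coords x n \<bullet> coords y n)"
  by (rule summable_rabs_cancel[OF square_summable_inner[OF square_summable_coords square_summable_coords]])

instance
proof
  fix x y z :: ell2 and r s :: real
  show "x + y + z = x + (y + z)" "x + y = y + x" "0 + x = x" "- x + x = 0" "x - y = x + - y"
    "r *\<^sub>R (x + y) = r *\<^sub>R x + r *\<^sub>R y" "(r + s) *\<^sub>R x = r *\<^sub>R x + s *\<^sub>R x"
    "r *\<^sub>R s *\<^sub>R x = (r * s) *\<^sub>R x" "1 *\<^sub>R x = x"
    by (transfer; auto simp: algebra_simps)+
  show "dist x y = norm (x - y)" "sgn x = inverse (norm x) *\<^sub>R x" "norm x = sqrt (inner x x)"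
    by (simp_all add: dist_ell2_def sgn_ell2_def norm_ell2_def)
  show "uniformity = (INF e\<in>{0<..}. principal {(x::ell2, y). dist x y < e})"
    by (rule uniformity_ell2_def)
  show "open U = (\<forall>x\<in>U. \<forall>\<^sub>F (x', y) in uniformity. x' = x \<longrightarrow> y \<in> U)" for U :: "ell2 set"
    by (rule open_ell2_def)
  show "inner x y = inner y x" by (simp add: inner_ell2_def inner_commute)
  show "inner (x + y) z = inner x z + inner y z"
    by (simp add: inner_ell2_def plus_ell2.rep_eq inner_add_left suminf_add summable_inner_coords)
  show "inner (r *\<^sub>R x) y = r * inner x y"
    by (simp add: inner_ell2_def scaleR_ell2.rep_eq suminf_mult summable_inner_coords)
  show "0 \<le> inner x x"
    unfolding inner_ell2_def by (intro suminf_nonneg summable_inner_coords) simp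
  show "inner x x = 0 \<longleftrightarrow> x = 0"
  proof -
    have "inner x x = 0 \<longleftrightarrow> (\<forall>n. coords x n \<bullet> coords x n = 0)"
      unfolding inner_ell2_def by (rule suminf_eq_zero_iff[OF summable_inner_coords]) simp
    then show ?thesis by (simp add: coords_inject[symmetric] zero_ell2.rep_eq fun_eq_iff)
  qed
qed

end

lemma power2_norm_ell2: "(norm x)\<^sup>2 = (\<Sum>n. (cmod (coords x n))\<^sup>2)"
  by (simp add: power2_norm_eq_inner inner_ell2_def)

lemma sum_le_norm_ell2: "finite I \<Longrightarrow> (\<Sum>n\<in>I. (cmod (coords x n))\<^sup>2) \<le> (norm x)\<^sup>2"
  unfolding power2_norm_ell2
  by (rule sum_le_suminf) (use square_summable_coords in \<open>auto simp: square_summable_def\<close>)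

lemma norm_coords_le: "cmod (coords x n) \<le> norm x"
  using sum_le_norm_ell2[of "{n}" x] by (simp add: power2_le_iff_abs_le)

lemma square_summable_bounded:
  assumes "\<And>N. (\<Sum>n<N. (cmod (f n))\<^sup>2) \<le> c\<^sup>2" "c \<ge> 0"
  shows "square_summable f" "norm (Abs_ell2 f) \<le> c"
proof -
  show s: "square_summable f"
    unfolding square_summable_def by (rule summableI_nonneg_bounded[of _ "c\<^sup>2"]) (use assms in auto)
  have "(norm (Abs_ell2 f))\<^sup>2 \<le> c\<^sup>2"
    unfolding power2_norm_ell2 using s assms(1)
    by (intro suminf_le_const) (simp_all add: Abs_ell2_inverse square_summable_def)
  then show "norm (Abs_ell2 f) \<le> c" using assms(2) power2_le_imp_le by blast
qed

text \<open>The coordinatewise limit is the candidate: bounds on the finite partial sums of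
  \<open>X k - X l\<close> survive the limit in \<open>l\<close>.\<close>

instance ell2 :: complete_space
proof
  fix X :: "nat \<Rightarrow> ell2" assume X: "Cauchy X"
  have "Cauchy (\<lambda>m. coords (X m) n)" for n
  proof (rule CauchyI)
    fix e :: real assume "e > 0"
    then obtain M where M: "\<And>k l. k \<ge> M \<Longrightarrow> l \<ge> M \<Longrightarrow> norm (X k - X l) < e" using X CauchyD by blast
    have "norm (coords (X k) n - coords (X l) n) < e" if "k \<ge> M" "l \<ge> M" for k l
      using norm_coords_le[of "X k - X l" n] M[OF that] by (simp add: minus_ell2.rep_eq)
    then show "\<exists>M. \<forall>k\<ge>M. \<forall>l\<ge>M. norm (coords (X k) n - coords (X l) n) < e" by blast
  qed
  then have "\<forall>n. \<exists>l. (\<lambda>m. coords (X m) n) \<longlonglongrightarrow> l" using Cauchy_convergent_iff convergent_def by blast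
  then obtain L where L: "\<And>n. (\<lambda>m. coords (X m) n) \<longlonglongrightarrow> L n" by metis
  \<comment> \<open>Used twice: the bound 1 puts the limit into the space, the bound e/2 gives
    convergence in norm.\<close>
  have close: "square_summable (\<lambda>n. coords (X k) n - L n) \<and> norm (Abs_ell2 (\<lambda>n. coords (X k) n - L n)) \<le> e"
    if e: "e \<ge> 0" and M: "\<And>l. l \<ge> M \<Longrightarrow> norm (X k - X l) \<le> e" for e k M
  proof -
    have "(\<Sum>n<N. (cmod (coords (X k) n - L n))\<^sup>2) \<le> e\<^sup>2" for N
    proof (rule LIMSEQ_le_const2)
      show "(\<lambda>l. \<Sum>n<N. (cmod (coords (X k) n - coords (X l) n))\<^sup>2) \<longlonglongrightarrow> (\<Sum>n<N. (cmod (coords (X k) n - L n))\<^sup>2)"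
        by (intro tendsto_intros L)
      have "(\<Sum>n<N. (cmod (coords (X k) n - coords (X l) n))\<^sup>2) \<le> e\<^sup>2" if "l \<ge> M" for l
      proof -
        have "(\<Sum>n<N. (cmod (coords (X k - X l) n))\<^sup>2) \<le> (norm (X k - X l))\<^sup>2"
          by (rule sum_le_norm_ell2) simp
        also have "\<dots> \<le> e\<^sup>2" using M[OF that] by (intro power_mono) auto
        finally show ?thesis by (simp add: minus_ell2.rep_eq)
      qed
      then show "\<exists>M. \<forall>l\<ge>M. (\<Sum>n<N. (cmod (coords (X k) n - coords (X l) n))\<^sup>2) \<le> e\<^sup>2" by blast
    qed
    then show ?thesis using square_summable_bounded[of "\<lambda>n. coords (X k) n - L n" e] e by blast
  qed
  obtain M1 where M1: "\<And>k l. k \<ge> M1 \<Longrightarrow> l \<ge> M1 \<Longrightarrow> norm (X k - X l) < 1" 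
    using CauchyD[OF X, of 1] by auto
  have "square_summable (\<lambda>n. coords (X M1) n - L n)"
    using close[of 1 M1 M1] M1 by (simp add: less_imp_le)
  then have "square_summable (\<lambda>n. coords (X M1) n + - (coords (X M1) n - L n))"
    by (intro square_summable_add square_summable_uminus square_summable_coords)
  then have Ls: "square_summable L" by simp
  have eq: "Abs_ell2 (\<lambda>n. coords (X k) n - L n) = X k - Abs_ell2 L" for k
    by (rule coords_inject[THEN iffD1])
      (use square_summable_add[OF square_summable_coords square_summable_uminus[OF Ls], of "X k"]
        in \<open>simp add: Abs_ell2_inverse minus_ell2.rep_eq Ls\<close>)
  have "X \<longlonglongrightarrow> Abs_ell2 L"
  proof (rule LIMSEQ_I)
    fix e :: real assume e: "e > 0"
    then obtain M where M: "\<And>k l. k \<ge> M \<Longrightarrow> l \<ge> M \<Longrightarrow> norm (X k - X l) < e / 2"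
      using CauchyD[OF X, of "e / 2"] by auto
    have "norm (X k - Abs_ell2 L) < e" if "k \<ge> M" for k
      using close[of "e / 2" M k] M[OF that] e unfolding eq by (force simp: less_imp_le)
    then show "\<exists>M. \<forall>k\<ge>M. norm (X k - Abs_ell2 L) < e" by blast
  qed
  then show "convergent X" by (rule convergentI)
qed

instance ell2 :: banach ..

section \<open>Operators that rearrange and weight coordinates\<close>

definition injective_weight :: "(nat \<Rightarrow> complex) \<Rightarrow> (nat \<Rightarrow> nat) \<Rightarrow> bool" where
  "injective_weight c \<rho> \<longleftrightarrow> bounded (range c) \<and> inj_on \<rho> {n. c n \<noteq> 0}"

text \<open>One form for all concrete operators of the proof: scalars, multiplication by functions,
  and the shifts with their adjoints. Injectivity of \<open>\<rho>\<close> where the bounded weight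
  \<open>c\<close> does not vanish guarantees boundedness, without which the value of
  \<open>Blinfun\<close> has no meaning.\<close>

definition weighted_op :: "(nat \<Rightarrow> complex) \<Rightarrow> (nat \<Rightarrow> nat) \<Rightarrow> ell2 \<Rightarrow>\<^sub>L ell2" where
  "weighted_op c \<rho> = Blinfun (\<lambda>x. Abs_ell2 (\<lambda>n. c n * coords x (\<rho> n)))"

lemma weighted_bound:
  assumes "inj_on \<rho> {n. c n \<noteq> 0}" "\<And>n. cmod (c n) \<le> C"
  shows "square_summable (\<lambda>n. c n * coords x (\<rho> n))"
    and "norm (Abs_ell2 (\<lambda>n. c n * coords x (\<rho> n))) \<le> C * norm x"
proof -
  have C: "C \<ge> 0" using assms(2)[of 0] norm_ge_zero order_trans by blast
  have "(\<Sum>n<N. (cmod (c n * coords x (\<rho> n)))\<^sup>2) \<le> (C * norm x)\<^sup>2" for N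
  proof -
    define I where "I = {n. n < N \<and> c n \<noteq> 0}"
    have "(\<Sum>n<N. (cmod (c n * coords x (\<rho> n)))\<^sup>2) = (\<Sum>n\<in>I. (cmod (c n * coords x (\<rho> n)))\<^sup>2)"
      by (rule sum.mono_neutral_right) (auto simp: I_def)
    also have "\<dots> \<le> (\<Sum>n\<in>I. C\<^sup>2 * (cmod (coords x (\<rho> n)))\<^sup>2)"
      using assms(2) by (intro sum_mono) (auto simp: norm_mult power_mult_distrib intro!: mult_right_mono power_mono)
    also have "\<dots> = C\<^sup>2 * (\<Sum>k\<in>\<rho> ` I. (cmod (coords x k))\<^sup>2)"
      using inj_on_subset[OF assms(1), of I] by (simp add: sum_distrib_left sum.reindex I_def subset_iff)
    also have "\<dots> \<le> C\<^sup>2 * (norm x)\<^sup>2"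
      by (intro mult_left_mono sum_le_norm_ell2) (auto simp: I_def)
    finally show ?thesis by (simp add: power_mult_distrib)
  qed
  then show "square_summable (\<lambda>n. c n * coords x (\<rho> n))"
    "norm (Abs_ell2 (\<lambda>n. c n * coords x (\<rho> n))) \<le> C * norm x"
    using square_summable_bounded[of "\<lambda>n. c n * coords x (\<rho> n)" "C * norm x"] C by auto
qed

lemma injective_weightD:
  assumes "injective_weight c \<rho>"
  shows "inj_on \<rho> {n. c n \<noteq> 0}" "\<exists>C. \<forall>n. cmod (c n) \<le> C"
  using assms unfolding injective_weight_def bounded_iff by auto

lemma coords_Abs_weighted:
  assumes "injective_weight c \<rho>"
  shows "coords (Abs_ell2 (\<lambda>n. c n * coords x (\<rho> n))) = (\<lambda>n. c n * coords x (\<rho> n))"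
proof -
  obtain C where "\<forall>n. cmod (c n) \<le> C" using injective_weightD(2)[OF assms] ..
  from weighted_bound(1)[OF injective_weightD(1)[OF assms] this[rule_format]]
  show ?thesis by (simp add: Abs_ell2_inverse)
qed

lemma coords_weighted_op:
  assumes "injective_weight c \<rho>"
  shows "coords (weighted_op c \<rho> x) n = c n * coords x (\<rho> n)"
proof -
  obtain C where C: "\<forall>n. cmod (c n) \<le> C" using injective_weightD(2)[OF assms] ..
  have "bounded_linear (\<lambda>x. Abs_ell2 (\<lambda>n. c n * coords x (\<rho> n)))"
  proof (rule bounded_linear_intro)
    show "norm (Abs_ell2 (\<lambda>n. c n * coords x (\<rho> n))) \<le> norm x * C" for x
      using weighted_bound(2)[OF injective_weightD(1)[OF assms] C[rule_format]] by (simp add: mult.commute)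
    show "Abs_ell2 (\<lambda>n. c n * coords (x + y) (\<rho> n)) =
        Abs_ell2 (\<lambda>n. c n * coords x (\<rho> n)) + Abs_ell2 (\<lambda>n. c n * coords y (\<rho> n))" for x y
      unfolding coords_inject[symmetric] unfolding coords_Abs_weighted[OF assms]
      by (simp add: plus_ell2.rep_eq coords_Abs_weighted[OF assms] distrib_left)
    show "Abs_ell2 (\<lambda>n. c n * coords (r *\<^sub>R x) (\<rho> n)) = r *\<^sub>R Abs_ell2 (\<lambda>n. c n * coords x (\<rho> n))" for r x
      unfolding coords_inject[symmetric] unfolding coords_Abs_weighted[OF assms]
      by (simp add: scaleR_ell2.rep_eq coords_Abs_weighted[OF assms])
  qed
  then have "weighted_op c \<rho> x = Abs_ell2 (\<lambda>n. c n * coords x (\<rho> n))"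
    unfolding weighted_op_def by (simp add: bounded_linear_Blinfun_apply)
  then show ?thesis by (simp add: coords_Abs_weighted[OF assms])
qed

lemma ell2_eqI: "(\<And>n. coords x n = coords y n) \<Longrightarrow> x = y"
  by (simp add: coords_inject[symmetric] fun_eq_iff)

lemma norm_weighted_op_le:
  assumes "inj_on \<rho> {n. c n \<noteq> 0}" "\<And>n. cmod (c n) \<le> C"
  shows "norm (weighted_op c \<rho>) \<le> C"
proof (rule norm_blinfun_bound)
  show "C \<ge> 0" using assms(2)[of 0] norm_ge_zero order_trans by blast
  have w: "injective_weight c \<rho>" using assms by (auto simp: injective_weight_def bounded_iff)
  have "weighted_op c \<rho> x = Abs_ell2 (\<lambda>n. c n * coords x (\<rho> n))" for x
    by (rule ell2_eqI) (simp add: coords_weighted_op[OF w] coords_Abs_weighted[OF w])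
  then show "norm (weighted_op c \<rho> x) \<le> C * norm x" for x
    using weighted_bound(2)[OF assms] by simp
qed

text \<open>Taking the adjoint conjugates the weights and inverts the partial bijection between the
  supports of \<open>c\<close> and \<open>c'\<close>.\<close>

lemma weighted_op_adjoint:
  assumes w: "injective_weight c \<rho>" "injective_weight c' \<rho>'"
    and 1: "\<And>n. c n \<noteq> 0 \<Longrightarrow> \<rho>' (\<rho> n) = n \<and> c' (\<rho> n) = cnj (c n)"
    and 2: "\<And>k. c' k \<noteq> 0 \<Longrightarrow> \<rho> (\<rho>' k) = k \<and> c (\<rho>' k) = cnj (c' k)"
  shows "weighted_op c \<rho> x \<bullet> y = x \<bullet> weighted_op c' \<rho>' y"
proof -
  \<comment> \<open>Unordered sums, because the terms are about to be rearranged along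
    \<open>\<rho>\<close>.\<close>
  have inf: "u \<bullet> v = (\<Sum>\<^sub>\<infinity>n. coords u n \<bullet> coords v n)" for u v :: ell2
    unfolding inner_ell2_def
  proof -
    have "summable (\<lambda>n. norm (coords u n \<bullet> coords v n))"
      using square_summable_inner[OF square_summable_coords square_summable_coords] by simp
    from norm_summable_imp_has_sum[OF this summable_sums[OF summable_norm_cancel[OF this]]]
    show "(\<Sum>n. coords u n \<bullet> coords v n) = (\<Sum>\<^sub>\<infinity>n. coords u n \<bullet> coords v n)"
      by (simp add: infsumI)
  qed
  have "weighted_op c \<rho> x \<bullet> y = (\<Sum>\<^sub>\<infinity>n. (c n * coords x (\<rho> n)) \<bullet> coords y n)"
    by (simp add: inf coords_weighted_op[OF w(1)])
  also have "\<dots> = (\<Sum>\<^sub>\<infinity>n\<in>{n. c n \<noteq> 0}. (c n * coords x (\<rho> n)) \<bullet> coords y n)"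
    by (rule infsum_cong_neutral) auto
  also have "\<dots> = (\<Sum>\<^sub>\<infinity>k\<in>{k. c' k \<noteq> 0}. coords x k \<bullet> (c' k * coords y (\<rho>' k)))"
  proof (rule infsum_reindex_bij_witness[of _ \<rho>' \<rho>])
    fix n assume "n \<in> {n. c n \<noteq> 0}"
    then have n: "c n \<noteq> 0" by simp
    show "\<rho>' (\<rho> n) = n" "\<rho> n \<in> {k. c' k \<noteq> 0}" using 1[OF n] n by auto
    show "coords x (\<rho> n) \<bullet> (c' (\<rho> n) * coords y (\<rho>' (\<rho> n))) = (c n * coords x (\<rho> n)) \<bullet> coords y n"
      using 1[OF n] by (simp add: inner_complex_def algebra_simps)
  next
    fix k assume "k \<in> {k. c' k \<noteq> 0}"
    then have k: "c' k \<noteq> 0" by simp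
    show "\<rho> (\<rho>' k) = k" "\<rho>' k \<in> {n. c n \<noteq> 0}" using 2[OF k] k by auto
  qed
  also have "\<dots> = (\<Sum>\<^sub>\<infinity>k. coords x k \<bullet> (c' k * coords y (\<rho>' k)))"
    by (rule infsum_cong_neutral) auto
  also have "\<dots> = x \<bullet> weighted_op c' \<rho>' y" by (simp add: inf coords_weighted_op[OF w(2)])
  finally show ?thesis .
qed

section \<open>The C*-algebra of complex linear operators\<close>

definition complex_scale :: "complex \<Rightarrow> ell2 \<Rightarrow>\<^sub>L ell2" where
  "complex_scale a = weighted_op (\<lambda>_. a) id"

lemma coords_complex_scale [simp]: "coords (complex_scale a x) n = a * coords x n"
  unfolding complex_scale_def by (subst coords_weighted_op) (auto simp: injective_weight_def)

lemma complex_scale_adjoint: "complex_scale a x \<bullet> y = x \<bullet> complex_scale (cnj a) y"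
  unfolding complex_scale_def by (rule weighted_op_adjoint) (auto simp: injective_weight_def)

lemma complex_scale_1: "complex_scale 1 x = x"
  by (rule ell2_eqI) simp

lemma complex_scale_minus_1: "complex_scale (- 1) x = - x"
  by (rule ell2_eqI) (simp add: uminus_ell2.rep_eq)

lemma complex_scale_add: "complex_scale (a + b) x = complex_scale a x + complex_scale b x"
  by (rule ell2_eqI) (simp add: plus_ell2.rep_eq algebra_simps)

lemma complex_scale_mult: "complex_scale a (complex_scale b x) = complex_scale (a * b) x"
  by (rule ell2_eqI) (simp add: algebra_simps)

lemma norm_complex_scale: "norm (complex_scale a x) = cmod a * norm x"
proof -
  have "summable (\<lambda>n. (cmod (coords x n))\<^sup>2)"
    using square_summable_coords by (simp add: square_summable_def)
  then have "(norm (complex_scale a x))\<^sup>2 = (cmod a * norm x)\<^sup>2"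
    by (simp add: power2_norm_ell2 norm_mult power_mult_distrib suminf_mult)
  then show ?thesis by (simp add: power2_eq_iff_nonneg)
qed

text \<open>Adjoints are handled as a relation: membership in \<open>ell2_operators\<close> includes
  the existence of an adjoint, so that no representation theorem for functionals enters.\<close>

definition adjoint_pair :: "(ell2 \<Rightarrow>\<^sub>L ell2) \<Rightarrow> (ell2 \<Rightarrow>\<^sub>L ell2) \<Rightarrow> bool" where
  "adjoint_pair T T' \<longleftrightarrow> (\<forall>x y. blinfun_apply T x \<bullet> y = x \<bullet> blinfun_apply T' y)"

definition adjoint_op :: "(ell2 \<Rightarrow>\<^sub>L ell2) \<Rightarrow> ell2 \<Rightarrow>\<^sub>L ell2" where
  "adjoint_op T = (SOME T'. adjoint_pair T T')"

text \<open>The inner product of \<^typ>\<open>ell2\<close> is real, so complex linearity is a separate condition; for complex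
  linear operators the real and the complex adjoint coincide.\<close>

definition ell2_operators :: "(ell2 \<Rightarrow>\<^sub>L ell2) set" where
  "ell2_operators = {T. (\<forall>a x. blinfun_apply T (complex_scale a x) = complex_scale a (blinfun_apply T x)) \<and>
     (\<exists>T'. adjoint_pair T T')}"

definition ell2_algebra :: "(ell2 \<Rightarrow>\<^sub>L ell2) star_algebra" where
  "ell2_algebra = \<lparr>carr = ell2_operators, zer = 0, add = (+), scl = (\<lambda>a T. complex_scale a o\<^sub>L T),
     mul = (o\<^sub>L), adj = adjoint_op, nrm = norm\<rparr>"

lemma ell2_algebra_simps [simp]:
  "carr ell2_algebra = ell2_operators" "zer ell2_algebra = 0" "add ell2_algebra = (+)"
  "scl ell2_algebra a T = complex_scale a o\<^sub>L T" "mul ell2_algebra = (o\<^sub>L)" "adj ell2_algebra = adjoint_op"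
  "nrm ell2_algebra = norm"
  by (simp_all add: ell2_algebra_def)

lemma adjoint_pair_unique:
  assumes "adjoint_pair T T'" "adjoint_pair T T''" shows "T' = T''"
proof (rule blinfun_eqI)
  fix y
  have "(T' y - T'' y) \<bullet> (T' y - T'' y) = 0"
    using assms unfolding adjoint_pair_def by (simp add: inner_diff_right)
  then show "T' y = T'' y" by simp
qed

lemma adjoint_op_eqI: "adjoint_pair T T' \<Longrightarrow> adjoint_op T = T'"
  unfolding adjoint_op_def using adjoint_pair_unique by (intro some_equality) blast+

lemma adjoint_pair_sym: "adjoint_pair T T' \<Longrightarrow> adjoint_pair T' T"
  unfolding adjoint_pair_def by (metis inner_commute)

lemma adjoint_pair_0: "adjoint_pair 0 0"
  by (simp add: adjoint_pair_def)

lemma adjoint_pair_add: "adjoint_pair S S' \<Longrightarrow> adjoint_pair T T' \<Longrightarrow> adjoint_pair (S + T) (S' + T')"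
  by (simp add: adjoint_pair_def blinfun.add_left inner_add)

lemma adjoint_pair_compose: "adjoint_pair S S' \<Longrightarrow> adjoint_pair T T' \<Longrightarrow> adjoint_pair (S o\<^sub>L T) (T' o\<^sub>L S')"
  by (simp add: adjoint_pair_def)

lemma adjoint_pair_complex_scale: "adjoint_pair (complex_scale a) (complex_scale (cnj a))"
  by (simp add: adjoint_pair_def complex_scale_adjoint)

lemma adjoint_pair_norm_le:
  assumes "adjoint_pair T T'" shows "norm T' \<le> norm T"
proof (rule norm_blinfun_bound)
  fix y
  have "(norm (T' y))\<^sup>2 = T (T' y) \<bullet> y"
    using assms unfolding adjoint_pair_def by (simp add: power2_norm_eq_inner)
  also have "\<dots> \<le> norm (T (T' y)) * norm y" by (rule norm_cauchy_schwarz)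
  also have "\<dots> \<le> norm T * norm (T' y) * norm y" by (intro mult_right_mono norm_blinfun) simp
  finally have "norm (T' y) * norm (T' y) \<le> (norm T * norm y) * norm (T' y)"
    by (simp add: power2_eq_square mult.assoc mult.commute mult.left_commute)
  then show "norm (T' y) \<le> norm T * norm y"
    by (cases "norm (T' y) = 0") (auto simp: mult_nonneg_nonneg)
qed simp

lemma adjoint_pair_norm: "adjoint_pair T T' \<Longrightarrow> norm T' = norm T"
  using adjoint_pair_norm_le adjoint_pair_sym by (metis order_antisym)

lemma adjoint_pair_cstar:
  assumes "adjoint_pair T T'" shows "norm (T' o\<^sub>L T) = (norm T)\<^sup>2"
proof (rule order_antisym)
  show "norm (T' o\<^sub>L T) \<le> (norm T)\<^sup>2"
    using norm_blinfun_compose[of T' T] adjoint_pair_norm[OF assms] by (simp add: power2_eq_square)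
  have "norm T \<le> sqrt (norm (T' o\<^sub>L T))"
  proof (rule norm_blinfun_bound)
    fix x
    have "(norm (T x))\<^sup>2 = x \<bullet> T' (T x)"
      using assms unfolding adjoint_pair_def by (simp add: power2_norm_eq_inner)
    also have "\<dots> \<le> norm x * norm ((T' o\<^sub>L T) x)" using norm_cauchy_schwarz by simp
    also have "\<dots> \<le> norm x * (norm (T' o\<^sub>L T) * norm x)" by (intro mult_left_mono norm_blinfun) simp
    also have "\<dots> = (sqrt (norm (T' o\<^sub>L T)) * norm x)\<^sup>2"
      by (simp add: power_mult_distrib power2_eq_square)
    finally show "norm (T x) \<le> sqrt (norm (T' o\<^sub>L T)) * norm x" by (rule power2_le_imp_le) simp
  qed simp
  then show "(norm T)\<^sup>2 \<le> norm (T' o\<^sub>L T)"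
    by (metis norm_ge_zero power_mono real_sqrt_pow2)
qed

lemma ell2_operatorsD:
  assumes "T \<in> ell2_operators"
  shows "T (complex_scale a x) = complex_scale a (T x)" "adjoint_pair T (adjoint_op T)"
  using assms unfolding ell2_operators_def by (auto simp: adjoint_op_eqI)

lemma ell2_operatorsI:
  fixes T :: "ell2 \<Rightarrow>\<^sub>L ell2"
  assumes "\<And>a x. T (complex_scale a x) = complex_scale a (T x)" "adjoint_pair T T'"
  shows "T \<in> ell2_operators"
  using assms unfolding ell2_operators_def by blast

text \<open>The adjoint comes from the real inner product, so its complex linearity has to be
  checked: pairing with any \<open>u\<close> moves a scalar to the other side as its conjugate,
  where \<open>T\<close> commutes with it.\<close>

lemma adjoint_op_in:
  assumes T: "T \<in> ell2_operators" shows "adjoint_op T \<in> ell2_operators"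
proof (rule ell2_operatorsI[OF _ adjoint_pair_sym[OF ell2_operatorsD(2)[OF T]]])
  fix a y
  have adj: "u \<bullet> adjoint_op T v = T u \<bullet> v" for u v
    using ell2_operatorsD(2)[OF T] by (simp add: adjoint_pair_def)
  define z where "z = adjoint_op T (complex_scale a y) - complex_scale a (adjoint_op T y)"
  have "u \<bullet> z = 0" for u
  proof -
    have "u \<bullet> complex_scale a (adjoint_op T y) = complex_scale (cnj a) u \<bullet> adjoint_op T y"
      using complex_scale_adjoint[of "cnj a"] by simp
    also have "\<dots> = complex_scale (cnj a) (T u) \<bullet> y" by (simp add: adj ell2_operatorsD(1)[OF T])
    also have "\<dots> = u \<bullet> adjoint_op T (complex_scale a y)"
      using complex_scale_adjoint[of "cnj a"] by (simp add: adj)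
    finally show ?thesis by (simp add: z_def inner_diff_right)
  qed
  then have "z = 0" by (metis inner_eq_zero_iff)
  then show "adjoint_op T (complex_scale a y) = complex_scale a (adjoint_op T y)" by (simp add: z_def)
qed

lemma complex_scale_minus_compose: "complex_scale (- 1) o\<^sub>L T = - T"
  by (rule blinfun_eqI) (simp add: complex_scale_minus_1 blinfun.minus_left)

lemma dst_ell2_algebra: "dst ell2_algebra S T = norm (S - T)"
  by (simp add: dst_def complex_scale_minus_compose)

lemma norm_scale_compose: "norm (complex_scale a o\<^sub>L T) = cmod a * norm T"
proof (rule order_antisym)
  have le: "norm (complex_scale a o\<^sub>L T) \<le> cmod a * norm T" for a T
  proof (rule norm_blinfun_bound)
    show "norm ((complex_scale a o\<^sub>L T) x) \<le> cmod a * norm T * norm x" for x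
      using mult_left_mono[OF norm_blinfun[of T x], of "cmod a"] by (simp add: norm_complex_scale mult.assoc)
  qed simp
  show "norm (complex_scale a o\<^sub>L T) \<le> cmod a * norm T" by (rule le)
  \<comment> \<open>The reverse inequality is the same bound for the inverse scalar.\<close>
  show "cmod a * norm T \<le> norm (complex_scale a o\<^sub>L T)"
  proof (cases "a = 0")
    case False
    have "complex_scale (inverse a) o\<^sub>L (complex_scale a o\<^sub>L T) = T"
      using False by (intro blinfun_eqI) (simp add: complex_scale_mult complex_scale_1)
    then have "norm T \<le> cmod (inverse a) * norm (complex_scale a o\<^sub>L T)" using le by metis
    then have "cmod a * norm T \<le> cmod a * (cmod (inverse a) * norm (complex_scale a o\<^sub>L T))"
      by (intro mult_left_mono) auto
    also have "\<dots> = norm (complex_scale a o\<^sub>L T)" using False by (simp add: norm_inverse)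
    finally show ?thesis .
  qed simp
qed

lemma ell2_operators_scale: "T \<in> ell2_operators \<Longrightarrow> complex_scale a o\<^sub>L T \<in> ell2_operators"
  by (rule ell2_operatorsI[OF _ adjoint_pair_compose[OF adjoint_pair_complex_scale ell2_operatorsD(2)]])
    (simp_all add: ell2_operatorsD complex_scale_mult mult.commute)

lemma ell2_operators_add: "S \<in> ell2_operators \<Longrightarrow> T \<in> ell2_operators \<Longrightarrow> S + T \<in> ell2_operators"
  by (rule ell2_operatorsI[OF _ adjoint_pair_add[OF ell2_operatorsD(2) ell2_operatorsD(2)]])
    (simp_all add: ell2_operatorsD blinfun.add_left blinfun.add_right)

lemma ell2_operators_compose: "S \<in> ell2_operators \<Longrightarrow> T \<in> ell2_operators \<Longrightarrow> S o\<^sub>L T \<in> ell2_operators"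
  by (rule ell2_operatorsI[OF _ adjoint_pair_compose[OF ell2_operatorsD(2) ell2_operatorsD(2)]])
    (simp_all add: ell2_operatorsD)

lemma adjoint_op_diff_norm:
  assumes "S \<in> ell2_operators" "T \<in> ell2_operators"
  shows "norm (adjoint_op S - adjoint_op T) = norm (S - T)"
proof (rule adjoint_pair_norm)
  show "adjoint_pair (S - T) (adjoint_op S - adjoint_op T)"
    using ell2_operatorsD(2)[OF assms(1)] ell2_operatorsD(2)[OF assms(2)]
    by (simp add: adjoint_pair_def blinfun.diff_left inner_diff)
qed

text \<open>Taking adjoints is isometric, so the adjoints of a Cauchy sequence converge as well, and
  their limit is an adjoint of the limit.\<close>

lemma ell2_operators_complete:
  assumes "\<And>n. \<sigma> n \<in> ell2_operators" "Cauchy \<sigma>"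
  obtains T where "T \<in> ell2_operators" "\<sigma> \<longlonglongrightarrow> T"
proof -
  obtain T where T: "\<sigma> \<longlonglongrightarrow> T"
    using Cauchy_convergent[OF assms(2)] unfolding convergent_def ..

  have "Cauchy (\<lambda>n. adjoint_op (\<sigma> n))"
    using assms unfolding Cauchy_def dist_norm by (simp add: adjoint_op_diff_norm)
  from Cauchy_convergent[OF this] obtain T' where T': "(\<lambda>n. adjoint_op (\<sigma> n)) \<longlonglongrightarrow> T'"
    unfolding convergent_def ..
  have lim: "(\<lambda>n. \<sigma> n x) \<longlonglongrightarrow> T x" "(\<lambda>n. adjoint_op (\<sigma> n) x) \<longlonglongrightarrow> T' x" for x
    by (intro tendsto_intros T T')+
  have "T (complex_scale a x) = complex_scale a (T x)" for a x
  proof (rule LIMSEQ_unique)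
    show "(\<lambda>n. \<sigma> n (complex_scale a x)) \<longlonglongrightarrow> T (complex_scale a x)" by (rule lim)
    show "(\<lambda>n. \<sigma> n (complex_scale a x)) \<longlonglongrightarrow> complex_scale a (T x)"
      unfolding ell2_operatorsD(1)[OF assms(1)] by (intro tendsto_intros lim)
  qed
  moreover have "T x \<bullet> y = x \<bullet> T' y" for x y
  proof (rule LIMSEQ_unique)
    show "(\<lambda>n. \<sigma> n x \<bullet> y) \<longlonglongrightarrow> T x \<bullet> y" by (intro tendsto_intros lim)
    have "\<sigma> n x \<bullet> y = x \<bullet> adjoint_op (\<sigma> n) y" for n
      using ell2_operatorsD(2)[OF assms(1)] by (simp add: adjoint_pair_def)
    then show "(\<lambda>n. \<sigma> n x \<bullet> y) \<longlonglongrightarrow> x \<bullet> T' y" by (simp add: lim tendsto_inner)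
  qed
  ultimately have "T \<in> ell2_operators" by (intro ell2_operatorsI) (auto simp: adjoint_pair_def)
  then show ?thesis using that T by blast
qed

lemma cstar_algebra_ell2: "cstar_algebra ell2_algebra"
proof
  fix \<sigma> :: "nat \<Rightarrow> ell2 \<Rightarrow>\<^sub>L ell2"
  assume s: "range \<sigma> \<subseteq> carr ell2_algebra"
    and c: "\<And>e. e > 0 \<Longrightarrow> \<exists>N. \<forall>m\<ge>N. \<forall>n\<ge>N. dst ell2_algebra (\<sigma> m) (\<sigma> n) < e"
  have "Cauchy \<sigma>" unfolding Cauchy_def using c by (simp add: dst_ell2_algebra dist_norm)
  then obtain T where T: "T \<in> ell2_operators" "\<sigma> \<longlonglongrightarrow> T" using ell2_operators_complete s by (metis ell2_algebra_simps(1) range_subsetD)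
  have "(\<lambda>n. dst ell2_algebra (\<sigma> n) T) \<longlonglongrightarrow> 0"
    unfolding dst_ell2_algebra using T(2) by (simp add: LIM_zero tendsto_norm_zero)
  then show "\<exists>l\<in>carr ell2_algebra. (\<lambda>n. dst ell2_algebra (\<sigma> n) l) \<longlonglongrightarrow> 0" using T(1) by auto
next
  fix S T :: "ell2 \<Rightarrow>\<^sub>L ell2" and a :: complex
  assume S: "S \<in> carr ell2_algebra" 
  have pS: "adjoint_pair S (adjoint_op S)" using S by (simp add: ell2_operatorsD)
  show "adj ell2_algebra (adj ell2_algebra S) = S" using adjoint_pair_sym[OF pS] by (simp add: adjoint_op_eqI)
  show "nrm ell2_algebra (mul ell2_algebra (adj ell2_algebra S) S) = (nrm ell2_algebra S)\<^sup>2"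
    using adjoint_pair_cstar[OF pS] by simp
  have "adjoint_pair (complex_scale a o\<^sub>L S) (adjoint_op S o\<^sub>L complex_scale (cnj a))"
    by (rule adjoint_pair_compose[OF adjoint_pair_complex_scale pS])
  moreover have "adjoint_op S o\<^sub>L complex_scale (cnj a) = complex_scale (cnj a) o\<^sub>L adjoint_op S"
    using adjoint_op_in S by (intro blinfun_eqI) (simp add: ell2_operatorsD)
  ultimately show "adj ell2_algebra (scl ell2_algebra a S) = scl ell2_algebra (cnj a) (adj ell2_algebra S)"
    by (simp add: adjoint_op_eqI)
  assume T: "T \<in> carr ell2_algebra"
  have pT: "adjoint_pair T (adjoint_op T)" using T by (simp add: ell2_operatorsD)
  show "adj ell2_algebra (add ell2_algebra S T) = add ell2_algebra (adj ell2_algebra S) (adj ell2_algebra T)"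
    using adjoint_pair_add[OF pS pT] by (simp add: adjoint_op_eqI)
  show "adj ell2_algebra (mul ell2_algebra S T) = mul ell2_algebra (adj ell2_algebra T) (adj ell2_algebra S)"
    using adjoint_pair_compose[OF pS pT] by (simp add: adjoint_op_eqI)
  show "mul ell2_algebra S (scl ell2_algebra a T) = scl ell2_algebra a (mul ell2_algebra S T)"
    using S by (intro blinfun_eqI) (simp add: ell2_operatorsD)
qed (auto simp: ell2_operators_add ell2_operators_scale ell2_operators_compose adjoint_op_in
    complex_scale_minus_compose complex_scale_add complex_scale_1 complex_scale_mult norm_scale_compose
    norm_blinfun_compose norm_triangle_ineq blinfun.add_left blinfun.add_right blinfun.minus_left
    intro!: blinfun_eqI ell2_operatorsI[OF _ adjoint_pair_0])

text \<open>The universal property is tested only on algebras carried by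
  \<open>test_carrier\<close>, so the operators have to be copied into that type. The operations
  matter on the image of \<open>\<iota>\<close> only; elsewhere \<open>inv \<iota>\<close> is
  arbitrary.\<close>

definition transport_algebra :: "('c \<Rightarrow> 'd) \<Rightarrow> 'c star_algebra \<Rightarrow> 'd star_algebra" where
  "transport_algebra \<iota> M = \<lparr>carr = \<iota> ` carr M, zer = \<iota> (zer M),
     add = (\<lambda>x y. \<iota> (add M (inv \<iota> x) (inv \<iota> y))), scl = (\<lambda>a x. \<iota> (scl M a (inv \<iota> x))),
     mul = (\<lambda>x y. \<iota> (mul M (inv \<iota> x) (inv \<iota> y))), adj = (\<lambda>x. \<iota> (adj M (inv \<iota> x))),
     nrm = (\<lambda>x. nrm M (inv \<iota> x))\<rparr>"

lemma transport_algebra_simps: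
  assumes "inj \<iota>"
  shows "carr (transport_algebra \<iota> M) = \<iota> ` carr M" "zer (transport_algebra \<iota> M) = \<iota> (zer M)"
    "add (transport_algebra \<iota> M) (\<iota> x) (\<iota> y) = \<iota> (add M x y)"
    "scl (transport_algebra \<iota> M) a (\<iota> x) = \<iota> (scl M a x)"
    "mul (transport_algebra \<iota> M) (\<iota> x) (\<iota> y) = \<iota> (mul M x y)"
    "adj (transport_algebra \<iota> M) (\<iota> x) = \<iota> (adj M x)"
    "nrm (transport_algebra \<iota> M) (\<iota> x) = nrm M x"
    "dst (transport_algebra \<iota> M) (\<iota> x) (\<iota> y) = dst M x y"
  using assms by (simp_all add: transport_algebra_def dst_def)

lemma cstar_algebra_transport:
  assumes "cstar_algebra M" and i: "inj \<iota>"
  shows "cstar_algebra (transport_algebra \<iota> M)"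
proof -
  interpret cstar_algebra M by fact
  note t = transport_algebra_simps[OF i, of M]
  show ?thesis
  proof
    fix \<sigma> :: "nat \<Rightarrow> 'b"
    assume s: "range \<sigma> \<subseteq> carr (transport_algebra \<iota> M)"
      and c: "\<And>e. e > 0 \<Longrightarrow> \<exists>N. \<forall>m\<ge>N. \<forall>n\<ge>N. dst (transport_algebra \<iota> M) (\<sigma> m) (\<sigma> n) < e"
    have "\<forall>n. \<exists>y\<in>carr M. \<sigma> n = \<iota> y" using s by (auto simp: t image_subset_iff image_iff)
    then obtain \<tau> where \<tau>: "\<And>n. \<tau> n \<in> carr M" "\<And>n. \<sigma> n = \<iota> (\<tau> n)" by metis
    obtain l where l: "l \<in> carr M" "(\<lambda>n. dst M (\<tau> n) l) \<longlonglongrightarrow> 0"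
      using complete[of \<tau>] c \<tau>(1) unfolding \<tau>(2) t by blast
    show "\<exists>l\<in>carr (transport_algebra \<iota> M). (\<lambda>n. dst (transport_algebra \<iota> M) (\<sigma> n) l) \<longlonglongrightarrow> 0"
      using l by (intro bexI[of _ "\<iota> l"]) (simp_all add: t \<tau>(2))
  qed (auto simp: t zer_closed add_closed scl_closed mul_closed adj_closed add_assoc add_zer add_neg
      scl_add add_scl scl_scl scl_one mul_assoc mul_add add_mul scl_mul mul_scl adj_adj adj_add adj_scl
      adj_mul nrm_nonneg nrm_eq_0 nrm_add nrm_scl nrm_mul cstar_identity inj_eq[OF i] intro: add_commute)
qed

lemma matsumoto_family_transport:
  assumes "matsumoto_family A X M T" and i: "inj \<iota>"
  shows "matsumoto_family A X (transport_algebra \<iota> M) (\<iota> \<circ> T)"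
proof -
  note t = transport_algebra_simps[OF i, of M]
  obtain \<phi> where \<phi>: "star_hom (cyl_algebra A X) (cstar_generated M (T ` lists A)) \<phi>"
    "\<And>u v. u \<in> lists A \<Longrightarrow> v \<in> lists A \<Longrightarrow> \<phi> (indicator (cyl X u v)) =
             mul M (mul M (mul M (T v) (adj M (T u))) (T u)) (adj M (T v))"
    and T: "\<And>u. u \<in> lists A \<Longrightarrow> partial_isometry M (T u)"
      "\<And>u v. u \<in> lists A \<Longrightarrow> v \<in> lists A \<Longrightarrow> mul M (T u) (T v) = T (u @ v)"
    using assms(1) unfolding matsumoto_family_def by blast
  have gen: "\<iota> x \<in> carr (cstar_generated (transport_algebra \<iota> M) ((\<iota> \<circ> T) ` lists A))"
    if x: "x \<in> carr (cstar_generated M (T ` lists A))" for x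
  proof -
    have "\<iota> x \<in> H" if H: "cstar_subalgebra (transport_algebra \<iota> M) H" "(\<iota> \<circ> T) ` lists A \<subseteq> H" for H
    proof -
      \<comment> \<open>Membership in the generated algebra is tested on every subalgebra
        \<open>H\<close> of the copy that contains the generators; the preimage of \<open>H\<close>
        is such a subalgebra of \<open>M\<close>.\<close>
      define H' where "H' = \<iota> -` H"
      note H1 = H(1)[unfolded cstar_subalgebra_def t(1,2)]
      have "norm_closed M H'"
        unfolding norm_closed_def
      proof (intro allI impI)
        fix \<sigma> l assume "range \<sigma> \<subseteq> H'" "l \<in> carr M" "(\<lambda>n. dst M (\<sigma> n) l) \<longlonglongrightarrow> 0"
        then show "l \<in> H'"
          using H(1) unfolding cstar_subalgebra_def norm_closed_def H'_def
          by (auto simp: t dest!: spec[of _ "\<iota> \<circ> \<sigma>"] spec[of _ "\<iota> l"])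
      qed
      moreover have "H' \<subseteq> carr M"
      proof
        fix x assume "x \<in> H'"
        then have "\<iota> x \<in> \<iota> ` carr M" using H1 by (auto simp: H'_def)
        then show "x \<in> carr M" by (simp add: inj_image_mem_iff[OF i])
      qed
      moreover have "\<iota> (add M x y) \<in> H" "\<iota> (mul M x y) \<in> H" if "\<iota> x \<in> H" "\<iota> y \<in> H" for x y
        unfolding t(3,5)[symmetric] using H1 that by blast+
      moreover have "\<iota> (adj M x) \<in> H" "\<iota> (scl M a x) \<in> H" if "\<iota> x \<in> H" for x a
        unfolding t(4,6)[symmetric] using H1 that by blast+
      moreover have "\<iota> (zer M) \<in> H" using H1 by blast
      ultimately have "cstar_subalgebra M H'"
        unfolding cstar_subalgebra_def by (simp add: H'_def)
      moreover have "T ` lists A \<subseteq> H'" using H(2) by (auto simp: H'_def)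
      ultimately have "x \<in> H'" using x by (auto simp: cstar_generated_def)
      then show ?thesis by (simp add: H'_def)
    qed
    then show ?thesis by (auto simp: cstar_generated_def)
  qed
  have ext: "add (cstar_generated N G) = add N" "mul (cstar_generated N G) = mul N"
    "adj (cstar_generated N G) = adj N" "scl (cstar_generated N G) = scl N" for N :: "'x star_algebra" and G
    by (simp_all add: cstar_generated_def)
  have "star_hom (cyl_algebra A X) (cstar_generated (transport_algebra \<iota> M) ((\<iota> \<circ> T) ` lists A)) (\<iota> \<circ> \<phi>)"
    using \<phi>(1) gen unfolding star_hom_def by (auto simp: t ext image_subset_iff)
  then show ?thesis
    unfolding matsumoto_family_def
  proof (intro conjI ballI exI[of _ "\<iota> \<circ> \<phi>"])
    show "partial_isometry (transport_algebra \<iota> M) ((\<iota> \<circ> T) u)" if "u \<in> lists A" for u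
      using T(1)[OF that] by (simp add: partial_isometry_def t)
  qed (use T(2) \<phi>(2) in \<open>simp_all add: t del: in_lists_conv_set\<close>)
qed

text \<open>\<open>Abs_ell2\<close> is unspecified on sequences that are not square summable, but
  the square summable ones already determine the operator.\<close>

definition embed_operator :: "(ell2 \<Rightarrow>\<^sub>L ell2) \<Rightarrow> test_carrier" where
  "embed_operator T = (\<lambda>f. coords (T (Abs_ell2 f)))"

lemma inj_embed_operator: "inj embed_operator"
proof (rule injI, rule blinfun_eqI)
  fix S T x assume "embed_operator S = embed_operator T"
  then have "embed_operator S (coords x) = embed_operator T (coords x)" by simp
  then show "S x = T x" by (simp add: embed_operator_def coords_inverse coords_inject)
qed

section \<open>Representations on tail classes of rays\<close>

lemma conc_inject [simp]: "u \<frown> x = u \<frown> y \<longleftrightarrow> x = y"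
proof
  assume eq: "u \<frown> x = u \<frown> y"
  show "x = y"
  proof
    fix n show "x n = y n" using fun_cong[OF eq, of "length u + n"] by simp
  qed
qed simp

lemma bounded_functions_simps [simp]:
  "carr (bounded_functions Z) = {f. bounded (f ` Z) \<and> (\<forall>z. z \<notin> Z \<longrightarrow> f z = 0)}"
  "zer (bounded_functions Z) = (\<lambda>_. 0)"
  "add (bounded_functions Z) f g = (\<lambda>z. f z + g z)"
  "scl (bounded_functions Z) a f = (\<lambda>z. a * f z)"
  "mul (bounded_functions Z) f g = (\<lambda>z. f z * g z)"
  "adj (bounded_functions Z) f = (\<lambda>z. cnj (f z))"
  by (simp_all add: bounded_functions_def)

lemma nrm_bounded_functions_ge:
  assumes "f \<in> carr (bounded_functions Z)"
  shows "cmod (f z) \<le> nrm (bounded_functions Z) f" "0 \<le> nrm (bounded_functions Z) f"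
proof -
  obtain C where "\<And>z. z \<in> Z \<Longrightarrow> cmod (f z) \<le> C" using assms by (auto simp: bounded_iff)
  then have bdd: "bdd_above (insert 0 ((\<lambda>z. cmod (f z)) ` Z))"
    by (intro bdd_aboveI[of _ "max 0 C"]) (auto intro: max.coboundedI2)
  show "0 \<le> nrm (bounded_functions Z) f"
    using cSup_upper[OF _ bdd, of 0] by (simp add: bounded_functions_def)
  show "cmod (f z) \<le> nrm (bounded_functions Z) f"
  proof (cases "z \<in> Z")
    case True then show ?thesis using cSup_upper[OF _ bdd, of "cmod (f z)"] by (simp add: bounded_functions_def)
  next
    case False then show ?thesis using assms \<open>0 \<le> nrm (bounded_functions Z) f\<close> by simp
  qed
qed

lemma bounded_functions_closed:
  assumes "f \<in> carr (bounded_functions Z)" "g \<in> carr (bounded_functions Z)"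
  shows "(\<lambda>z. f z + g z) \<in> carr (bounded_functions Z)" "(\<lambda>z. a * f z) \<in> carr (bounded_functions Z)"
    "(\<lambda>z. f z * g z) \<in> carr (bounded_functions Z)" "(\<lambda>z. cnj (f z)) \<in> carr (bounded_functions Z)"
proof -
  obtain C where C: "\<And>z. z \<in> Z \<Longrightarrow> cmod (f z) \<le> C" using assms(1) by (auto simp: bounded_iff)
  obtain D where D: "\<And>z. z \<in> Z \<Longrightarrow> cmod (g z) \<le> D" using assms(2) by (auto simp: bounded_iff)
  have "cmod (f z + g z) \<le> C + D" "cmod (a * f z) \<le> cmod a * C" "cmod (f z * g z) \<le> C * D"
    "cmod (cnj (f z)) \<le> C" if "z \<in> Z" for z
    using C[OF that] D[OF that] order_trans[OF norm_ge_zero C[OF that]]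
    by (auto simp: norm_mult intro: norm_triangle_le mult_mono mult_left_mono)
  then show "(\<lambda>z. f z + g z) \<in> carr (bounded_functions Z)" "(\<lambda>z. a * f z) \<in> carr (bounded_functions Z)"
    "(\<lambda>z. f z * g z) \<in> carr (bounded_functions Z)" "(\<lambda>z. cnj (f z)) \<in> carr (bounded_functions Z)"
    using assms by (auto simp: bounded_iff)
qed

text \<open>By \<open>prepend_in\<close> and \<open>tail_in\<close>, adding and deleting admissible
  prefixes acts within \<open>R\<close>; countability allows the basis vectors to be indexed by
  natural numbers.\<close>

locale ray_representation = closed_shift A X
  for A :: "'a set" and X :: "(int \<Rightarrow> 'a) set" +
  fixes R :: "(nat \<Rightarrow> 'a) set"
  assumes rays: "R \<subseteq> right_rays X"
    and countable_rays: "countable R"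
    and prepend_in: "x \<in> R \<Longrightarrow> u \<frown> x \<in> right_rays X \<Longrightarrow> u \<frown> x \<in> R"
    and tail_in: "u \<frown> x \<in> R \<Longrightarrow> x \<in> R"
begin

abbreviation enc :: "(nat \<Rightarrow> 'a) \<Rightarrow> nat" where
  "enc \<equiv> to_nat_on R"

abbreviation dec :: "nat \<Rightarrow> nat \<Rightarrow> 'a" where
  "dec \<equiv> inv_into R enc"

lemma inj_enc: "inj_on enc R"
  by (rule inj_on_to_nat_on[OF countable_rays])

lemma dec_enc [simp]: "x \<in> R \<Longrightarrow> dec (enc x) = x"
  by (rule inv_into_f_f[OF inj_enc])

lemma enc_eq [simp]: "x \<in> R \<Longrightarrow> y \<in> R \<Longrightarrow> enc x = enc y \<longleftrightarrow> x = y"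
  using inj_enc by (auto simp: inj_on_def)

text \<open>Coordinates that do not encode a ray of \<open>R\<close> are sent to 0. The
  representation thus lives on a subspace, and even the operator of the empty word is only the
  projection onto it.\<close>

definition mult_op :: "((nat \<Rightarrow> 'a) \<Rightarrow> complex) \<Rightarrow> ell2 \<Rightarrow>\<^sub>L ell2" where
  "mult_op f = weighted_op (\<lambda>n. if n \<in> enc ` R then f (dec n) else 0) id"

text \<open>The basis vector of y goes to that of u y if u y is in \<open>R\<close>, and to 0
  otherwise; in terms of coordinates, the one at u y is read off at y.\<close>

definition shift_op :: "'a list \<Rightarrow> ell2 \<Rightarrow>\<^sub>L ell2" where
  "shift_op u = weighted_op (\<lambda>n. if \<exists>y. u \<frown> y \<in> R \<and> n = enc (u \<frown> y) then 1 else 0)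
     (\<lambda>n. enc (suffix (length u) (dec n)))"

definition backshift_op :: "'a list \<Rightarrow> ell2 \<Rightarrow>\<^sub>L ell2" where
  "backshift_op u = weighted_op (\<lambda>n. if \<exists>y. u \<frown> y \<in> R \<and> n = enc y then 1 else 0)
     (\<lambda>n. enc (u \<frown> dec n))"

lemma mult_weight: 
  assumes "\<And>z. cmod (f z) \<le> C"
  shows "injective_weight (\<lambda>n. if n \<in> enc ` R then f (dec n) else 0) id"
  using order_trans[OF norm_ge_zero assms] assms by (auto simp: injective_weight_def bounded_iff intro!: exI[of _ C])

lemma shift_weight:
  "injective_weight (\<lambda>n. if \<exists>y. u \<frown> y \<in> R \<and> n = enc (u \<frown> y) then 1 else 0) (\<lambda>n. enc (suffix (length u) (dec n)))"
  unfolding injective_weight_def bounded_iff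
  by (auto intro!: exI[of _ 1] inj_onI) (metis enc_eq tail_in)

lemma backshift_weight:
  "injective_weight (\<lambda>n. if \<exists>y. u \<frown> y \<in> R \<and> n = enc y then 1 else 0) (\<lambda>n. enc (u \<frown> dec n))"
  unfolding injective_weight_def bounded_iff
  by (auto intro!: exI[of _ 1] inj_onI) (metis enc_eq tail_in dec_enc conc_inject)

lemma adjoint_shift: "adjoint_pair (shift_op u) (backshift_op u)"
  unfolding adjoint_pair_def shift_op_def backshift_op_def
proof (intro allI weighted_op_adjoint shift_weight backshift_weight)
  fix n assume "(if \<exists>y. u \<frown> y \<in> R \<and> n = enc (u \<frown> y) then 1 else 0) \<noteq> (0::complex)"
  then obtain y where y: "u \<frown> y \<in> R" "n = enc (u \<frown> y)" by (auto split: if_splits)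
  then have "y \<in> R" using tail_in by blast
  then show "enc (u \<frown> dec (enc (suffix (length u) (dec n)))) = n \<and>
    (if \<exists>y. u \<frown> y \<in> R \<and> enc (suffix (length u) (dec n)) = enc y then 1 else 0) =
      cnj (if \<exists>y. u \<frown> y \<in> R \<and> n = enc (u \<frown> y) then 1 else 0)"
    using y by auto
next
  fix k assume "(if \<exists>y. u \<frown> y \<in> R \<and> k = enc y then 1 else 0) \<noteq> (0::complex)"
  then obtain y where y: "u \<frown> y \<in> R" "k = enc y" by (auto split: if_splits)
  then have "y \<in> R" using tail_in by blast
  then show "enc (suffix (length u) (dec (enc (u \<frown> dec k)))) = k \<and>
    (if \<exists>y. u \<frown> y \<in> R \<and> enc (u \<frown> dec k) = enc (u \<frown> y) then 1 else 0) =
      cnj (if \<exists>y. u \<frown> y \<in> R \<and> k = enc y then 1 else 0)"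
    using y by auto
qed

lemma coords_shift:
  assumes "x \<in> R"
  shows "coords (shift_op u v) (enc x) = (if \<exists>y. x = u \<frown> y then coords v (enc (suffix (length u) x)) else 0)"
    and "coords (backshift_op u v) (enc x) = (if u \<frown> x \<in> R then coords v (enc (u \<frown> x)) else 0)"
proof -
  have "(\<exists>y. u \<frown> y \<in> R \<and> enc x = enc (u \<frown> y)) \<longleftrightarrow> (\<exists>y. x = u \<frown> y)" using assms by auto
  then show "coords (shift_op u v) (enc x) = (if \<exists>y. x = u \<frown> y then coords v (enc (suffix (length u) x)) else 0)"
    unfolding shift_op_def coords_weighted_op[OF shift_weight] using assms by simp
  have "(\<exists>y. u \<frown> y \<in> R \<and> enc x = enc y) \<longleftrightarrow> u \<frown> x \<in> R" using assms tail_in by auto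
  then show "coords (backshift_op u v) (enc x) = (if u \<frown> x \<in> R then coords v (enc (u \<frown> x)) else 0)"
    unfolding backshift_op_def coords_weighted_op[OF backshift_weight] using assms by simp
qed

lemma coords_mult:
  assumes "\<And>z. cmod (f z) \<le> C" "x \<in> R"
  shows "coords (mult_op f v) (enc x) = f x * coords v (enc x)"
  unfolding mult_op_def coords_weighted_op[OF mult_weight[of f C, OF assms(1)]] using assms(2) by simp

lemma coords_outside:
  assumes "n \<notin> enc ` R"
  shows "coords (shift_op u v) n = 0" "coords (backshift_op u v) n = 0"
    "(\<And>z. cmod (f z) \<le> C) \<Longrightarrow> coords (mult_op f v) n = 0"
proof -
  have no: "\<not> (\<exists>y. u \<frown> y \<in> R \<and> n = enc (u \<frown> y))" "\<not> (\<exists>y. u \<frown> y \<in> R \<and> n = enc y)"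
    using assms tail_in by auto
  show "coords (shift_op u v) n = 0" "coords (backshift_op u v) n = 0"
    unfolding shift_op_def coords_weighted_op[OF shift_weight] backshift_op_def
      coords_weighted_op[OF backshift_weight] by (simp_all only: no if_False mult_zero_left)
  assume "\<And>z. cmod (f z) \<le> C"
  then show "coords (mult_op f v) n = 0"
    unfolding mult_op_def using coords_weighted_op[OF mult_weight[of f C]] assms by simp
qed

lemma vector_eqI:
  assumes "\<And>x. x \<in> R \<Longrightarrow> coords v (enc x) = coords w (enc x)"
    and "\<And>n. n \<notin> enc ` R \<Longrightarrow> coords v n = coords w n"
  shows "v = w"
proof (rule ell2_eqI)
  fix n show "coords v n = coords w n"
    by (cases "n \<in> enc ` R") (use assms in auto)
qed

lemma shift_shift: "shift_op u o\<^sub>L shift_op v = shift_op (u @ v)"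
proof (rule blinfun_eqI, rule vector_eqI)
  fix w x assume x: "x \<in> R"
  show "coords ((shift_op u o\<^sub>L shift_op v) w) (enc x) = coords (shift_op (u @ v) w) (enc x)"
  proof (cases "\<exists>y. x = u \<frown> y")
    case True
    then obtain y where y: "x = u \<frown> y" by blast
    then have "y \<in> R" using x tail_in by blast
    moreover have "suffix (length (u @ v)) x = suffix (length v) y"
      unfolding y by (simp add: suffix_suffix[symmetric] del: suffix_suffix)
    moreover have "(\<exists>z. x = (u @ v) \<frown> z) \<longleftrightarrow> (\<exists>z. y = v \<frown> z)"
      unfolding y conc_conc[symmetric] conc_inject ..
    ultimately show ?thesis using x y by (simp add: coords_shift)
  next
    case False
    have "(u @ v) \<frown> z = u \<frown> (v \<frown> z)" for z by simp
    then have "\<not> (\<exists>z. x = (u @ v) \<frown> z)" using False by metis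
    then show ?thesis using x False by (simp add: coords_shift)
  qed
qed (simp add: coords_outside)

lemma backshift_shift: "backshift_op u o\<^sub>L shift_op u = mult_op (\<lambda>x. if u \<frown> x \<in> R then 1 else 0)"
proof (rule blinfun_eqI, rule vector_eqI)
  have le: "cmod (if u \<frown> x \<in> R then 1 else 0) \<le> 1" for x by simp
  fix w
  show "coords ((backshift_op u o\<^sub>L shift_op u) w) (enc x) =
      coords (mult_op (\<lambda>x. if u \<frown> x \<in> R then 1 else 0) w) (enc x)" if x: "x \<in> R" for x
    using x by (simp add: coords_shift coords_mult[OF le])
  show "coords ((backshift_op u o\<^sub>L shift_op u) w) n = coords (mult_op (\<lambda>x. if u \<frown> x \<in> R then 1 else 0) w) n"
    if "n \<notin> enc ` R" for n
    using that by (simp add: coords_outside coords_outside(3)[OF _ le])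
qed

text \<open>A coordinate survives exactly at those x = v y for which u y lies in \<open>R\<close>.
  As \<open>R\<close> contains every admissible prolongation of y, this is admissibility of u y, the
  condition that defines the cylinder.\<close>

lemma shift_cyl:
  "shift_op v o\<^sub>L backshift_op u o\<^sub>L shift_op u o\<^sub>L backshift_op v = mult_op (indicator (cyl X u v))"
proof (rule blinfun_eqI, rule vector_eqI)
  have le: "cmod (indicator (cyl X u v) x) \<le> 1" for x by (simp add: indicator_def)
  fix w
  show "coords ((shift_op v o\<^sub>L backshift_op u o\<^sub>L shift_op u o\<^sub>L backshift_op v) w) (enc x) =
      coords (mult_op (indicator (cyl X u v)) w) (enc x)" if x: "x \<in> R" for x
  proof (cases "\<exists>y. x = v \<frown> y")
    case True
    then obtain y where y: "x = v \<frown> y" by blast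
    then have "y \<in> R" using x tail_in by blast
    moreover have "x \<in> cyl X u v \<longleftrightarrow> u \<frown> y \<in> R"
      using x y rays \<open>y \<in> R\<close> prepend_in by (auto simp: cyl_def)
    ultimately show ?thesis using x y by (simp add: coords_shift coords_mult[OF le] indicator_def)
  next
    case False
    then have "x \<notin> cyl X u v" by (auto simp: cyl_def)
    then show ?thesis using x False by (simp add: coords_shift coords_mult[OF le])
  qed
  show "coords ((shift_op v o\<^sub>L backshift_op u o\<^sub>L shift_op u o\<^sub>L backshift_op v) w) n =
      coords (mult_op (indicator (cyl X u v)) w) n" if "n \<notin> enc ` R" for n
    using that by (simp add: coords_outside coords_outside(3)[OF _ le])
qed

lemma shift_backshift_shift: "shift_op u o\<^sub>L backshift_op u o\<^sub>L shift_op u = shift_op u"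
proof (rule blinfun_eqI, rule vector_eqI)
  fix w x assume x: "x \<in> R"
  show "coords ((shift_op u o\<^sub>L backshift_op u o\<^sub>L shift_op u) w) (enc x) = coords (shift_op u w) (enc x)"
  proof (cases "\<exists>y. x = u \<frown> y")
    case True
    then obtain y where "x = u \<frown> y" by blast
    moreover from this have "y \<in> R" using x tail_in by blast
    ultimately show ?thesis using x by (simp add: coords_shift)
  qed (use x in \<open>simp add: coords_shift\<close>)
qed (simp add: coords_outside)

lemma weighted_op_complex_linear:
  "injective_weight c \<rho> \<Longrightarrow> weighted_op c \<rho> (complex_scale a x) = complex_scale a (weighted_op c \<rho> x)"
  by (rule ell2_eqI) (simp add: coords_weighted_op)

lemma shift_op_in: "shift_op u \<in> ell2_operators"
  by (rule ell2_operatorsI[OF _ adjoint_shift]) (simp add: shift_op_def weighted_op_complex_linear shift_weight)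

lemma adjoint_op_shift: "adjoint_op (shift_op u) = backshift_op u"
  by (rule adjoint_op_eqI[OF adjoint_shift])

lemma adjoint_mult:
  assumes f: "\<And>z. cmod (f z) \<le> C"
  shows "adjoint_pair (mult_op f) (mult_op (\<lambda>z. cnj (f z)))"
  unfolding adjoint_pair_def mult_op_def
proof (intro allI weighted_op_adjoint)
  show "injective_weight (\<lambda>n. if n \<in> enc ` R then f (dec n) else 0) id"
    by (rule mult_weight[OF f])
  show "injective_weight (\<lambda>n. if n \<in> enc ` R then cnj (f (dec n)) else 0) id"
    by (rule mult_weight[of "\<lambda>z. cnj (f z)" C]) (simp add: f)
qed auto

lemma mult_op_in:
  assumes f: "\<And>z. cmod (f z) \<le> C" shows "mult_op f \<in> ell2_operators"
proof (rule ell2_operatorsI[OF _ adjoint_mult[OF f]])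
  show "mult_op f (complex_scale a x) = complex_scale a (mult_op f x)" for a x
    unfolding mult_op_def by (rule weighted_op_complex_linear[OF mult_weight[OF f]])
qed

lemma norm_mult_op_le:
  assumes "\<And>z. cmod (f z) \<le> C"
  shows "norm (mult_op f) \<le> C"
  unfolding mult_op_def using order_trans[OF norm_ge_zero assms] assms
  by (intro norm_weighted_op_le) auto

lemma mult_op_algebra:
  assumes f: "\<And>z. cmod (f z) \<le> C" and g: "\<And>z. cmod (g z) \<le> D"
  shows "mult_op (\<lambda>z. f z + g z) = mult_op f + mult_op g"
    "mult_op (\<lambda>z. f z * g z) = mult_op f o\<^sub>L mult_op g"
    "mult_op (\<lambda>z. a * f z) = complex_scale a o\<^sub>L mult_op f"
proof -
  have fg: "cmod (f z + g z) \<le> C + D" "cmod (f z * g z) \<le> C * D" "cmod (a * f z) \<le> cmod a * C" for z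
    using f[of z] g[of z] order_trans[OF norm_ge_zero f[of z]]
    by (auto simp: norm_mult intro: norm_triangle_le mult_mono mult_left_mono)
  note [simp] = coords_mult[of f C, OF f] coords_mult[of g D, OF g] coords_outside(3)[of _ f C, OF _ f]
    coords_outside(3)[of _ g D, OF _ g] plus_ell2.rep_eq blinfun.add_left distrib_right
  show "mult_op (\<lambda>z. f z + g z) = mult_op f + mult_op g"
    by (rule blinfun_eqI, rule vector_eqI) (simp_all add: coords_mult[OF fg(1)] coords_outside(3)[OF _ fg(1)])
  show "mult_op (\<lambda>z. f z * g z) = mult_op f o\<^sub>L mult_op g"
    by (rule blinfun_eqI, rule vector_eqI) (simp_all add: coords_mult[OF fg(2)] coords_outside(3)[OF _ fg(2)])
  show "mult_op (\<lambda>z. a * f z) = complex_scale a o\<^sub>L mult_op f"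
    by (rule blinfun_eqI, rule vector_eqI) (simp_all add: coords_mult[OF fg(3)] coords_outside(3)[OF _ fg(3)])
qed

text \<open>The functions whose multiplication operator lies in \<open>H\<close> form a
  C*-subalgebra, closed because the sup norm bounds the operator norm. Boundedness of
  \<open>f\<close> is carried along since the rules for \<open>mult_op\<close> presuppose
  it.\<close>

lemma mult_op_in_generated:
  assumes H: "cstar_subalgebra ell2_algebra H" "shift_op ` lists A \<subseteq> H"
    and f: "f \<in> carr (cyl_algebra A X)"
  shows "f \<in> carr (bounded_functions (right_rays X)) \<and> mult_op f \<in> H"
proof -
  define BF where "BF = bounded_functions (right_rays X)"
  define G where "G = {f \<in> carr BF. mult_op f \<in> H}"
  have bound: "cmod (f z) \<le> nrm BF f" if "f \<in> carr BF" for f z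
    using nrm_bounded_functions_ge(1) that unfolding BF_def .
  have clo: "(\<lambda>z. f z + g z) \<in> carr BF" "(\<lambda>z. a * f z) \<in> carr BF"
    "(\<lambda>z. f z * g z) \<in> carr BF" "(\<lambda>z. cnj (f z)) \<in> carr BF"
    if "f \<in> carr BF" "g \<in> carr BF" for f g a
    unfolding BF_def by (rule bounded_functions_closed[OF that[unfolded BF_def]])+
  have Hc: "S + T \<in> H" "S o\<^sub>L T \<in> H" if "S \<in> H" "T \<in> H" for S T
    using H(1) that unfolding cstar_subalgebra_def by auto
  have Hs: "adjoint_op S \<in> H" "complex_scale a o\<^sub>L S \<in> H" if "S \<in> H" for S a
    using H(1) that unfolding cstar_subalgebra_def by auto
  have "0 \<in> H" using H(1) unfolding cstar_subalgebra_def by auto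
  have "mult_op (\<lambda>_. 0) = 0" using mult_op_algebra(3)[of "\<lambda>_. 0" 0 "\<lambda>_. 0" 0 0] norm_mult_op_le[of "\<lambda>_. 0" 0] by simp
  have "norm_closed BF G"
    unfolding norm_closed_def
  proof (intro allI impI)
    fix \<sigma> l assume s: "range \<sigma> \<subseteq> G" and l: "l \<in> carr BF" "(\<lambda>n. dst BF (\<sigma> n) l) \<longlonglongrightarrow> 0"
    have sc: "\<sigma> n \<in> carr BF" "mult_op (\<sigma> n) \<in> H" for n using s by (auto simp: G_def)
    have "norm (mult_op (\<sigma> n) - mult_op l) \<le> dst BF (\<sigma> n) l" for n
    proof -
      have d: "(\<lambda>z. \<sigma> n z + - 1 * l z) \<in> carr BF" by (rule clo(1)[OF sc(1) clo(2)[OF l(1) l(1)]])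
      have "mult_op (\<sigma> n) - mult_op l = mult_op (\<lambda>z. \<sigma> n z + - 1 * l z)"
        using mult_op_algebra(1)[OF bound[OF sc(1)[of n]] bound[OF clo(2)[OF l(1) l(1), of "-1"]]]
          mult_op_algebra(3)[OF bound[OF l(1)] bound[OF l(1)], of "-1"]
        by (simp add: complex_scale_minus_compose)
      also have "norm \<dots> \<le> nrm BF (\<lambda>z. \<sigma> n z + - 1 * l z)" by (rule norm_mult_op_le[OF bound[OF d]])
      finally show ?thesis by (simp add: dst_def BF_def)
    qed
    then have "(\<lambda>n. norm (mult_op (\<sigma> n) - mult_op l)) \<longlonglongrightarrow> 0"
      by (intro Lim_null_comparison[OF _ l(2)]) simp
    then have "mult_op l \<in> H"
      using H(1) sc(2) mult_op_in[OF bound[OF l(1)]]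
      unfolding cstar_subalgebra_def norm_closed_def
      by (auto simp: dst_ell2_algebra dest!: spec[of _ "\<lambda>n. mult_op (\<sigma> n)"] spec[of _ "mult_op l"])
    then show "l \<in> G" using l by (simp add: G_def)
  qed
  moreover have "(\<lambda>z. f z + g z) \<in> G" "(\<lambda>z. f z * g z) \<in> G" "(\<lambda>z. a * f z) \<in> G" "(\<lambda>z. cnj (f z)) \<in> G"
    if "f \<in> G" "g \<in> G" for f g a
  proof -
    have fg: "f \<in> carr BF" "g \<in> carr BF" "mult_op f \<in> H" "mult_op g \<in> H" using that by (auto simp: G_def)
    note eq = mult_op_algebra[OF bound[OF fg(1)] bound[OF fg(2)]]
    show "(\<lambda>z. f z + g z) \<in> G" "(\<lambda>z. f z * g z) \<in> G" "(\<lambda>z. a * f z) \<in> G"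
      unfolding G_def mem_Collect_eq eq using clo[OF fg(1,2)] Hc[OF fg(3,4)] Hs(2)[OF fg(3)] by blast+
    have "mult_op (\<lambda>z. cnj (f z)) = adjoint_op (mult_op f)"
      using adjoint_op_eqI[OF adjoint_mult[OF bound[OF fg(1)]]] by simp
    then show "(\<lambda>z. cnj (f z)) \<in> G"
      unfolding G_def using clo(4)[OF fg(1,2)] Hs(1)[OF fg(3)] by simp
  qed
  moreover have "(\<lambda>_. 0) \<in> G" using \<open>0 \<in> H\<close> \<open>mult_op (\<lambda>_. 0) = 0\<close> by (auto simp: G_def BF_def bounded_iff intro!: exI[of _ 0])
  moreover have "G \<subseteq> carr BF" by (auto simp: G_def)
  ultimately have "cstar_subalgebra BF G"
    unfolding cstar_subalgebra_def by (simp add: BF_def)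
  moreover have "{indicator (cyl X u v) | u v. u \<in> lists A \<and> v \<in> lists A} \<subseteq> G"
  proof
    fix f :: "(nat \<Rightarrow> 'a) \<Rightarrow> complex" assume "f \<in> {indicator (cyl X u v) | u v. u \<in> lists A \<and> v \<in> lists A}"
    then obtain u v where uv: "u \<in> lists A" "v \<in> lists A" and f: "f = indicator (cyl X u v)" by blast
    then have "shift_op u \<in> H" "shift_op v \<in> H" using H(2) by auto
    then have "mult_op (indicator (cyl X u v)) \<in> H"
      unfolding shift_cyl[symmetric] adjoint_op_shift[symmetric] by (simp add: Hc(2) Hs(1))
    moreover have "indicator (cyl X u v) \<in> carr BF"
      by (auto simp: BF_def bounded_iff indicator_def cyl_def intro!: exI[of _ 1])
    ultimately show "f \<in> G" by (simp add: G_def f)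
  qed
  ultimately have "f \<in> G" using f unfolding cyl_algebra_def cstar_generated_def BF_def by auto
  then show ?thesis by (simp add: G_def BF_def)
qed

lemma matsumoto_family_shift: "matsumoto_family A X ell2_algebra shift_op"
  unfolding matsumoto_family_def
proof (intro conjI ballI exI[of _ mult_op])
  interpret E: cstar_algebra ell2_algebra by (rule cstar_algebra_ell2)
  show "partial_isometry ell2_algebra (shift_op u)" for u
    by (simp add: partial_isometry_def shift_op_in adjoint_op_shift shift_backshift_shift)
  show "mul ell2_algebra (shift_op u) (shift_op v) = shift_op (u @ v)" for u v
    by (simp add: shift_shift)
  show "mult_op (indicator (cyl X u v)) = mul ell2_algebra (mul ell2_algebra (mul ell2_algebra (shift_op v)
      (adj ell2_algebra (shift_op u))) (shift_op u)) (adj ell2_algebra (shift_op v))" for u v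
    by (simp add: adjoint_op_shift shift_cyl)
  \<comment> \<open>Taking all operators for \<open>H\<close> extracts from
    \<open>mult_op_in_generated\<close> the boundedness of the functions in
    \<open>cyl_algebra\<close>.\<close>
  have "norm_closed ell2_algebra ell2_operators" unfolding norm_closed_def by simp
  then have whole: "cstar_subalgebra ell2_algebra ell2_operators"
    unfolding cstar_subalgebra_def
    using E.zer_closed E.add_closed E.mul_closed E.adj_closed E.scl_closed by simp
  have car: "f \<in> carr (bounded_functions (right_rays X))" if "f \<in> carr (cyl_algebra A X)" for f
    using mult_op_in_generated[OF whole _ that] shift_op_in by blast
  have bound: "cmod (f z) \<le> nrm (bounded_functions (right_rays X)) f" if "f \<in> carr (cyl_algebra A X)" for f z
    by (rule nrm_bounded_functions_ge(1)[OF car[OF that]])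
  have ops: "add (cyl_algebra A X) f g = (\<lambda>z. f z + g z)" "mul (cyl_algebra A X) f g = (\<lambda>z. f z * g z)"
    "scl (cyl_algebra A X) a f = (\<lambda>z. a * f z)" "adj (cyl_algebra A X) f = (\<lambda>z. cnj (f z))" for f g a
    by (simp_all add: cyl_algebra_def cstar_generated_def)
  have ops': "add (cstar_generated ell2_algebra G) = (+)" "mul (cstar_generated ell2_algebra G) = (o\<^sub>L)"
    "scl (cstar_generated ell2_algebra G) a T = complex_scale a o\<^sub>L T" 
    "adj (cstar_generated ell2_algebra G) = adjoint_op" for G a T
    by (simp_all add: cstar_generated_def)
  show "star_hom (cyl_algebra A X) (cstar_generated ell2_algebra (shift_op ` lists A)) mult_op"
    unfolding star_hom_def ops ops'
  proof (intro conjI ballI allI)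
    show "mult_op ` carr (cyl_algebra A X) \<subseteq> carr (cstar_generated ell2_algebra (shift_op ` lists A))"
      using mult_op_in_generated by (auto simp: cstar_generated_def)
    show "mult_op (\<lambda>z. cnj (f z)) = adjoint_op (mult_op f)" if "f \<in> carr (cyl_algebra A X)" for f
      using adjoint_op_eqI[OF adjoint_mult[OF bound[OF that]]] by simp
  qed (rule mult_op_algebra[OF bound bound]; assumption)+
qed

lemma mult_op_nonzero:
  assumes "\<And>z. cmod (f z) \<le> C" "x \<in> R" "f x \<noteq> 0"
  shows "mult_op f \<noteq> 0"
proof
  \<comment> \<open>The basis vector of \<open>x\<close> detects the value
    \<open>f x\<close>.\<close>
  define d where "d = (\<lambda>n. if n = enc x then 1 else (0::complex))"
  have "square_summable d" unfolding square_summable_def d_def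
    by (rule summable_finite[of "{enc x}"]) auto
  then have d: "coords (Abs_ell2 d) = d" by (simp add: Abs_ell2_inverse)
  have "coords (Abs_ell2 d) (enc x) = 1" unfolding d by (simp add: d_def)
  then have "coords (mult_op f (Abs_ell2 d)) (enc x) = f x" by (simp add: coords_mult[OF assms(1,2)])
  moreover assume "mult_op f = 0"
  ultimately show False using assms(3) by (simp add: zero_ell2.rep_eq)
qed

lemma mult_op_zero:
  assumes "\<And>x. x \<in> R \<Longrightarrow> f x = 0"
  shows "mult_op f = 0"
proof -
  have "(\<lambda>n. if n \<in> enc ` R then f (dec n) else 0) = (\<lambda>_. 0)" using assms by (auto simp: fun_eq_iff)
  moreover have "norm (weighted_op (\<lambda>_. 0) id) \<le> 0" by (rule norm_weighted_op_le) auto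
  ultimately show ?thesis by (simp add: mult_op_def)
qed

text \<open>In this form the image of the unit is seen to be nonzero as soon as \<open>R\<close> is
  nonempty.\<close>

lemma shift_op_Nil: "shift_op [] = mult_op (\<lambda>_. 1)"
proof (rule blinfun_eqI, rule vector_eqI)
  have le: "cmod 1 \<le> 1" by simp
  fix w n
  show "coords (shift_op [] w) (enc x) = coords (mult_op (\<lambda>_. 1) w) (enc x)" if "x \<in> R" for x
    using that by (simp add: coords_shift coords_mult[of "\<lambda>_. 1", OF le])
  show "coords (shift_op [] w) n = coords (mult_op (\<lambda>_. 1) w) n" if "n \<notin> enc ` R"
    using that by (simp add: coords_outside coords_outside(3)[of _ "\<lambda>_. 1", OF _ le])
qed

definition target :: "test_carrier star_algebra" where
  "target = transport_algebra embed_operator ell2_algebra"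

lemma cstar_algebra_target: "cstar_algebra target"
  unfolding target_def by (rule cstar_algebra_transport[OF cstar_algebra_ell2 inj_embed_operator])

lemma zer_target: "zer target = embed_operator 0"
  by (simp add: target_def transport_algebra_simps[OF inj_embed_operator])

lemma universal_representation:
  assumes "matsumoto_algebra A X M S"
  obtains \<psi> where "star_hom M target \<psi>" "\<forall>u\<in>lists A. \<psi> (S u) = embed_operator (shift_op u)"
proof -
  have "matsumoto_family A X target (embed_operator \<circ> shift_op)"
    unfolding target_def by (rule matsumoto_family_transport[OF matsumoto_family_shift inj_embed_operator])
  then show ?thesis
    using assms cstar_algebra_target that unfolding matsumoto_algebra_def by (metis comp_apply)
qed

text \<open>Each factor is the initial projection of a generator, and multiplication operators
  multiply pointwise.\<close>

lemma representation_range_product: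
  assumes \<psi>: "star_hom M target \<psi>" "\<forall>u\<in>lists A. \<psi> (S u) = embed_operator (shift_op u)"
    and M: "cstar_algebra M" and u: "u \<in> lists A" "v \<in> lists A" "S u \<in> carr M" "S v \<in> carr M"
  shows "\<psi> (mul M (mul M (adj M (S u)) (S u)) (mul M (adj M (S v)) (S v))) =
    embed_operator (mult_op (\<lambda>x. if u \<frown> x \<in> R \<and> v \<frown> x \<in> R then 1 else 0))"
proof -
  interpret M: cstar_algebra M by (rule M)
  note t = transport_algebra_simps[OF inj_embed_operator, of ell2_algebra, folded target_def, simplified]
  have h: "\<psi> (mul M x y) = mul target (\<psi> x) (\<psi> y)" "\<psi> (adj M x) = adj target (\<psi> x)"
    if "x \<in> carr M" "y \<in> carr M" for x y
    using \<psi>(1) that by (auto simp: star_hom_def)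
  have "\<psi> (mul M (mul M (adj M (S u)) (S u)) (mul M (adj M (S v)) (S v))) =
      mul target (mul target (adj target (\<psi> (S u))) (\<psi> (S u))) (mul target (adj target (\<psi> (S v))) (\<psi> (S v)))"
    using u(3,4) by (simp add: h M.mul_closed M.adj_closed)
  also have "\<dots> = embed_operator ((backshift_op u o\<^sub>L shift_op u) o\<^sub>L (backshift_op v o\<^sub>L shift_op v))"
    by (simp add: \<psi>(2) u(1,2) t adjoint_op_shift del: in_lists_conv_set)
  also have "(backshift_op u o\<^sub>L shift_op u) o\<^sub>L (backshift_op v o\<^sub>L shift_op v) =
      mult_op (\<lambda>x. (if u \<frown> x \<in> R then 1 else 0) * (if v \<frown> x \<in> R then 1 else 0))"
    unfolding backshift_shift by (rule mult_op_algebra(2)[symmetric, of _ 1 _ 1]) simp_all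
  also have "(\<lambda>x. (if u \<frown> x \<in> R then 1 else 0) * (if v \<frown> x \<in> R then 1 else 0)) =
      (\<lambda>x. if u \<frown> x \<in> R \<and> v \<frown> x \<in> R then 1 else (0::complex))" by auto
  finally show ?thesis .
qed

end

section \<open>Tail classes of rays\<close>

definition tail_class :: "(int \<Rightarrow> 'a) set \<Rightarrow> (nat \<Rightarrow> 'a) \<Rightarrow> (nat \<Rightarrow> 'a) set" where
  "tail_class X r = right_rays X \<inter> {w \<frown> suffix j r | w j. True}"

text \<open>With truncated subtraction one formula covers both cases, a cut inside \<open>w\<close>
  and a cut beyond it.\<close>

lemma suffix_conc_drop: "suffix k (w \<frown> y) = drop k w \<frown> suffix (k - length w) y"
  by (rule ext) (auto simp: conc_def intro!: arg_cong[where f = y])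

context closed_shift
begin

lemma right_ray_word_lists: "w \<frown> y \<in> right_rays X \<Longrightarrow> w \<in> lists A"
  using language_lists right_ray_prefix[of "w \<frown> y" "length w + 0"] unfolding prefix_conc by simp

lemma self_tail_class: "r \<in> right_rays X \<Longrightarrow> r \<in> tail_class X r"
  unfolding tail_class_def by (auto intro!: exI[of _ "[]"] exI[of _ 0])

lemma ray_representation_tail_class: "ray_representation A X (tail_class X r)"
proof
  show "tail_class X r \<subseteq> right_rays X" by (auto simp: tail_class_def)
  \<comment> \<open>A ray of the class is determined by a finite word over \<open>A\<close> and a
    starting index, which gives countability.\<close>
  have "tail_class X r \<subseteq> (\<lambda>(w, j). w \<frown> suffix j r) ` (lists A \<times> UNIV)"
  proof
    fix x assume "x \<in> tail_class X r"
    then obtain w j where wj: "x = w \<frown> suffix j r" "w \<frown> suffix j r \<in> right_rays X"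
      by (auto simp: tail_class_def)
    have "w \<in> lists A" by (rule right_ray_word_lists[OF wj(2)])
    then show "x \<in> (\<lambda>(w, j). w \<frown> suffix j r) ` (lists A \<times> UNIV)"
      unfolding wj(1) by (intro image_eqI[of _ _ "(w, j)"]) simp_all
  qed
  moreover have "countable (lists A \<times> (UNIV :: nat set))"
    using countable_lists[OF countable_finite[OF finite_alphabet]] by (intro countable_SIGMA) auto
  ultimately show "countable (tail_class X r)" by (meson countable_image countable_subset)
  show "u \<frown> x \<in> tail_class X r" if "x \<in> tail_class X r" "u \<frown> x \<in> right_rays X" for x u
    using that unfolding tail_class_def by force
  show "x \<in> tail_class X r" if x: "u \<frown> x \<in> tail_class X r" for x u
  proof -
    obtain w j where wj: "u \<frown> x = w \<frown> suffix j r" using x by (auto simp: tail_class_def)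
    have "x = suffix (length u) (u \<frown> x)" by (rule ext) simp
    also have "\<dots> = drop (length u) w \<frown> suffix (j + (length u - length w)) r"
      unfolding wj suffix_conc_drop by simp
    finally show ?thesis using x right_ray_conc_tail unfolding tail_class_def by blast
  qed
qed

text \<open>Every ray of the class runs into a copy of \<open>W\<close> after finitely many letters;
  these letters form \<open>p\<close>, and the same \<open>p\<close> serves \<open>u\<close> and
  \<open>u'\<close>.\<close>

lemma tail_class_recurrent:
  assumes rec: "\<forall>n. \<exists>i\<ge>n. r [i \<rightarrow> i + length W] = W"
    and x: "x \<in> tail_class X r" and u: "u \<frown> x \<in> right_rays X" "u' \<frown> x \<in> right_rays X"
  shows "\<exists>p. u @ p @ W \<in> language X \<and> u' @ p @ W \<in> language X"
proof -
  obtain w j where w: "x = w \<frown> suffix j r" using x by (auto simp: tail_class_def)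
  obtain i where i: "i \<ge> j" "r [i \<rightarrow> i + length W] = W" using rec by blast
  have "prefix (i - j + length W) (suffix j r) = r [j \<rightarrow> i + length W]"
    using i(1) by (intro nth_equalityI) (auto simp: add.commute)
  also have "\<dots> = r [j \<rightarrow> i] @ r [i \<rightarrow> i + length W]"
    unfolding subsequence_def map_append[symmetric] using i(1)
    by (metis le_add1 upt_add_eq_append le_add_diff_inverse)
  finally have "prefix (length w + (i - j + length W)) x = w @ r [j \<rightarrow> i] @ W"
    unfolding w prefix_conc i(2) by simp
  then have "prefix (length v + (length w + (i - j + length W))) (v \<frown> x) = v @ (w @ r [j \<rightarrow> i]) @ W" for v
    unfolding prefix_conc by simp
  then show ?thesis using right_ray_prefix u by metis
qed

end

theorem corollary4p7:
  fixes A :: "'a set" and X :: "(int \<Rightarrow> 'a) set"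
    and M :: "'c star_algebra" and S :: "'a list \<Rightarrow> 'c"
  assumes "shift_space A X"
    and "irreducible_shift X"
    and "strictly_sofic A X"
    and "AFT A X"
    and "matsumoto_algebra A X M S"
  shows "\<not> simple_cstar M"
proof -
  interpret closed_shift A X using assms(1) by (rule shift_space_closed_shift)
  interpret M: cstar_algebra M using assms(5) by (simp add: matsumoto_algebra_def)
  have "\<not> SFT A X" using assms(3) by (simp add: strictly_sofic_def)
  then obtain u u' z W where W: "W \<in> language X" "W \<noteq> []"
    and z: "u \<frown> z \<in> right_rays X" "u' \<frown> z \<in> right_rays X"
    and no: "\<not> (\<exists>p. u @ p @ W \<in> language X \<and> u' @ p @ W \<in> language X)"
    using not_SFT_witness[OF assms(1,2) _ assms(4)] by metis
  obtain r where r: "r \<in> right_rays X" "\<forall>n. \<exists>i\<ge>n. r [i \<rightarrow> i + length W] = W"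
    using recurrent_ray[OF assms(2) W] .
  have u: "u \<in> lists A" "u' \<in> lists A" using z right_ray_word_lists by blast+
  have fam: "matsumoto_family A X M S" and gen: "carr (cstar_generated M (S ` lists A)) = carr M"
    using assms(5) by (simp_all add: matsumoto_algebra_def)
  have S: "partial_isometry M (S w)" "S w \<in> carr M" if "w \<in> lists A" for w
    using fam that by (auto simp: matsumoto_family_def partial_isometry_def)
  have SS: "mul M (S v) (S w) = S (v @ w)" if "v \<in> lists A" "w \<in> lists A" for v w
    using fam that by (auto simp: matsumoto_family_def)
  have nil: "[] \<in> lists A" by simp
  \<comment> \<open>The generator of the empty word is idempotent, hence self-adjoint, and it fixes
    all generators from both sides; so it is the unit.\<close>
  have "adj M (S []) = S []"
    using M.idempotent_partial_isometry_self_adjoint[OF S(1)[OF nil]] SS[OF nil nil] by simp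
  then have unit: "mul M (S []) x = x" if "x \<in> carr M" for x
    by (rule M.unit_of_generators(1)[OF gen S(2)[OF nil] _ _ _ that])
      (use S(2) SS[OF nil] SS[OF _ nil] in \<open>auto simp del: in_lists_conv_set\<close>)
  \<comment> \<open>The product of the initial projections of the two generators; in a
    representation on rays it projects onto those that both \<open>u\<close> and \<open>u'\<close>
    may precede.\<close>
  define a where "a = mul M (mul M (adj M (S u)) (S u)) (mul M (adj M (S u')) (S u'))"
  have a: "a \<in> carr M" using S(2) u by (simp add: a_def M.mul_closed M.adj_closed)

  \<comment> \<open>On the tail class of \<open>z\<close> this projection does not vanish, since
    \<open>z\<close> itself may be preceded by both words.\<close>
  interpret R1: ray_representation A X "tail_class X z" by (rule ray_representation_tail_class)
  obtain \<psi>1 where \<psi>1: "star_hom M R1.target \<psi>1"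
    "\<forall>u\<in>lists A. \<psi>1 (S u) = embed_operator (R1.shift_op u)"
    using R1.universal_representation[OF assms(5)] .
  have "z \<in> tail_class X z" using z right_ray_conc_tail self_tail_class by blast
  then have "R1.mult_op (\<lambda>x. if u \<frown> x \<in> tail_class X z \<and> u' \<frown> x \<in> tail_class X z then 1 else 0) \<noteq> 0"
    using R1.prepend_in z by (intro R1.mult_op_nonzero[of _ 1 z]) auto
  then have "\<psi>1 a \<noteq> zer R1.target"
    using R1.representation_range_product[OF \<psi>1 M.cstar_algebra_axioms u S(2)[OF u(1)] S(2)[OF u(2)]]
    unfolding a_def R1.zer_target by (simp add: inj_eq[OF inj_embed_operator])
  have "a \<noteq> zer M"
  proof
    assume "a = zer M"
    then have "a = scl M 0 a" using M.scl_0[OF a] by simp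
    then have "\<psi>1 a = scl R1.target 0 (\<psi>1 a)" "\<psi>1 a \<in> carr R1.target"
      using \<psi>1(1) a unfolding star_hom_def by (metis, blast)
    then show False
      using cstar_algebra.scl_0[OF R1.cstar_algebra_target] \<open>\<psi>1 a \<noteq> zer R1.target\<close> by metis
  qed

  \<comment> \<open>On the tail class of \<open>r\<close> every ray runs into \<open>W\<close>, so
    none can be preceded by both words: \<open>a\<close> goes to 0 while the unit does not.\<close>
  interpret R2: ray_representation A X "tail_class X r" by (rule ray_representation_tail_class)
  obtain \<psi>2 where \<psi>2: "star_hom M R2.target \<psi>2"
    "\<forall>u\<in>lists A. \<psi>2 (S u) = embed_operator (R2.shift_op u)"
    using R2.universal_representation[OF assms(5)] .
  have "R2.mult_op (\<lambda>x. if u \<frown> x \<in> tail_class X r \<and> u' \<frown> x \<in> tail_class X r then 1 else 0) = 0"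
  proof (rule R2.mult_op_zero)
    fix x assume "x \<in> tail_class X r"
    then have "\<not> (u \<frown> x \<in> tail_class X r \<and> u' \<frown> x \<in> tail_class X r)"
      using tail_class_recurrent[OF r(2)] no R2.rays by blast
    then show "(if u \<frown> x \<in> tail_class X r \<and> u' \<frown> x \<in> tail_class X r then 1 else 0) = (0::complex)"
      by (rule if_not_P)
  qed
  then have "\<psi>2 a = zer R2.target"
    using R2.representation_range_product[OF \<psi>2 M.cstar_algebra_axioms u S(2)[OF u(1)] S(2)[OF u(2)]]
    unfolding a_def R2.zer_target by simp
  have "R2.mult_op (\<lambda>_. 1) \<noteq> 0"
    using self_tail_class[OF r(1)] by (intro R2.mult_op_nonzero[of _ 1 r]) auto
  then have "\<psi>2 (S []) \<noteq> zer R2.target"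
    unfolding \<psi>2(2)[THEN bspec, OF nil] R2.shift_op_Nil R2.zer_target by (simp add: inj_eq[OF inj_embed_operator])
  then show ?thesis
    using M.not_simple_if_noninjective_hom[OF R2.cstar_algebra_target \<psi>2(1) S(2)[OF nil] unit _ a]
      \<open>a \<noteq> zer M\<close> \<open>\<psi>2 a = zer R2.target\<close> by blast
qed

end
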